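(* Let $(B,g_B)$ and $(F,g_F)$ be two non-degenerate semi-Riemannian manifolds, $b\in C^\infty(B\times F)$, and suppose $db=0$ at all points where $b=0$. Let $P\in\Gamma(TB)$ and let $\widehat R$ be the semi-symmetric non-metric curvature, with respect to $P$, of the twisted product $B\times_bF$. For all $X,Y,Z,T\in\Gamma(TB)$ and $U,V,W,Q\in\Gamma(TF)$: (1) $\widehat R(X,Y,Z,T)=\widehat R_B(X,Y,Z,T)$; (2) $\widehat R(X,Y,Z,W)=\widehat R(X,Y,W,Z)=\widehat R(Z,W,X,Y)=0$; (3) $\widehat R(X,Y,V,W)=\widehat R(V,W,X,Y)=0$; (4) $\widehat R(V,X,W,Y)=-\widehat R(X,V,W,Y)=bXY(b)g_F(V,W)-bg_B^*(\nabla^\flat_XY,db)g_F(V,W)-2bX(b)g_B(Y,P)g_F(V,W)$; (5) $\widehat R(V,X,Y,W)=-\widehat R(X,V,Y,W)=-bXY(b)g_F(V,W)+bg_B^*(\nabla^\flat_XY,db)g_F(V,W)-b^2X(g_B(Y,P))g_F(V,W)$; (6) $\widehat R(X,U,V,W)=\widehat R(V,W,X,U)=bXV(b)g_F(W,U)-X(b)V(b)g_F(W,U)-bXW(b)g_F(U,V)+X(b)W(b)g_F(U,V)$; (7) $\widehat R(V,W,U,X)=-bXV(b)g_F(W,U)+X(b)V(b)g_F(W,U)+bXW(b)g_F(U,V)-X(b)W(b)g_F(U,V)-2bW(b)g_B(X,P)g_F(U,V)+2bV(b)g_B(X,P)g_F(U,W)+b^2g_B(X,P)\big(\mathcal K_F(W,U,V)-\mathcal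 K_F(V,U,W)\big)$; (8) $\widehat R(U,V,W,Q)=b^2R_F(U,V,W,Q)+\big(b^2g_B^*(db,db)+g_F^*(db,db)\big)\big(g_F(U,W)g_F(V,Q)-g_F(V,W)g_F(U,Q)\big)+\big(bUW(b)-2U(b)W(b)-bg_F^*(\nabla^\flat_UW,db)\big)g_F(V,Q)+\big(bVQ(b)-2V(b)Q(b)-bg_F^*(\nabla^\flat_VQ,db)\big)g_F(U,W)-\big(bVW(b)-2V(b)W(b)-bg_F^*(\nabla^\flat_VW,db)\big)g_F(U,Q)-\big(bUQ(b)-2U(b)Q(b)-bg_F^*(\nabla^\flat_UQ,db)\big)g_F(V,W)$.
   Context: A singular semi-Riemannian manifold $(M,g)$ is a smooth manifold with a smooth symmetric bilinear form $g$ on $TM$, possibly degenerate and of variable signature; it is non-degenerate if $g$ is non-degenerate everywhere. Its Koszul form is $\mathcal K(X,Y,Z)=\frac12\{X(g(Y,Z))+Y(g(Z,X))-Z(g(X,Y))-g(X,[Y,Z])+g(Y,[Z,X])+g(Z,[X,Y])\}$, and $(\nabla^\flat_XY)(Z)=\mathcal K(X,Y,Z)$. Contraction: let $T_p^\bullet M=\{g_p(v,\cdot):v\in T_pM\}\subset T_p^*M$ with inner product $g_p^\bullet(g_p(v,\cdot),g_p(w,\cdot))=g_p(v,w)$. For 1-forms $\omega,\tau$ with values in $T^\bullet M$, $\omega(\bullet)\tau(\bullet)$ is the function $p\mapsto g^\bullet_p(\omega_p,\tau_p)$ on the dense open set where the rank of $g$ is locally constant; it is called smooth if it extends (uniquely)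 to a smooth function on $M$, and then the same symbol denotes the extension. $(M,g)$ is radical-stationary if $\mathcal K(X,Y,\cdot)$ takes values in $T^\bullet M$ for all vector fields $X,Y$, and semi-regular if moreover all $\mathcal K(X,Y,\bullet)\mathcal K(Z,T,\bullet)$ are smooth. On a semi-regular manifold $R(X,Y,Z,T)=X(\mathcal K(Y,Z,T))-Y(\mathcal K(X,Z,T))-\mathcal K([X,Y],Z,T)+\mathcal K(X,Z,\bullet)\mathcal K(Y,T,\bullet)-\mathcal K(Y,Z,\bullet)\mathcal K(X,T,\bullet)$. For a vector field $P$ on $M$, the semi-symmetric non-metric Koszul form is $\widehat{\mathcal K}(X,Y,Z)=\mathcal K(X,Y,Z)+g(Y,P)g(X,Z)$. The semi-symmetric non-metric curvature is $\widehat R(X,Y,Z,T)=(\widehat\nabla_X\widehat\nabla^\flat_YZ)(T)-(\widehat\nabla_Y\widehat\nabla^\flat_XZ)(T)-(\widehat\nabla^\flat_{[X,Y]}Z)(T)$ with $(\widehat\nabla^\flat_XY)(Z)=\widehat{\mathcal K}(X,Y,Z)$ and $(\widehat\nabla_X\omega)(T)=X(\omega(T))-(\widehat\nabla^\flat_XT)(\bullet)\,\omega(\bullet)$; that is, the formula for $R$ with $\mathcal K$ replaced everywhere by $\widehat{\mathcal K}$. Equivalently, $\widehat R(X,Y,Z,T)=R(X,Y,Z,T)+X(g(Z,P))g(Y,T)-Y(g(Z,P))g(X,T)-\widehat{\mathcal K}(Y,Z,X)g(P,T)+\widehat{\mathcal K}(X,Z,Y)g(P,T)$. The twisted product $B\times_bF$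 with twisting function $b:B\times F\to\mathbb R$ (smooth, possibly vanishing) is $B\times F$ with $g=\pi_B^*(g_B)+b^2\pi_F^*(g_F)$, $\pi_B,\pi_F$ the canonical projections. Under the hypotheses of the claim it is semi-regular. Vector fields in $\Gamma(TB)$, $\Gamma(TF)$ are identified with their lifts to the product, and functions and tensors on the factors with their pullbacks. Subscripts $B$, $F$ denote objects of that factor ($\widehat R_B$ uses $P$ on $B$). $g_B^*$, $g_F^*$ are the inverse metrics of $g_B$, $g_F$ applied to the restrictions of 1-forms to $TB$, resp. $TF$; in $g_B^*(\nabla^\flat_XY,db)$ one has $\nabla^\flat_XY=\mathcal K_B(X,Y,\cdot)$, and in $g_F^*(\nabla^\flat_UW,db)$ one has $\nabla^\flat_UW=\mathcal K_F(U,W,\cdot)$. $XY(f)$ means $X(Y(f))$.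
   Formalization: In (7) the last term is proved with the opposite sign, b²g_B(X,P)(K_F(V,U,W) − K_F(W,U,V)); the printed order is false, e.g. for B=ℝ, F=ℝ² flat, b=1, P=X=∂_t, V=∂_x, W=∂_y, U=x∂_y. B and F have dimension at least 1. *)

theory Defs
  imports "HOL-Analysis.Analysis" "HOL-Library.Function_Algebras"
begin

section \<open>Smooth manifolds\<close>

text \<open>Only used for open sets \<open>S\<close>, so that the full derivative at a point of \<open>S\<close>
  does not see the values of \<open>f\<close> outside \<open>S\<close>.\<close>

primrec Ck_on :: "'a::real_normed_vector set \<Rightarrow> ('a \<Rightarrow> 'b::real_normed_vector) \<Rightarrow> nat \<Rightarrow> bool" where
  "Ck_on S f 0 \<longleftrightarrow> continuous_on S f"
| "Ck_on S f (Suc k) \<longleftrightarrow> (\<forall>x\<in>S. f differentiable (at x)) \<and>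
     (\<forall>v. Ck_on S (\<lambda>x. frechet_derivative f (at x) v) k)"

definition smooth_on :: "'a::real_normed_vector set \<Rightarrow> ('a \<Rightarrow> 'b::real_normed_vector) \<Rightarrow> bool" where
  "smooth_on S f \<longleftrightarrow> (\<forall>k. Ck_on S f k)"

text \<open>A manifold is a whole type \<open>'m\<close> together with a smooth atlas; a chart is a pair of a
  domain and a coordinate map, whose values outside the domain are irrelevant.\<close>

type_synonym ('m, 'e) atlas = "('m set \<times> ('m \<Rightarrow> 'e)) set"

definition smooth_manifold ::
  "('m::{t2_space,second_countable_topology}, 'e::euclidean_space) atlas \<Rightarrow> bool" where
  "smooth_manifold A \<longleftrightarrow>
     (\<Union>(U, \<phi>)\<in>A. U) = UNIV \<and>
     (\<forall>(U, \<phi>)\<in>A. open U \<and> open (\<phi> ` U) \<and> homeomorphism U (\<phi> ` U) \<phi> (inv_into U \<phi>)) \<and>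
     (\<forall>(U, \<phi>)\<in>A. \<forall>(V, \<psi>)\<in>A. smooth_on (\<phi> ` (U \<inter> V)) (\<psi> \<circ> inv_into U \<phi>))"

definition smooth_functions :: "('m, 'e::euclidean_space) atlas \<Rightarrow> ('m \<Rightarrow> real) set" where
  "smooth_functions A = {f. \<forall>(U, \<phi>)\<in>A. smooth_on (\<phi> ` U) (f \<circ> inv_into U \<phi>)}"

definition prod_atlas ::
  "('m, 'e::euclidean_space) atlas \<Rightarrow> ('n, 'd::euclidean_space) atlas \<Rightarrow> ('m \<times> 'n, 'e \<times> 'd) atlas" where
  "prod_atlas A B = {(U \<times> V, map_prod \<phi> \<psi>) | U \<phi> V \<psi>. (U, \<phi>) \<in> A \<and> (V, \<psi>) \<in> B}"

section \<open>Tangent vectors and vector fields\<close>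

text \<open>Tangent vectors are derivations of the algebra of smooth functions. They are set to \<open>0\<close> on
  functions that are not smooth, so that equality of tangent vectors is equality in HOL.\<close>

type_synonym 'm tvec = "('m \<Rightarrow> real) \<Rightarrow> real"

definition tangent_space :: "('m, 'e::euclidean_space) atlas \<Rightarrow> 'm \<Rightarrow> 'm tvec set" where
  "tangent_space A p = {v.
     (\<forall>f\<in>smooth_functions A. \<forall>h\<in>smooth_functions A. v (\<lambda>q. f q + h q) = v f + v h) \<and>
     (\<forall>f\<in>smooth_functions A. \<forall>c. v (\<lambda>q. c * f q) = c * v f) \<and>
     (\<forall>f\<in>smooth_functions A. \<forall>h\<in>smooth_functions A. v (\<lambda>q. f q * h q) = v f * h p + f p * v h) \<and>
     (\<forall>f. f \<notin> smooth_functions A \<longrightarrow> v f = 0)}"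

type_synonym 'm vfield = "'m \<Rightarrow> 'm tvec"

definition vf_apply :: "'m vfield \<Rightarrow> ('m \<Rightarrow> real) \<Rightarrow> 'm \<Rightarrow> real" where
  "vf_apply X f = (\<lambda>p. X p f)"

definition vector_fields :: "('m, 'e::euclidean_space) atlas \<Rightarrow> 'm vfield set" where
  "vector_fields A = {X. (\<forall>p. X p \<in> tangent_space A p) \<and>
     (\<forall>f\<in>smooth_functions A. vf_apply X f \<in> smooth_functions A)}"

definition lie_bracket :: "'m vfield \<Rightarrow> 'm vfield \<Rightarrow> 'm vfield" where
  "lie_bracket X Y = (\<lambda>p f. X p (vf_apply Y f) - Y p (vf_apply X f))"

text \<open>The tangent map of \<open>h\<close>, where \<open>A\<close> is the atlas of the target manifold.\<close>

definition pushforward :: "('n, 'd::euclidean_space) atlas \<Rightarrow> ('m \<Rightarrow> 'n) \<Rightarrow> 'm tvec \<Rightarrow> 'n tvec" where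
  "pushforward A h v = (\<lambda>f. if f \<in> smooth_functions A then v (f \<circ> h) else 0)"

section \<open>Singular semi-Riemannian metrics\<close>

type_synonym 'm metric_tensor = "'m \<Rightarrow> 'm tvec \<Rightarrow> 'm tvec \<Rightarrow> real"

definition metric_apply :: "'m metric_tensor \<Rightarrow> 'm vfield \<Rightarrow> 'm vfield \<Rightarrow> 'm \<Rightarrow> real" where
  "metric_apply g X Y = (\<lambda>p. g p (X p) (Y p))"

definition singular_semi_riemannian ::
  "('m, 'e::euclidean_space) atlas \<Rightarrow> 'm metric_tensor \<Rightarrow> bool" where
  "singular_semi_riemannian A g \<longleftrightarrow>
     (\<forall>p. \<forall>v\<in>tangent_space A p. \<forall>w\<in>tangent_space A p. g p v w = g p w v) \<and>
     (\<forall>p. \<forall>u\<in>tangent_space A p. \<forall>v\<in>tangent_space A p. \<forall>w\<in>tangent_space A p.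
        g p (u + v) w = g p u w + g p v w) \<and>
     (\<forall>p c. \<forall>v\<in>tangent_space A p. \<forall>w\<in>tangent_space A p. g p (\<lambda>f. c * v f) w = c * g p v w) \<and>
     (\<forall>X\<in>vector_fields A. \<forall>Y\<in>vector_fields A. metric_apply g X Y \<in> smooth_functions A)"

definition nondegenerate :: "('m, 'e::euclidean_space) atlas \<Rightarrow> 'm metric_tensor \<Rightarrow> bool" where
  "nondegenerate A g \<longleftrightarrow>
     (\<forall>p. \<forall>v\<in>tangent_space A p. (\<forall>w\<in>tangent_space A p. g p v w = 0) \<longrightarrow> v = 0)"

definition koszul :: "'m metric_tensor \<Rightarrow> 'm vfield \<Rightarrow> 'm vfield \<Rightarrow> 'm vfield \<Rightarrow> 'm \<Rightarrow> real" where
  "koszul g X Y Z = (\<lambda>p. 1/2 *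
     (vf_apply X (metric_apply g Y Z) p + vf_apply Y (metric_apply g Z X) p - vf_apply Z (metric_apply g X Y) p
      - metric_apply g X (lie_bracket Y Z) p + metric_apply g Y (lie_bracket Z X) p
      + metric_apply g Z (lie_bracket X Y) p))"

section \<open>Covectors, 1-forms and contraction\<close>

text \<open>A covector at \<open>p\<close> is set to \<open>0\<close> outside the tangent space at \<open>p\<close>.\<close>

type_synonym 'm covec = "'m tvec \<Rightarrow> real"

definition differential :: "('m, 'e::euclidean_space) atlas \<Rightarrow> ('m \<Rightarrow> real) \<Rightarrow> 'm \<Rightarrow> 'm covec" where
  "differential A f p = (\<lambda>v. if v \<in> tangent_space A p then v f else 0)"

definition flat :: "('m, 'e::euclidean_space) atlas \<Rightarrow> 'm metric_tensor \<Rightarrow> 'm \<Rightarrow> 'm tvec \<Rightarrow> 'm covec" where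
  "flat A g p v = (\<lambda>w. if w \<in> tangent_space A p then g p v w else 0)"

definition T_bullet :: "('m, 'e::euclidean_space) atlas \<Rightarrow> 'm metric_tensor \<Rightarrow> 'm \<Rightarrow> 'm covec set" where
  "T_bullet A g p = flat A g p ` tangent_space A p"

definition g_bullet ::
  "('m, 'e::euclidean_space) atlas \<Rightarrow> 'm metric_tensor \<Rightarrow> 'm \<Rightarrow> 'm covec \<Rightarrow> 'm covec \<Rightarrow> real" where
  "g_bullet A g p \<alpha> \<beta> = (THE c. \<exists>v\<in>tangent_space A p. \<exists>w\<in>tangent_space A p.
     \<alpha> = flat A g p v \<and> \<beta> = flat A g p w \<and> c = g p v w)"

definition metric_rank :: "('m, 'e::euclidean_space) atlas \<Rightarrow> 'm metric_tensor \<Rightarrow> 'm \<Rightarrow> nat" where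
  "metric_rank A g p = vector_space.dim (\<lambda>(c::real) (\<alpha>::'m covec). \<lambda>v. c * \<alpha> v) (T_bullet A g p)"

definition regular_points ::
  "('m::topological_space, 'e::euclidean_space) atlas \<Rightarrow> 'm metric_tensor \<Rightarrow> 'm set" where
  "regular_points A g =
     {p. \<exists>N. open N \<and> p \<in> N \<and> (\<forall>q\<in>N. metric_rank A g q = metric_rank A g p)}"

text \<open>1-forms are represented by their action on vector fields.\<close>

type_synonym 'm form = "'m vfield \<Rightarrow> 'm \<Rightarrow> real"

text \<open>The covector at \<open>p\<close> of a 1-form: evaluate on any vector field extending the given
  tangent vector; the result does not depend on the extension.\<close>

definition form_at :: "('m, 'e::euclidean_space) atlas \<Rightarrow> 'm form \<Rightarrow> 'm \<Rightarrow> 'm covec" where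
  "form_at A \<omega> p = (\<lambda>v. if v \<in> tangent_space A p
     then (THE c. \<forall>Z\<in>vector_fields A. Z p = v \<longrightarrow> \<omega> Z p = c) else 0)"

text \<open>The smooth extension of the pointwise contraction, unique since the regular points are
  dense; it is meaningful only if the extension exists.\<close>

definition contraction ::
  "('m::topological_space, 'e::euclidean_space) atlas \<Rightarrow> 'm metric_tensor \<Rightarrow> 'm form \<Rightarrow> 'm form
    \<Rightarrow> 'm \<Rightarrow> real" where
  "contraction A g \<omega> \<tau> = (THE h. h \<in> smooth_functions A \<and>
     (\<forall>p\<in>regular_points A g. h p = g_bullet A g p (form_at A \<omega> p) (form_at A \<tau> p)))"

text \<open>The inverse of a non-degenerate metric, via index raising.\<close>

definition sharp :: "('m, 'e::euclidean_space) atlas \<Rightarrow> 'm metric_tensor \<Rightarrow> 'm \<Rightarrow> 'm covec \<Rightarrow> 'm tvec" where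
  "sharp A g p \<alpha> = (THE v. v \<in> tangent_space A p \<and> (\<forall>w\<in>tangent_space A p. g p v w = \<alpha> w))"

definition inverse_metric ::
  "('m, 'e::euclidean_space) atlas \<Rightarrow> 'm metric_tensor \<Rightarrow> 'm \<Rightarrow> 'm covec \<Rightarrow> 'm covec \<Rightarrow> real" where
  "inverse_metric A g p \<alpha> \<beta> = g p (sharp A g p \<alpha>) (sharp A g p \<beta>)"

section \<open>Curvatures\<close>

definition koszul_ssnm ::
  "'m metric_tensor \<Rightarrow> 'm vfield \<Rightarrow> 'm vfield \<Rightarrow> 'm vfield \<Rightarrow> 'm vfield \<Rightarrow> 'm \<Rightarrow> real" where
  "koszul_ssnm g P X Y Z = (\<lambda>p. koszul g X Y Z p + metric_apply g Y P p * metric_apply g X Z p)"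

text \<open>The common formula for the Riemann curvature and the semi-symmetric non-metric curvature, in
  terms of the Koszul form \<open>K\<close>.\<close>

definition curvature_of ::
  "('m::topological_space, 'e::euclidean_space) atlas \<Rightarrow> 'm metric_tensor
    \<Rightarrow> ('m vfield \<Rightarrow> 'm vfield \<Rightarrow> 'm form)
    \<Rightarrow> 'm vfield \<Rightarrow> 'm vfield \<Rightarrow> 'm vfield \<Rightarrow> 'm vfield \<Rightarrow> 'm \<Rightarrow> real" where
  "curvature_of A g K X Y Z T = (\<lambda>p.
     vf_apply X (K Y Z T) p - vf_apply Y (K X Z T) p - K (lie_bracket X Y) Z T p
     + contraction A g (K X Z) (K Y T) p - contraction A g (K Y Z) (K X T) p)"

definition riemann ::
  "('m::topological_space, 'e::euclidean_space) atlas \<Rightarrow> 'm metric_tensor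
    \<Rightarrow> 'm vfield \<Rightarrow> 'm vfield \<Rightarrow> 'm vfield \<Rightarrow> 'm vfield \<Rightarrow> 'm \<Rightarrow> real" where
  "riemann A g = curvature_of A g (koszul g)"

definition riemann_ssnm ::
  "('m::topological_space, 'e::euclidean_space) atlas \<Rightarrow> 'm metric_tensor \<Rightarrow> 'm vfield
    \<Rightarrow> 'm vfield \<Rightarrow> 'm vfield \<Rightarrow> 'm vfield \<Rightarrow> 'm vfield \<Rightarrow> 'm \<Rightarrow> real" where
  "riemann_ssnm A g P = curvature_of A g (koszul_ssnm g P)"

section \<open>Twisted products\<close>

definition twisted_metric ::
  "('m, 'e::euclidean_space) atlas \<Rightarrow> ('n, 'd::euclidean_space) atlas
    \<Rightarrow> 'm metric_tensor \<Rightarrow> 'n metric_tensor \<Rightarrow> ('m \<times> 'n \<Rightarrow> real) \<Rightarrow> ('m \<times> 'n) metric_tensor" where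
  "twisted_metric A\<^sub>B A\<^sub>F g\<^sub>B g\<^sub>F b p v w =
     g\<^sub>B (fst p) (pushforward A\<^sub>B fst v) (pushforward A\<^sub>B fst w)
     + (b p)\<^sup>2 * g\<^sub>F (snd p) (pushforward A\<^sub>F snd v) (pushforward A\<^sub>F snd w)"

text \<open>Tangent vectors of a factor are lifted to the product along the inclusion of the slice
  through the given point.\<close>

definition lift_fst ::
  "('m, 'e::euclidean_space) atlas \<Rightarrow> ('n, 'd::euclidean_space) atlas
    \<Rightarrow> 'm vfield \<Rightarrow> ('m \<times> 'n) vfield" where
  "lift_fst A\<^sub>B A\<^sub>F X = (\<lambda>(x, y). pushforward (prod_atlas A\<^sub>B A\<^sub>F) (\<lambda>x'. (x', y)) (X x))"

definition lift_snd ::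
  "('m, 'e::euclidean_space) atlas \<Rightarrow> ('n, 'd::euclidean_space) atlas
    \<Rightarrow> 'n vfield \<Rightarrow> ('m \<times> 'n) vfield" where
  "lift_snd A\<^sub>B A\<^sub>F U = (\<lambda>(x, y). pushforward (prod_atlas A\<^sub>B A\<^sub>F) (\<lambda>y'. (x, y')) (U y))"

text \<open>Restriction of a covector at \<open>p\<close> on the product to the tangent spaces of the factors.\<close>

definition restrict_fst ::
  "('m, 'e::euclidean_space) atlas \<Rightarrow> ('n, 'd::euclidean_space) atlas
    \<Rightarrow> 'm \<times> 'n \<Rightarrow> ('m \<times> 'n) covec \<Rightarrow> 'm covec" where
  "restrict_fst A\<^sub>B A\<^sub>F p \<alpha> = (\<lambda>v. if v \<in> tangent_space A\<^sub>B (fst p)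
     then \<alpha> (pushforward (prod_atlas A\<^sub>B A\<^sub>F) (\<lambda>x'. (x', snd p)) v) else 0)"

definition restrict_snd ::
  "('m, 'e::euclidean_space) atlas \<Rightarrow> ('n, 'd::euclidean_space) atlas
    \<Rightarrow> 'm \<times> 'n \<Rightarrow> ('m \<times> 'n) covec \<Rightarrow> 'n covec" where
  "restrict_snd A\<^sub>B A\<^sub>F p \<alpha> = (\<lambda>v. if v \<in> tangent_space A\<^sub>F (snd p)
     then \<alpha> (pushforward (prod_atlas A\<^sub>B A\<^sub>F) (\<lambda>y'. (fst p, y')) v) else 0)"

end

(* The curvature is a sum of derivatives of Koszul forms and of contractions of two Koszul forms.
   On lifts of vector fields of the factors the Koszul form of the twisted product is explicit, and
   its F-part is always b * g_F(d, .) with a smooth section d that vanishes where b does (this is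
   where db = 0 on {b = 0} enters).  Hence the form is g-dual to c + d/b off the zeros of b and to c
   on them, where c represents its B-part, and the contraction of (c, d) with (c', d') is
   g_B(c, c') + g_F(d, d') at every point.  This function is smooth, and the regular points are dense
   because the rank of g depends only on whether b vanishes, so it is the contraction.  The eight
   identities then follow from the Leibniz rule and bilinearity.

   Tangent vectors are derivations, so the manifold theory rests on Hadamard's lemma, which provides
   local coordinate frames and splits a derivation on B x F into its two factors.  Smoothness of the
   inverse metrics comes from dual frames given by the adjugate of the Gram matrix. *)

theory Submission
  imports Defs "Jordan_Normal_Form.Determinant"
begin

section \<open>Smooth maps between Euclidean spaces\<close>

text \<open>On the twisted product the covariant derivative exists only in index-lowered form, and a
  contraction is a description of a smooth extension, so it can be evaluated only after a candidate
  has been exhibited. A candidate needs representing vectors at every point, but d/b need not extend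
  continuously across the zeros of b. Keeping d in place of d/b confines the division to pointwise
  statements, and smoothness is checked on d alone. Since b and its derivatives depend on both
  factors, c and d are not vector fields of B and F but maps from the product into the tangent
  spaces of the factors. Hence the sections along the projections, whose smoothness is tested by
  pairing with vector fields of the factor. The forms are explicit on lifts only, whereas their
  covectors act on all tangent vectors. The splitting of tangent vectors, together with linearity
  over the smooth functions, closes this gap.\<close>

lemma Ck_on_congD:
  assumes "open S" "\<And>x. x \<in> S \<Longrightarrow> f x = g x" "Ck_on S f k"
  shows "Ck_on S g k"
  using assms(2,3)
proof (induction k arbitrary: f g)
  case 0
  then show ?case using continuous_on_eq by auto
next
  case (Suc k)
  have d: "g differentiable at x" "frechet_derivative g (at x) = frechet_derivative f (at x)"
    if "x \<in> S" for x
  proof -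
    have "f differentiable at x" using Suc.prems(2) that by auto
    then have "(f has_derivative frechet_derivative f (at x)) (at x)"
      using frechet_derivative_works by blast
    then have "(g has_derivative frechet_derivative f (at x)) (at x)"
      using has_derivative_transform_within_open[OF _ assms(1) that] Suc.prems(1) by blast
    then show "g differentiable at x" "frechet_derivative g (at x) = frechet_derivative f (at x)"
      by (auto simp: differentiable_def frechet_derivative_at[symmetric])
  qed
  have "Ck_on S (\<lambda>x. frechet_derivative g (at x) v) k" for v
    by (rule Suc.IH[of "\<lambda>x. frechet_derivative f (at x) v"]) (use d Suc.prems(2) in auto)
  with d show ?case by auto
qed

lemma Ck_on_cong:
  assumes "open S" "\<And>x. x \<in> S \<Longrightarrow> f x = g x"
  shows "Ck_on S f k \<longleftrightarrow> Ck_on S g k"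
  using Ck_on_congD[of S f g k] Ck_on_congD[of S g f k] assms by auto

text \<open>\<open>Ck_on\<close> speaks of \<open>frechet_derivative\<close>, a choice that is
  awkward to compute with; here any explicit family of derivatives will do. Most closure properties
  below use this rule in an induction on the order.\<close>

lemma Ck_on_SucI:
  assumes "open S" "\<And>x. x \<in> S \<Longrightarrow> (f has_derivative f' x) (at x)" "\<And>v. Ck_on S (\<lambda>x. f' x v) k"
  shows "Ck_on S f (Suc k)"
proof -
  have e: "frechet_derivative f (at x) = f' x" if "x \<in> S" for x
    using assms(2)[OF that] frechet_derivative_at by metis
  have "Ck_on S (\<lambda>x. frechet_derivative f (at x) v) k" for v
    using Ck_on_cong[OF assms(1), of "\<lambda>x. frechet_derivative f (at x) v" "\<lambda>x. f' x v"] e assms(3)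
    by auto
  then show ?thesis using assms(2) by (auto simp: differentiable_def)
qed

lemma Ck_on_SucD:
  assumes "Ck_on S f (Suc k)" "x \<in> S"
  shows "(f has_derivative frechet_derivative f (at x)) (at x)"
  using assms by (auto simp: frechet_derivative_works[symmetric])

lemma Ck_on_subset: "Ck_on S f k \<Longrightarrow> T \<subseteq> S \<Longrightarrow> Ck_on T f k"
  by (induction k arbitrary: f) (auto intro: continuous_on_subset)

lemma Ck_on_continuous: "Ck_on S f k \<Longrightarrow> continuous_on S f"
  by (cases k) (auto intro!: continuous_at_imp_continuous_on differentiable_imp_continuous_within)

lemma Ck_on_Suc_lower: "Ck_on S f (Suc k) \<Longrightarrow> Ck_on S f k"
proof (induction k arbitrary: f)
  case 0
  then show ?case using Ck_on_continuous[OF 0] by simp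
next
  case (Suc k)
  have "\<forall>x\<in>S. f differentiable (at x)" "\<forall>v. Ck_on S (\<lambda>x. frechet_derivative f (at x) v) (Suc k)"
    using Suc.prems unfolding Ck_on.simps(2)[of S f] by auto
  with Suc.IH show ?case unfolding Ck_on.simps(2)[of S f] by blast
qed

lemma Ck_on_local:
  assumes "\<And>x. x \<in> S \<Longrightarrow> \<exists>T. open T \<and> x \<in> T \<and> Ck_on T f k"
  shows "Ck_on S f k"
  using assms
proof (induction k arbitrary: f)
  case 0
  have "isCont f x" if "x \<in> S" for x
    using 0[OF that] continuous_on_eq_continuous_at by auto
  then show ?case by (auto intro: continuous_at_imp_continuous_on)
next
  case (Suc k)
  have "Ck_on S (\<lambda>x. frechet_derivative f (at x) v) k" for v
  proof (rule Suc.IH)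
    fix x assume "x \<in> S"
    then obtain T where "open T" "x \<in> T" "Ck_on T f (Suc k)" using Suc.prems by blast
    then show "\<exists>T. open T \<and> x \<in> T \<and> Ck_on T (\<lambda>x. frechet_derivative f (at x) v) k"
      unfolding Ck_on.simps(2) by blast
  qed
  moreover have "f differentiable at x" if "x \<in> S" for x
    using Suc.prems[OF that] by auto
  ultimately show ?case by simp
qed

lemma Ck_on_const: "open S \<Longrightarrow> Ck_on S (\<lambda>x. c) k"
  by (induction k arbitrary: c) (auto intro!: Ck_on_SucI[where f' = "\<lambda>x v. 0"] simp del: Ck_on.simps(2))

lemma Ck_on_bounded_linear_compose:
  assumes "open S" "bounded_linear L" "Ck_on S f k"
  shows "Ck_on S (\<lambda>x. L (f x)) k"
  using assms(3)
proof (induction k arbitrary: f)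
  case 0
  then show ?case using assms(2) by (auto intro: bounded_linear.continuous_on)
next
  case (Suc k)
  show ?case
    by (rule Ck_on_SucI[OF assms(1)],
        rule bounded_linear.has_derivative[OF assms(2)], rule Ck_on_SucD[OF Suc.prems], assumption,
        rule Suc.IH) (use Suc.prems in auto)
qed

lemma Ck_on_bounded_linear:
  assumes "open S" "bounded_linear L"
  shows "Ck_on S L k"
proof (cases k)
  case 0
  then show ?thesis using assms(2) by (auto intro: linear_continuous_on)
next
  case (Suc j)
  show ?thesis unfolding Suc
    by (rule Ck_on_SucI[OF assms(1) bounded_linear_imp_has_derivative[OF assms(2)] Ck_on_const[OF assms(1)]])
qed

lemma Ck_on_add:
  assumes "open S" "Ck_on S f k" "Ck_on S g k"
  shows "Ck_on S (\<lambda>x. f x + g x) k"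
  using assms(2,3)
proof (induction k arbitrary: f g)
  case 0
  then show ?case by (auto intro: continuous_on_add)
next
  case (Suc k)
  show ?case
    by (rule Ck_on_SucI[OF assms(1)],
        rule has_derivative_add[OF Ck_on_SucD[OF Suc.prems(1)] Ck_on_SucD[OF Suc.prems(2)]],
        assumption, assumption, rule Suc.IH) (use Suc.prems in auto)
qed

lemma Ck_on_bilinear:
  assumes "open S" "bounded_bilinear h" "Ck_on S f k" "Ck_on S g k"
  shows "Ck_on S (\<lambda>x. h (f x) (g x)) k"
  using assms(3,4)
proof (induction k arbitrary: f g)
  case 0
  then show ?case using assms(2) by (auto intro: bounded_bilinear.continuous_on)
next
  case (Suc k)
  \<comment> \<open>The product rule pairs each derivative with the other factor undifferentiated,
    so the factors themselves are needed at order k as well.\<close>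
  have l: "Ck_on S f k" "Ck_on S g k" using Suc.prems Ck_on_Suc_lower by blast+
  show ?case
    by (rule Ck_on_SucI[OF assms(1)],
        rule bounded_bilinear.FDERIV[OF assms(2) Ck_on_SucD[OF Suc.prems(1)] Ck_on_SucD[OF Suc.prems(2)]],
        assumption, assumption, rule Ck_on_add[OF assms(1)]; rule Suc.IH) (use Suc.prems l in auto)
qed

lemma Ck_on_sum:
  assumes "open S" "\<And>i. i \<in> I \<Longrightarrow> Ck_on S (f i) k"
  shows "Ck_on S (\<lambda>x. \<Sum>i\<in>I. f i x) k"
  using assms(2)
  by (induction I rule: infinite_finite_induct) (auto intro: Ck_on_const Ck_on_add assms(1))

lemma Ck_on_compose:
  fixes g :: "'a::real_normed_vector \<Rightarrow> 'b::euclidean_space"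
  assumes "open S" "open T" "Ck_on S g k" "g ` S \<subseteq> T" "Ck_on T f k"
  shows "Ck_on S (\<lambda>x. f (g x)) k"
  using assms(3,5)
proof (induction k arbitrary: f)
  case 0
  then show ?case using assms(4) by (auto intro: continuous_on_compose2)
next
  case (Suc k)
  let ?f' = "\<lambda>y. frechet_derivative f (at y)" and ?g' = "\<lambda>x. frechet_derivative g (at x)"
  have hd: "((\<lambda>x. f (g x)) has_derivative (\<lambda>v. ?f' (g x) (?g' x v))) (at x)" if "x \<in> S" for x
    by (rule has_derivative_compose[OF Ck_on_SucD[OF Suc.prems(1) that] Ck_on_SucD[OF Suc.prems(2)]])
      (use assms(4) that in auto)
  \<comment> \<open>\<open>Ck_on\<close> controls derivatives in a fixed direction only, whereas the
    direction \<open>?g' x v\<close> moves with x. Expanding it in the basis leaves products of a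
    coefficient and a derivative of f in a fixed direction.\<close>
  have ex: "?f' (g x) (?g' x v) = (\<Sum>i\<in>Basis. inner (?g' x v) i *\<^sub>R ?f' (g x) i)" if "x \<in> S" for x v
  proof -
    have l: "linear (?f' (g x))"
      using Ck_on_SucD[OF Suc.prems(2)] assms(4) that has_derivative_linear by blast
    have "?f' (g x) (?g' x v) = ?f' (g x) (\<Sum>i\<in>Basis. inner (?g' x v) i *\<^sub>R i)"
      by (simp add: euclidean_representation)
    also have "\<dots> = (\<Sum>i\<in>Basis. inner (?g' x v) i *\<^sub>R ?f' (g x) i)"
      by (simp add: linear_sum[OF l] linear_cmul[OF l])
    finally show ?thesis .
  qed
  have gk: "Ck_on S g k" by (rule Ck_on_Suc_lower[OF Suc.prems(1)])
  have "Ck_on S (\<lambda>x. \<Sum>i\<in>Basis. inner (?g' x v) i *\<^sub>R ?f' (g x) i) k" for v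
    by (intro Ck_on_sum Ck_on_bilinear[OF assms(1) bounded_bilinear_scaleR] assms(1) Suc.IH gk
        Ck_on_bounded_linear_compose[OF assms(1) bounded_linear_inner_left])
      (use Suc.prems in auto)
  then have "Ck_on S (\<lambda>x. ?f' (g x) (?g' x v)) k" for v
    using Ck_on_cong[OF assms(1), of "\<lambda>x. ?f' (g x) (?g' x v)"] ex by simp
  with hd show ?case by (intro Ck_on_SucI[OF assms(1)]) auto
qed

lemma Ck_on_Pair:
  assumes "open S" "Ck_on S f k" "Ck_on S g k"
  shows "Ck_on S (\<lambda>x. (f x, g x)) k"
  using assms(2,3)
proof (induction k arbitrary: f g)
  case 0
  then show ?case by (auto intro: continuous_on_Pair)
next
  case (Suc k)
  show ?case
    by (rule Ck_on_SucI[OF assms(1)],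
        rule has_derivative_Pair[OF Ck_on_SucD[OF Suc.prems(1)] Ck_on_SucD[OF Suc.prems(2)]],
        assumption, assumption, rule Suc.IH) (use Suc.prems in auto)
qed

lemma smooth_on_cong:
  "open S \<Longrightarrow> (\<And>x. x \<in> S \<Longrightarrow> f x = g x) \<Longrightarrow> smooth_on S f \<longleftrightarrow> smooth_on S g"
  unfolding smooth_on_def using Ck_on_cong by blast

lemma smooth_on_transform:
  assumes "open S" "smooth_on S f" "\<And>x. x \<in> S \<Longrightarrow> f x = g x"
  shows "smooth_on S g"
  using smooth_on_cong[OF assms(1), of f g] assms(2,3) by blast

lemma smooth_on_subset: "smooth_on S f \<Longrightarrow> T \<subseteq> S \<Longrightarrow> smooth_on T f"
  unfolding smooth_on_def using Ck_on_subset by blast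

lemma smooth_on_local:
  "(\<And>x. x \<in> S \<Longrightarrow> \<exists>T. open T \<and> x \<in> T \<and> smooth_on T f) \<Longrightarrow> smooth_on S f"
  unfolding smooth_on_def by (meson Ck_on_local)

lemma smooth_on_const: "open S \<Longrightarrow> smooth_on S (\<lambda>x. c)"
  unfolding smooth_on_def using Ck_on_const by blast

lemma smooth_on_bounded_linear: "open S \<Longrightarrow> bounded_linear L \<Longrightarrow> smooth_on S L"
  unfolding smooth_on_def using Ck_on_bounded_linear by blast

lemma smooth_on_add:
  "open S \<Longrightarrow> smooth_on S f \<Longrightarrow> smooth_on S g \<Longrightarrow> smooth_on S (\<lambda>x. f x + g x)"
  unfolding smooth_on_def using Ck_on_add by blast

lemma smooth_on_scaleR:
  "open S \<Longrightarrow> smooth_on S f \<Longrightarrow> smooth_on S g \<Longrightarrow> smooth_on S (\<lambda>x. f x *\<^sub>R g x)"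
  unfolding smooth_on_def using Ck_on_bilinear[OF _ bounded_bilinear_scaleR] by blast

lemma smooth_on_mult:
  fixes f g :: "'a::real_normed_vector \<Rightarrow> real"
  shows "open S \<Longrightarrow> smooth_on S f \<Longrightarrow> smooth_on S g \<Longrightarrow> smooth_on S (\<lambda>x. f x * g x)"
  unfolding smooth_on_def using Ck_on_bilinear[OF _ bounded_bilinear_mult] by blast

lemma smooth_on_inner:
  fixes f g :: "'a::real_normed_vector \<Rightarrow> 'b::real_inner"
  shows "open S \<Longrightarrow> smooth_on S f \<Longrightarrow> smooth_on S g \<Longrightarrow> smooth_on S (\<lambda>x. inner (f x) (g x))"
  unfolding smooth_on_def using Ck_on_bilinear[OF _ bounded_bilinear_inner] by blast

lemma smooth_on_compose:
  fixes g :: "'a::real_normed_vector \<Rightarrow> 'b::euclidean_space"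
  shows "open S \<Longrightarrow> open T \<Longrightarrow> smooth_on S g \<Longrightarrow> g ` S \<subseteq> T \<Longrightarrow> smooth_on T f
    \<Longrightarrow> smooth_on S (\<lambda>x. f (g x))"
  unfolding smooth_on_def using Ck_on_compose by blast

lemma smooth_on_Pair:
  "open S \<Longrightarrow> smooth_on S f \<Longrightarrow> smooth_on S g \<Longrightarrow> smooth_on S (\<lambda>x. (f x, g x))"
  unfolding smooth_on_def using Ck_on_Pair by blast

lemma smooth_on_frechet_derivative:
  "smooth_on S f \<Longrightarrow> smooth_on S (\<lambda>x. frechet_derivative f (at x) v)"
  unfolding smooth_on_def using Ck_on.simps(2) by blast

lemma smooth_on_has_derivative:
  "smooth_on S f \<Longrightarrow> x \<in> S \<Longrightarrow> (f has_derivative frechet_derivative f (at x)) (at x)"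
  unfolding smooth_on_def using Ck_on_SucD by blast

lemma smooth_on_continuous: "smooth_on S f \<Longrightarrow> continuous_on S f"
  unfolding smooth_on_def using Ck_on_continuous by blast

text \<open>The derivative of the reciprocal is a product of reciprocals and a constant, so order k
  for the function itself yields order k for its derivative.\<close>

lemma smooth_on_inverse: "smooth_on (- {0}) (inverse :: real \<Rightarrow> real)"
proof -
  have "Ck_on (- {0}) (inverse :: real \<Rightarrow> real) k" for k
  proof (induction k)
    case 0
    then show ?case by (auto intro!: continuous_intros)
  next
    case (Suc k)
    have o: "open (- {0::real})" by auto
    show ?case
    proof (rule Ck_on_SucI[OF o, where f' = "\<lambda>x v. - (inverse x * v * inverse x)"])
      show "(inverse has_derivative (\<lambda>v. - (inverse x * v * inverse x))) (at x)"
        if "x \<in> - {0}" for x :: real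
        using that by (auto intro!: has_derivative_inverse')
      have "Ck_on (- {0::real}) (\<lambda>x. (- v) * (inverse x * inverse x)) k" for v
        by (intro Ck_on_bilinear[OF o bounded_bilinear_mult] Ck_on_const Suc o)
      then show "Ck_on (- {0::real}) (\<lambda>x. - (inverse x * v * inverse x)) k" for v
        by (simp add: mult_ac)
    qed
  qed
  then show ?thesis unfolding smooth_on_def by blast
qed

section \<open>Smooth bump functions on Euclidean space\<close>

definition poly_exp_flat :: "real poly \<Rightarrow> real \<Rightarrow> real" where
  "poly_exp_flat p t = (if t > 0 then poly p (inverse t) * exp (- inverse t) else 0)"

lemma poly_times_exp_minus_tendsto_0: "((\<lambda>s. poly p s * exp (- s)) \<longlongrightarrow> 0) at_top" for p :: "real poly"
proof -
  have "((\<lambda>s. \<Sum>i\<le>degree p. coeff p i * (s ^ i / exp s)) \<longlongrightarrow> (\<Sum>i\<le>degree p. coeff p i * 0)) at_top"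
    by (intro tendsto_sum tendsto_mult tendsto_const tendsto_power_div_exp_0)
  moreover have "poly p s * exp (- s) = (\<Sum>i\<le>degree p. coeff p i * (s ^ i / exp s))" for s
    by (simp add: poly_altdef sum_distrib_right exp_minus divide_inverse mult.assoc)
  ultimately show ?thesis by simp
qed

text \<open>The derivative of p(1/t) exp(-1/t) is (1/t^2) (p - p')(1/t) exp(-1/t), so p is replaced
  by X^2 (p - p'). The family is thus closed under differentiation, and smoothness becomes a single
  induction over all polynomials at once.\<close>

lemma has_derivative_poly_exp_flat:
  "(poly_exp_flat p has_derivative (\<lambda>v. v * poly_exp_flat ([:0,0,1:] * (p - pderiv p)) t)) (at t)"
proof -
  have "(poly_exp_flat p has_real_derivative poly_exp_flat ([:0,0,1:] * (p - pderiv p)) t) (at t)"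
  proof (cases t "0::real" rule: linorder_cases)
    case less
    have "(poly_exp_flat p has_real_derivative 0) (at t)"
      by (rule has_field_derivative_transform_within[where f = "\<lambda>x. 0" and d = "- t"])
        (use less in \<open>auto simp: poly_exp_flat_def dist_real_def\<close>)
    then show ?thesis using less by (simp add: poly_exp_flat_def)
  next
    case greater
    have "((\<lambda>x. poly p (inverse x) * exp (- inverse x)) has_real_derivative
        poly_exp_flat ([:0,0,1:] * (p - pderiv p)) t) (at t)"
      by (rule DERIV_cong[OF DERIV_mult[OF DERIV_chain2[OF poly_DERIV DERIV_inverse]
              DERIV_chain2[OF DERIV_exp DERIV_minus[OF DERIV_inverse]]]])
        (use greater in \<open>auto simp: poly_exp_flat_def power2_eq_square algebra_simps\<close>)
    then show ?thesis
      by (rule has_field_derivative_transform_within[where d = t])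
        (use greater in \<open>auto simp: poly_exp_flat_def dist_real_def\<close>)
  next
    case equal
    have "((\<lambda>h. (poly_exp_flat p (0 + h) - poly_exp_flat p 0) / h) \<longlongrightarrow> 0) (at 0)"
    proof (rule filterlim_split_at)
      have "\<forall>\<^sub>F h in at_left 0. (poly_exp_flat p (0 + h) - poly_exp_flat p 0) / h = (0::real)"
        by (auto simp: eventually_at_filter poly_exp_flat_def)
      then show "((\<lambda>h. (poly_exp_flat p (0 + h) - poly_exp_flat p 0) / h) \<longlongrightarrow> 0) (at_left 0)"
        by (rule tendsto_eventually)
      \<comment> \<open>Dividing by h multiplies the polynomial in 1/h by its variable, which is
        \<open>pCons 0 p\<close>.\<close>
      have "((\<lambda>h. poly (pCons 0 p) (inverse h) * exp (- inverse h)) \<longlongrightarrow> 0) (at_right (0::real))"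
        by (rule filterlim_compose[OF poly_times_exp_minus_tendsto_0 filterlim_inverse_at_top_right])
      moreover have "\<forall>\<^sub>F h in at_right 0. poly (pCons 0 p) (inverse h) * exp (- inverse h)
          = (poly_exp_flat p (0 + h) - poly_exp_flat p 0) / h"
        by (auto simp: eventually_at_filter poly_exp_flat_def field_simps)
      ultimately show "((\<lambda>h. (poly_exp_flat p (0 + h) - poly_exp_flat p 0) / h) \<longlongrightarrow> 0) (at_right 0)"
        by (rule Lim_transform_eventually)
    qed
    then show ?thesis using equal by (simp add: DERIV_def poly_exp_flat_def)
  qed
  from this[unfolded has_field_derivative_def] show ?thesis
    by (rule has_derivative_eq_rhs) (auto simp: fun_eq_iff mult.commute)
qed

lemma smooth_on_poly_exp_flat: "smooth_on UNIV (poly_exp_flat p)"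
proof -
  have "Ck_on UNIV (poly_exp_flat p) k" for k
  proof (induction k arbitrary: p)
    case 0
    show ?case
      by (auto intro!: continuous_at_imp_continuous_on has_derivative_continuous[OF has_derivative_poly_exp_flat])
  next
    case (Suc k)
    show ?case
      by (rule Ck_on_SucI[OF open_UNIV has_derivative_poly_exp_flat])
        (intro Ck_on_bilinear[OF open_UNIV bounded_bilinear_mult] Ck_on_const open_UNIV Suc)
  qed
  then show ?thesis by (simp add: smooth_on_def)
qed

text \<open>With f(t) = exp(-1/t) for positive t and 0 otherwise, the quotient f(q) / (f(q) + f(1 -
  q)) is 1 where q exceeds 1 and 0 where q is negative. Its denominator is positive because q and 1
  - q are never both nonpositive.\<close>

lemma exists_smooth_bump:
  fixes c :: "'e::euclidean_space"
  assumes "0 < r"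
  obtains \<beta> :: "'e \<Rightarrow> real" where "smooth_on UNIV \<beta>" "\<And>z. z \<in> ball c r \<Longrightarrow> \<beta> z = 1"
    "\<And>z. z \<notin> cball c (2 * r) \<Longrightarrow> \<beta> z = 0"
proof -
  let ?f = "poly_exp_flat 1"
  \<comment> \<open>The squared norm keeps q smooth at the centre. The constant 2 makes q larger
    than 1 within radius r and negative beyond radius sqrt(2) r, hence outside the larger
    ball.\<close>
  define q where "q = (\<lambda>z. 2 - inner (z - c) (z - c) * inverse (r^2))"
  let ?den = "\<lambda>z. ?f (q z) + ?f (1 - q z)"
  have sub: "smooth_on UNIV (\<lambda>z. z - c)"
    using smooth_on_add[OF open_UNIV smooth_on_bounded_linear[OF open_UNIV bounded_linear_ident]
        smooth_on_const[OF open_UNIV], of "- c"] by simp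
  have q: "smooth_on UNIV q"
    using smooth_on_add[OF open_UNIV smooth_on_const[OF open_UNIV, of 2]
        smooth_on_mult[OF open_UNIV smooth_on_inner[OF open_UNIV sub sub]
          smooth_on_const[OF open_UNIV, of "- inverse (r^2)"]]]
    by (simp add: q_def)
  have q1: "smooth_on UNIV (\<lambda>z. 1 - q z)"
    using smooth_on_add[OF open_UNIV smooth_on_const[OF open_UNIV, of 1]
        smooth_on_mult[OF open_UNIV q smooth_on_const[OF open_UNIV, of "- 1"]]] by simp
  have f1: "smooth_on UNIV (\<lambda>z. ?f (q z))" and f2: "smooth_on UNIV (\<lambda>z. ?f (1 - q z))"
    using smooth_on_compose[OF open_UNIV open_UNIV _ _ smooth_on_poly_exp_flat] q q1 by auto
  have pos: "?den z > 0" for z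
    by (auto simp: poly_exp_flat_def add_pos_nonneg add_nonneg_pos)
  have inv: "smooth_on UNIV (\<lambda>z. inverse (?den z))"
    by (rule smooth_on_compose[OF open_UNIV _ smooth_on_add[OF open_UNIV f1 f2] _ smooth_on_inverse])
      (use pos in \<open>auto simp: less_le\<close>)
  show thesis
  proof (rule that)
    show "smooth_on UNIV (\<lambda>z. ?f (q z) * inverse (?den z))"
      by (rule smooth_on_mult[OF open_UNIV f1 inv])
    show "?f (q z) * inverse (?den z) = 1" if "z \<in> ball c r" for z
    proof -
      have "(norm (z - c))^2 < r^2"
        using that by (auto simp: dist_norm norm_minus_commute intro!: power_strict_mono)
      then have "1 - q z < 0" using assms
        by (simp add: q_def power2_norm_eq_inner[symmetric] field_simps)
      then have "?f (1 - q z) = 0" by (simp add: poly_exp_flat_def)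
      then show ?thesis using pos[of z] by simp
    qed
    show "?f (q z) * inverse (?den z) = 0" if "z \<notin> cball c (2 * r)" for z
    proof -
      have "2 * r < norm (z - c)" using that by (auto simp: dist_norm norm_minus_commute)
      then have "(2 * r)^2 < (norm (z - c))^2" by (rule power_strict_mono) (use assms in auto)
      then have "2 * r^2 < (norm (z - c))^2" using assms
        by (simp add: power_mult_distrib) (smt (verit) zero_less_power)
      then have "q z < 0" using assms
        by (simp add: q_def power2_norm_eq_inner[symmetric] field_simps)
      then show ?thesis by (simp add: poly_exp_flat_def)
    qed
  qed
qed

section \<open>Integrals depending on a parameter, and Hadamard's lemma\<close>

lemma Ck_on_integral:
  fixes f :: "'e::euclidean_space \<times> real \<Rightarrow> real"
  assumes "open S" "open T" "{0..1} \<subseteq> T" "Ck_on (S \<times> T) f k"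
  shows "Ck_on S (\<lambda>z. integral (cbox 0 1) (\<lambda>t. f (z, t))) k"
  using assms(4)
proof (induction k arbitrary: f)
  case 0
  then have "continuous_on (S \<times> cbox 0 1) f"
    using assms(3) by (auto intro: continuous_on_subset)
  then have "continuous_on (S \<times> cbox 0 1) (\<lambda>(z, t). f (z, t))" by simp
  then show ?case using integral_continuous_on_param by fastforce
next
  case (Suc k)
  let ?D = "\<lambda>z t v. frechet_derivative f (at (z, t)) (v, 0)"
  \<comment> \<open>\<open>leibniz_rule\<close> takes the derivative in z as a bounded linear map
    that is jointly continuous in (z, t). In finite dimension this continuity can be checked
    direction by direction.\<close>
  define fx where "fx = (\<lambda>z t. Blinfun (?D z t))"
  have D: "((\<lambda>z. f (z, t)) has_derivative ?D z t) (at z)" if "z \<in> S" "t \<in> cbox 0 1" for z t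
  proof -
    have "((\<lambda>z. (z, t)) has_derivative (\<lambda>v. (v, 0))) (at z)"
      by (auto intro!: derivative_eq_intros)
    then show ?thesis
      by (rule has_derivative_compose[OF _ Ck_on_SucD[OF Suc.prems]]) (use that assms(3) in auto)
  qed
  have fx: "blinfun_apply (fx z t) = ?D z t" if "z \<in> S" "t \<in> cbox 0 1" for z t
    unfolding fx_def using bounded_linear_Blinfun_apply has_derivative_bounded_linear[OF D[OF that]] by blast
  have cf: "continuous_on (S \<times> cbox 0 1) f"
    by (rule continuous_on_subset[OF Ck_on_continuous[OF Suc.prems]]) (use assms(3) in auto)
  have cD: "continuous_on (S \<times> cbox 0 1) (\<lambda>(z, t). ?D z t v)" for v
  proof -
    have "Ck_on (S \<times> T) (\<lambda>x. frechet_derivative f (at x) (v, 0)) k" using Suc.prems by auto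
    then have "continuous_on (S \<times> cbox 0 1) (\<lambda>x. frechet_derivative f (at x) (v, 0))"
      by (intro continuous_on_subset[OF Ck_on_continuous]) (use assms(3) in auto)
    then show ?thesis by (simp add: case_prod_beta')
  qed
  have cfx: "continuous_on (S \<times> cbox 0 1) (\<lambda>(z, t). fx z t)"
  proof (rule continuous_on_blinfun_componentwise)
    fix i :: 'e
    show "continuous_on (S \<times> cbox 0 1) (\<lambda>x. blinfun_apply (case x of (z, t) \<Rightarrow> fx z t) i)"
      by (rule continuous_on_eq[OF cD[of i]]) (auto simp: fx)
  qed
  have der: "((\<lambda>z. integral (cbox 0 1) (\<lambda>t. f (z, t))) has_derivative
      (\<lambda>v. integral (cbox 0 1) (\<lambda>t. ?D z t v))) (at z)" if z: "z \<in> S" for z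
  proof -
    obtain e where e: "e > 0" "ball z e \<subseteq> S" using assms(1) z open_contains_ball by blast
    have "((\<lambda>z. integral (cbox 0 1) (\<lambda>t. f (z, t))) has_derivative
        blinfun_apply (integral (cbox 0 1) (fx z))) (at z within ball z e)"
    proof (rule leibniz_rule)
      show "((\<lambda>z. f (z, t)) has_derivative blinfun_apply (fx y t)) (at y within ball z e)"
        if "y \<in> ball z e" "t \<in> cbox 0 1" for y t
      proof -
        have "y \<in> S" using that e by auto
        then show ?thesis using D[of y t] fx[of y t] that(2) by (simp add: has_derivative_at_withinI)
      qed
      show "(\<lambda>t. f (y, t)) integrable_on cbox 0 1" if "y \<in> ball z e" for y
        by (intro integrable_continuous continuous_on_compose2[OF cf] continuous_intros)
          (use that e in auto)
      show "continuous_on (ball z e \<times> cbox 0 1) (\<lambda>(z, t). fx z t)"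
        by (rule continuous_on_subset[OF cfx]) (use e in auto)
    qed (use e in auto)
    moreover have "at z within ball z e = at z"
      by (rule at_within_open) (use e in auto)
    moreover have "blinfun_apply (integral (cbox 0 1) (fx z)) = (\<lambda>v. integral (cbox 0 1) (\<lambda>t. ?D z t v))"
    proof
      fix v
      have "continuous_on (cbox 0 1) (\<lambda>t. (\<lambda>(z, t). fx z t) (z, t))"
        by (rule continuous_on_compose2[OF cfx continuous_on_Pair[OF continuous_on_const continuous_on_id]])
          (use z in auto)
      then have "continuous_on (cbox 0 1) (\<lambda>t. fx z t)" by simp
      then have "fx z integrable_on cbox 0 1" by (rule integrable_continuous)
      then have "blinfun_apply (integral (cbox 0 1) (fx z)) v = integral (cbox 0 1) (\<lambda>t. fx z t v)"
        by (rule blinfun_apply_integral)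
      also have "\<dots> = integral (cbox 0 1) (\<lambda>t. ?D z t v)"
        by (rule integral_cong) (use fx z in auto)
      finally show "blinfun_apply (integral (cbox 0 1) (fx z)) v = integral (cbox 0 1) (\<lambda>t. ?D z t v)" .
    qed
    ultimately show ?thesis by simp
  qed
  show ?case
    by (rule Ck_on_SucI[OF assms(1) der], assumption, rule Suc.IH) (use Suc.prems in auto)
qed

text \<open>The fundamental theorem of calculus along the segment from z0 to z produces h_i(z) as
  the integral over t in [0,1] of the i-th partial derivative at z0 + t (z - z0). At z = z0 the
  integrand is constant, which gives the value of h_i there. A derivation at z0 applied to the
  expansion sees only these values, since the other factors vanish at z0.\<close>

lemma hadamard_expansion:
  fixes f :: "'e::euclidean_space \<Rightarrow> real"
  assumes "smooth_on (ball z0 r) f" "0 < r"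
  obtains h where "\<And>i. smooth_on (ball z0 (r / 2)) (h i)"
    "\<And>i. h i z0 = frechet_derivative f (at z0) i"
    "\<And>z. z \<in> ball z0 (r / 2) \<Longrightarrow> f z = f z0 + (\<Sum>i\<in>Basis. inner (z - z0) i * h i z)"
proof -
  \<comment> \<open>The derivatives in \<open>Ck_on\<close> are full ones, so [0,1] is enlarged to
    an open interval. For t of modulus below 2, halving the radius keeps z0 + t (z - z0) inside the
    original ball.\<close>
  let ?S = "ball z0 (r / 2)" and ?T = "{-2<..<2::real}"
  let ?f' = "\<lambda>z. frechet_derivative f (at z)"
  let ?c = "\<lambda>(z, t). z0 + t *\<^sub>R (z - z0)"
  have oST: "open (?S \<times> ?T)" by (intro open_Times) auto
  have c_in: "z0 + t *\<^sub>R (z - z0) \<in> ball z0 r" if "z \<in> ?S" "t \<in> ?T" for z t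
  proof -
    have "\<bar>t\<bar> * norm (z - z0) \<le> 2 * norm (z - z0)"
      by (rule mult_right_mono) (use that(2) in auto)
    also have "\<dots> < r"
      using that(1) by (auto simp: dist_norm norm_minus_commute)
    finally show ?thesis by (simp add: dist_norm)
  qed
  define h where "h = (\<lambda>i z. integral (cbox 0 1) (\<lambda>t. ?f' (?c (z, t)) i))"
  show thesis
  proof (rule that)
    show "smooth_on ?S (h i)" for i
    proof -
      have lin: "smooth_on (?S \<times> ?T) (\<lambda>x. z0 + snd x *\<^sub>R (fst x + - z0))"
        by (intro smooth_on_add smooth_on_scaleR smooth_on_const smooth_on_bounded_linear oST
            bounded_linear_fst bounded_linear_snd)
      have "smooth_on (?S \<times> ?T) (\<lambda>x. ?f' (z0 + snd x *\<^sub>R (fst x + - z0)) i)"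
        by (rule smooth_on_compose[OF oST open_ball lin _ smooth_on_frechet_derivative[OF assms(1)]])
          (use c_in in auto)
      then have "Ck_on (?S \<times> ?T) (\<lambda>x. ?f' (?c x) i) k" for k
        by (simp add: smooth_on_def case_prod_beta')
      then have "Ck_on ?S (\<lambda>z. integral (cbox 0 1) (\<lambda>t. (\<lambda>x. ?f' (?c x) i) (z, t))) k" for k
        by (intro Ck_on_integral[of ?S ?T]) auto
      then show ?thesis by (simp add: smooth_on_def h_def)
    qed
    show "h i z0 = ?f' z0 i" for i by (simp add: h_def)
    show "f z = f z0 + (\<Sum>i\<in>Basis. inner (z - z0) i * h i z)" if z: "z \<in> ?S" for z
    proof -
      have l: "linear (?f' y)" if "y \<in> ball z0 r" for y
        using smooth_on_has_derivative[OF assms(1) that] has_derivative_linear by blast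
      have d: "((\<lambda>t. f (z0 + t *\<^sub>R (z - z0))) has_vector_derivative
          (\<Sum>i\<in>Basis. inner (z - z0) i * ?f' (?c (z, t)) i)) (at t within {0..1})"
        if t: "t \<in> {0..1}" for t
      proof -
        have i: "?c (z, t) \<in> ball z0 r" using c_in[OF z, of t] t by auto
        have "((\<lambda>t. z0 + t *\<^sub>R (z - z0)) has_derivative (\<lambda>v. v *\<^sub>R (z - z0))) (at t within {0..1})"
          by (auto intro!: derivative_eq_intros)
        then have "((\<lambda>t. f (z0 + t *\<^sub>R (z - z0))) has_derivative (\<lambda>v. ?f' (?c (z, t)) (v *\<^sub>R (z - z0))))
            (at t within {0..1})"
          by (rule has_derivative_compose) (use smooth_on_has_derivative[OF assms(1) i] in simp)
        moreover have "?f' (?c (z, t)) (v *\<^sub>R (z - z0))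
            = v *\<^sub>R (\<Sum>j\<in>Basis. inner (z - z0) j * ?f' (?c (z, t)) j)" for v
        proof -
          have "?f' (?c (z, t)) (z - z0) = ?f' (?c (z, t)) (\<Sum>j\<in>Basis. inner (z - z0) j *\<^sub>R j)"
            by (simp only: euclidean_representation)
          also have "\<dots> = (\<Sum>j\<in>Basis. inner (z - z0) j * ?f' (?c (z, t)) j)"
            by (simp only: linear_sum[OF l[OF i]] linear_cmul[OF l[OF i]] real_scaleR_def)
          finally show ?thesis by (simp only: linear_cmul[OF l[OF i]])
        qed
        ultimately show ?thesis by (simp add: has_vector_derivative_def)
      qed
      have int: "(\<lambda>t. ?f' (?c (z, t)) i) integrable_on cbox 0 1" for i
      proof (rule integrable_continuous, simp)
        show "continuous_on {0..1} (\<lambda>t. ?f' (z0 + t *\<^sub>R (z - z0)) i)"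
          by (rule continuous_on_compose2[OF smooth_on_continuous[OF smooth_on_frechet_derivative[OF assms(1)]]])
            (use c_in[OF z] in \<open>auto intro!: continuous_intros\<close>)
      qed
      have "((\<lambda>t. \<Sum>i\<in>Basis. inner (z - z0) i * ?f' (?c (z, t)) i) has_integral
          f (z0 + 1 *\<^sub>R (z - z0)) - f (z0 + 0 *\<^sub>R (z - z0))) {0..1}"
        by (rule fundamental_theorem_of_calculus) (use d in auto)
      moreover have "((\<lambda>t. \<Sum>i\<in>Basis. inner (z - z0) i * ?f' (?c (z, t)) i) has_integral
          (\<Sum>i\<in>Basis. inner (z - z0) i * h i z)) (cbox 0 1)"
        unfolding h_def by (intro has_integral_sum has_integral_mult_right integrable_integral int) auto
      ultimately have "f (z0 + 1 *\<^sub>R (z - z0)) - f (z0 + 0 *\<^sub>R (z - z0))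
          = (\<Sum>i\<in>Basis. inner (z - z0) i * h i z)"
        unfolding box_real(2) by (rule has_integral_unique)
      then show ?thesis by simp
    qed
  qed
qed

section \<open>Smooth functions on a manifold\<close>

text \<open>Functions given only on an open set, such as coordinates, have to be called smooth there
  before a bump function extends them.\<close>

definition smooth_fun_on :: "('m, 'e::euclidean_space) atlas \<Rightarrow> 'm set \<Rightarrow> ('m \<Rightarrow> real) \<Rightarrow> bool" where
  "smooth_fun_on A S f \<longleftrightarrow> (\<forall>(U, \<phi>)\<in>A. smooth_on (\<phi> ` (U \<inter> S)) (f \<circ> inv_into U \<phi>))"

lemma smooth_functions_eq: "f \<in> smooth_functions A \<longleftrightarrow> smooth_fun_on A UNIV f"
  by (auto simp: smooth_functions_def smooth_fun_on_def)

locale manifold =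
  fixes A :: "('m::{t2_space,second_countable_topology}, 'e::euclidean_space) atlas"
  assumes smooth_manifold: "smooth_manifold A"
begin

lemma chart_exists: obtains U \<phi> where "(U, \<phi>) \<in> A" "p \<in> U"
proof -
  have "p \<in> (\<Union>(U, \<phi>)\<in>A. U)" using smooth_manifold by (simp add: smooth_manifold_def)
  then show thesis using that by auto
qed

lemma chart:
  assumes "(U, \<phi>) \<in> A"
  shows "open U" "open (\<phi> ` U)" "homeomorphism U (\<phi> ` U) \<phi> (inv_into U \<phi>)" "inj_on \<phi> U"
    "continuous_on U \<phi>" "continuous_on (\<phi> ` U) (inv_into U \<phi>)"
proof -
  show 1: "open U" "open (\<phi> ` U)" and h: "homeomorphism U (\<phi> ` U) \<phi> (inv_into U \<phi>)"
    using smooth_manifold assms by (auto simp: smooth_manifold_def)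
  show "continuous_on U \<phi>" "continuous_on (\<phi> ` U) (inv_into U \<phi>)"
    using h by (auto simp: homeomorphism_def)
  have "\<And>x. x \<in> U \<Longrightarrow> inv_into U \<phi> (\<phi> x) = x" using h by (auto simp: homeomorphism_def)
  then show "inj_on \<phi> U" by (rule inj_on_inverseI)
qed

lemma chart_transition:
  assumes "(U, \<phi>) \<in> A" "(V, \<psi>) \<in> A"
  shows "smooth_on (\<phi> ` (U \<inter> V)) (\<psi> \<circ> inv_into U \<phi>)"
proof -
  have "\<forall>(U, \<phi>)\<in>A. \<forall>(V, \<psi>)\<in>A. smooth_on (\<phi> ` (U \<inter> V)) (\<psi> \<circ> inv_into U \<phi>)"
    using smooth_manifold by (simp add: smooth_manifold_def)
  then show ?thesis using assms by auto
qed

lemma chart_inv: "(U, \<phi>) \<in> A \<Longrightarrow> q \<in> U \<Longrightarrow> inv_into U \<phi> (\<phi> q) = q"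
  using chart(4) by simp

lemma open_chart_image:
  assumes "(U, \<phi>) \<in> A" "open S"
  shows "open (\<phi> ` (U \<inter> S))"
proof -
  have "openin (top_of_set U) (U \<inter> S)" using assms(2) by (simp add: openin_open_Int)
  then have "openin (top_of_set (\<phi> ` U)) (\<phi> ` (U \<inter> S))"
    using homeomorphism_imp_open_map[OF chart(3)[OF assms(1)]] by simp
  then show ?thesis using chart(2)[OF assms(1)] by (simp add: openin_open_eq)
qed

lemma open_chart_preimage:
  "(U, \<phi>) \<in> A \<Longrightarrow> open S \<Longrightarrow> open (U \<inter> \<phi> -` S)"
  using continuous_open_preimage[OF chart(5) chart(1)] by blast

lemma smooth_fun_onD:
  "smooth_fun_on A S f \<Longrightarrow> (U, \<phi>) \<in> A \<Longrightarrow> smooth_on (\<phi> ` (U \<inter> S)) (f \<circ> inv_into U \<phi>)"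
  unfolding smooth_fun_on_def by auto

lemma smooth_fun_onI:
  "(\<And>U \<phi>. (U, \<phi>) \<in> A \<Longrightarrow> smooth_on (\<phi> ` (U \<inter> S)) (\<lambda>z. f (inv_into U \<phi> z))) \<Longrightarrow> smooth_fun_on A S f"
  unfolding smooth_fun_on_def comp_def by auto

lemma smooth_fun_on_cong:
  assumes "open S" "\<And>q. q \<in> S \<Longrightarrow> f q = h q" "smooth_fun_on A S f"
  shows "smooth_fun_on A S h"
proof (rule smooth_fun_onI)
  fix U \<phi> assume c: "(U, \<phi>) \<in> A"
  have "smooth_on (\<phi> ` (U \<inter> S)) (\<lambda>z. f (inv_into U \<phi> z))"
    using smooth_fun_onD[OF assms(3) c] by (simp add: comp_def)
  then show "smooth_on (\<phi> ` (U \<inter> S)) (\<lambda>z. h (inv_into U \<phi> z))"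
    by (subst (asm) smooth_on_cong[OF open_chart_image[OF c assms(1)]])
      (auto simp: chart_inv[OF c] assms(2))
qed

lemma smooth_fun_on_subset: "smooth_fun_on A S f \<Longrightarrow> T \<subseteq> S \<Longrightarrow> smooth_fun_on A T f"
  by (intro smooth_fun_onI, rule smooth_on_subset[OF smooth_fun_onD[unfolded comp_def]]) auto

lemma smooth_fun_on_local:
  assumes "\<And>q. q \<in> S \<Longrightarrow> \<exists>N. open N \<and> q \<in> N \<and> smooth_fun_on A N f"
  shows "smooth_fun_on A S f"
proof (rule smooth_fun_onI)
  fix U \<phi> assume c: "(U, \<phi>) \<in> A"
  show "smooth_on (\<phi> ` (U \<inter> S)) (\<lambda>z. f (inv_into U \<phi> z))"
  proof (rule smooth_on_local)
    fix z assume "z \<in> \<phi> ` (U \<inter> S)"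
    then obtain q where q: "z = \<phi> q" "q \<in> U" "q \<in> S" by auto
    then obtain N where N: "open N" "q \<in> N" "smooth_fun_on A N f" using assms by blast
    show "\<exists>T. open T \<and> z \<in> T \<and> smooth_on T (\<lambda>z. f (inv_into U \<phi> z))"
      using open_chart_image[OF c N(1)] smooth_fun_onD[OF N(3) c] N(2) q
      by (auto simp: comp_def intro!: exI[of _ "\<phi> ` (U \<inter> N)"])
  qed
qed

lemma smooth_fun_on_const: "open S \<Longrightarrow> smooth_fun_on A S (\<lambda>q. c)"
  by (intro smooth_fun_onI smooth_on_const open_chart_image)

lemma smooth_fun_on_add:
  "open S \<Longrightarrow> smooth_fun_on A S f \<Longrightarrow> smooth_fun_on A S h \<Longrightarrow> smooth_fun_on A S (\<lambda>q. f q + h q)"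
  by (intro smooth_fun_onI smooth_on_add open_chart_image)
    (auto dest: smooth_fun_onD simp: comp_def)

lemma smooth_fun_on_mult:
  "open S \<Longrightarrow> smooth_fun_on A S f \<Longrightarrow> smooth_fun_on A S h \<Longrightarrow> smooth_fun_on A S (\<lambda>q. f q * h q)"
  by (intro smooth_fun_onI smooth_on_mult open_chart_image)
    (auto dest: smooth_fun_onD simp: comp_def)

lemma smooth_fun_on_sum:
  "open S \<Longrightarrow> (\<And>i. i \<in> I \<Longrightarrow> smooth_fun_on A S (f i)) \<Longrightarrow> smooth_fun_on A S (\<lambda>q. \<Sum>i\<in>I. f i q)"
  by (induction I rule: infinite_finite_induct) (simp_all add: smooth_fun_on_const smooth_fun_on_add)

lemma smooth_fun_on_prod:
  "open S \<Longrightarrow> (\<And>i. i \<in> I \<Longrightarrow> smooth_fun_on A S (f i)) \<Longrightarrow> smooth_fun_on A S (\<lambda>q. \<Prod>i\<in>I. f i q)"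
  by (induction I rule: infinite_finite_induct) (simp_all add: smooth_fun_on_const smooth_fun_on_mult)

lemma smooth_fun_on_inverse:
  assumes "open S" "smooth_fun_on A S f" "\<And>q. q \<in> S \<Longrightarrow> f q \<noteq> 0"
  shows "smooth_fun_on A S (\<lambda>q. inverse (f q))"
proof (rule smooth_fun_onI)
  fix U \<phi> assume c: "(U, \<phi>) \<in> A"
  show "smooth_on (\<phi> ` (U \<inter> S)) (\<lambda>z. inverse (f (inv_into U \<phi> z)))"
    by (rule smooth_on_compose[OF open_chart_image[OF c assms(1)] _ _ _ smooth_on_inverse])
      (use smooth_fun_onD[OF assms(2) c] assms(3) in \<open>auto simp: comp_def chart_inv[OF c]\<close>)
qed

text \<open>Smoothness is tested in every chart of the atlas; the transition maps carry it over from
  the one chart in which the function is given.\<close>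

lemma smooth_fun_on_chart:
  assumes c: "(U, \<phi>) \<in> A" and "open S" "smooth_on S F"
  shows "smooth_fun_on A (U \<inter> \<phi> -` S) (\<lambda>q. F (\<phi> q))"
proof (rule smooth_fun_onI)
  fix V \<psi> assume d: "(V, \<psi>) \<in> A"
  have o: "open (\<psi> ` (V \<inter> (U \<inter> \<phi> -` S)))"
    by (rule open_chart_image[OF d open_chart_preimage[OF c assms(2)]])
  have t: "smooth_on (\<psi> ` (V \<inter> (U \<inter> \<phi> -` S))) (\<lambda>z. \<phi> (inv_into V \<psi> z))"
    by (rule smooth_on_subset[OF chart_transition[OF d c, unfolded comp_def]]) auto
  show "smooth_on (\<psi> ` (V \<inter> (U \<inter> \<phi> -` S))) (\<lambda>z. F (\<phi> (inv_into V \<psi> z)))"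
    by (rule smooth_on_compose[OF o assms(2) t _ assms(3)]) (auto simp: chart_inv[OF d])
qed

lemma smooth_fun_on_continuous:
  assumes "smooth_fun_on A S f" "open S"
  shows "continuous_on S f"
proof -
  have "isCont f q" if "q \<in> S" for q
  proof -
    obtain U \<phi> where c: "(U, \<phi>) \<in> A" "q \<in> U" by (rule chart_exists)
    have o: "open (U \<inter> S)" using chart(1)[OF c(1)] assms(2) by auto
    have "continuous_on (U \<inter> S) (\<lambda>q. (f \<circ> inv_into U \<phi>) (\<phi> q))"
      by (rule continuous_on_compose2[OF smooth_on_continuous[OF smooth_fun_onD[OF assms(1) c(1)]]])
        (auto intro: continuous_on_subset[OF chart(5)[OF c(1)]])
    then have "continuous_on (U \<inter> S) f"
      by (rule continuous_on_eq) (simp add: chart_inv[OF c(1)])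
    then show ?thesis using o c(2) that by (auto simp: continuous_on_eq_continuous_at)
  qed
  then show ?thesis by (simp add: continuous_at_imp_continuous_on)
qed

abbreviation "SF \<equiv> smooth_functions A"

lemma SF_smooth_on: "f \<in> SF \<Longrightarrow> smooth_fun_on A S f"
  unfolding smooth_functions_eq using smooth_fun_on_subset by blast

lemma SF_continuous: "f \<in> SF \<Longrightarrow> continuous_on UNIV f"
  using smooth_fun_on_continuous[OF _ open_UNIV] by (simp add: smooth_functions_eq)

lemma SF_const [simp]: "(\<lambda>q. c) \<in> SF"
  by (simp add: smooth_functions_eq smooth_fun_on_const)

lemma SF_add: "f \<in> SF \<Longrightarrow> h \<in> SF \<Longrightarrow> (\<lambda>q. f q + h q) \<in> SF"
  by (simp add: smooth_functions_eq smooth_fun_on_add)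

lemma SF_mult: "f \<in> SF \<Longrightarrow> h \<in> SF \<Longrightarrow> (\<lambda>q. f q * h q) \<in> SF"
  by (simp add: smooth_functions_eq smooth_fun_on_mult)

lemma SF_cmult: "f \<in> SF \<Longrightarrow> (\<lambda>q. c * f q) \<in> SF"
  using SF_mult[OF SF_const] by blast

lemma SF_minus: "f \<in> SF \<Longrightarrow> (\<lambda>q. - f q) \<in> SF"
  using SF_cmult[of f "- 1"] by simp

lemma SF_diff: "f \<in> SF \<Longrightarrow> h \<in> SF \<Longrightarrow> (\<lambda>q. f q - h q) \<in> SF"
  using SF_add[OF _ SF_minus] by fastforce

lemma SF_sum: "(\<And>i. i \<in> I \<Longrightarrow> f i \<in> SF) \<Longrightarrow> (\<lambda>q. \<Sum>i\<in>I. f i q) \<in> SF"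
  by (simp add: smooth_functions_eq smooth_fun_on_sum)

lemma SF_prod: "(\<And>i. i \<in> I \<Longrightarrow> f i \<in> SF) \<Longrightarrow> (\<lambda>q. \<Prod>i\<in>I. f i q) \<in> SF"
  by (simp add: smooth_functions_eq smooth_fun_on_prod)

lemma SF_power: "f \<in> SF \<Longrightarrow> (\<lambda>q. (f q)^n) \<in> SF"
  by (induction n) (simp_all add: SF_mult)

lemmas SF_intros = SF_const SF_add SF_mult SF_minus SF_diff SF_sum SF_power

lemma SF_local:
  assumes "\<And>q. \<exists>N h. open N \<and> q \<in> N \<and> h \<in> SF \<and> (\<forall>q'\<in>N. f q' = h q')"
  shows "f \<in> SF"
  unfolding smooth_functions_eq
proof (rule smooth_fun_on_local)
  fix q
  obtain N h where "open N" "q \<in> N" "h \<in> SF" "\<forall>q'\<in>N. f q' = h q'" using assms by blast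
  then show "\<exists>N. open N \<and> q \<in> N \<and> smooth_fun_on A N f"
    using smooth_fun_on_cong[of N h f] SF_smooth_on by auto
qed

text \<open>The preimage K of a closed coordinate ball is compact, hence closed in a Hausdorff
  space. A function that is smooth on \<open>U \<inter> S\<close> and zero off K is therefore smooth
  on two open sets covering the manifold. The clause on arbitrary f is the form in which local
  constructions become global.\<close>

lemma bump_exists:
  assumes "open S" "p \<in> S"
  obtains \<beta> N where "\<beta> \<in> SF" "open N" "p \<in> N" "N \<subseteq> S" "\<forall>q\<in>N. \<beta> q = 1"
    "\<forall>f. smooth_fun_on A S f \<longrightarrow> (\<lambda>q. if q \<in> S then \<beta> q * f q else 0) \<in> SF"
    "\<forall>q. q \<notin> S \<longrightarrow> \<beta> q = 0"
proof -
  obtain U \<phi> where c: "(U, \<phi>) \<in> A" "p \<in> U" by (rule chart_exists)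
  have "open (\<phi> ` (U \<inter> S))" "\<phi> p \<in> \<phi> ` (U \<inter> S)"
    using open_chart_image[OF c(1) assms(1)] c(2) assms(2) by auto
  then obtain e where e: "e > 0" "cball (\<phi> p) e \<subseteq> \<phi> ` (U \<inter> S)"
    using open_contains_cball by blast
  obtain b where b: "smooth_on UNIV b" "\<And>z. z \<in> ball (\<phi> p) (e/2) \<Longrightarrow> b z = (1::real)"
    "\<And>z. z \<notin> cball (\<phi> p) (2 * (e/2)) \<Longrightarrow> b z = 0"
    using exists_smooth_bump[of "e/2" "\<phi> p"] e by auto
  define K where "K = inv_into U \<phi> ` cball (\<phi> p) e"
  define \<beta> where "\<beta> = (\<lambda>q. if q \<in> U then b (\<phi> q) else 0)"
  define N where "N = U \<inter> \<phi> -` ball (\<phi> p) (e/2)"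
  have "compact K" unfolding K_def
    by (rule compact_continuous_image[OF continuous_on_subset[OF chart(6)[OF c(1)]] compact_cball])
      (use e in auto)
  then have K: "open (- K)" using compact_imp_closed by auto
  have KU: "K \<subseteq> U \<inter> S"
  proof
    fix q assume "q \<in> K"
    then obtain z where z: "z \<in> cball (\<phi> p) e" "q = inv_into U \<phi> z" by (auto simp: K_def)
    then obtain q' where "z = \<phi> q'" "q' \<in> U \<inter> S" using e(2) by blast
    with z show "q \<in> U \<inter> S" using chart_inv[OF c(1)] by auto
  qed
  have \<beta>0: "\<beta> q = 0" if "q \<notin> K" for q
  proof (cases "q \<in> U")
    case True
    then have "\<phi> q \<notin> cball (\<phi> p) e" using that chart_inv[OF c(1) True] unfolding K_def by (metis image_eqI)
    then show ?thesis using b(3) by (simp add: \<beta>_def)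
  qed (simp add: \<beta>_def)
  have sU: "smooth_fun_on A U \<beta>"
  proof (rule smooth_fun_on_cong[OF chart(1)[OF c(1)]])
    show "smooth_fun_on A U (\<lambda>q. b (\<phi> q))"
      using smooth_fun_on_chart[OF c(1) open_UNIV b(1)] by simp
  qed (simp add: \<beta>_def)
  have glue: "g \<in> SF" if "smooth_fun_on A (U \<inter> S) g" "\<And>q. q \<notin> K \<Longrightarrow> g q = 0" for g
    unfolding smooth_functions_eq
  proof (rule smooth_fun_on_local)
    fix q
    have k: "smooth_fun_on A (- K) g"
      by (rule smooth_fun_on_cong[OF K, of "\<lambda>q. 0"]) (use that smooth_fun_on_const[OF K] in auto)
    show "\<exists>N. open N \<and> q \<in> N \<and> smooth_fun_on A N g"
    proof (cases "q \<in> K")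
      case True
      then show ?thesis using that(1) KU assms(1) chart(1)[OF c(1)] by (intro exI[of _ "U \<inter> S"]) auto
    next
      case False
      then show ?thesis using k K by (intro exI[of _ "- K"]) auto
    qed
  qed
  show thesis
  proof (rule that)
    show "\<beta> \<in> SF" by (rule glue[OF smooth_fun_on_subset[OF sU] \<beta>0]) auto
    show "open N" unfolding N_def by (rule open_chart_preimage[OF c(1) open_ball])
    show "p \<in> N" using c e by (simp add: N_def)
    show "N \<subseteq> S"
    proof
      fix q assume q: "q \<in> N"
      then have "\<phi> q \<in> cball (\<phi> p) e" "q \<in> U" using e by (auto simp: N_def)
      then obtain q' where "\<phi> q = \<phi> q'" "q' \<in> U \<inter> S" using e(2) by blast
      then show "q \<in> S" using chart(4)[OF c(1)] \<open>q \<in> U\<close> by (auto dest: inj_onD)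
    qed
    show "\<forall>q\<in>N. \<beta> q = 1" using b(2) by (simp add: N_def \<beta>_def)
    show "\<forall>f. smooth_fun_on A S f \<longrightarrow> (\<lambda>q. if q \<in> S then \<beta> q * f q else 0) \<in> SF"
    proof (intro allI impI, rule glue)
      fix f assume f: "smooth_fun_on A S f"
      have o: "open (U \<inter> S)" using chart(1)[OF c(1)] assms(1) by auto
      show "smooth_fun_on A (U \<inter> S) (\<lambda>q. if q \<in> S then \<beta> q * f q else 0)"
        by (rule smooth_fun_on_cong[OF o _ smooth_fun_on_mult[OF o smooth_fun_on_subset[OF sU]
              smooth_fun_on_subset[OF f]]]) auto
    qed (use \<beta>0 in auto)
    show "\<forall>q. q \<notin> S \<longrightarrow> \<beta> q = 0" using \<beta>0 KU by auto
  qed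
qed

end

section \<open>Tangent vectors and local frames\<close>

definition fscale :: "('m \<Rightarrow> real) \<Rightarrow> 'm vfield \<Rightarrow> 'm vfield" where
  "fscale h X = (\<lambda>p f. h p * X p f)"

context manifold
begin

abbreviation "T\<^sub>p \<equiv> tangent_space A"
abbreviation "VF \<equiv> vector_fields A"

lemma tangent_add: "v \<in> T\<^sub>p q \<Longrightarrow> f \<in> SF \<Longrightarrow> h \<in> SF \<Longrightarrow> v (\<lambda>q. f q + h q) = v f + v h"
  by (simp add: tangent_space_def)

lemma tangent_cmult: "v \<in> T\<^sub>p q \<Longrightarrow> f \<in> SF \<Longrightarrow> v (\<lambda>q. c * f q) = c * v f"
  by (simp add: tangent_space_def)

lemma tangent_mult:
  "v \<in> T\<^sub>p q \<Longrightarrow> f \<in> SF \<Longrightarrow> h \<in> SF \<Longrightarrow> v (\<lambda>q. f q * h q) = v f * h q + f q * v h"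
  by (simp add: tangent_space_def)

lemma tangent_nonsmooth: "v \<in> T\<^sub>p q \<Longrightarrow> f \<notin> SF \<Longrightarrow> v f = 0"
  by (simp add: tangent_space_def)

lemma tangentI:
  assumes "\<And>f h. f \<in> SF \<Longrightarrow> h \<in> SF \<Longrightarrow> v (\<lambda>q. f q + h q) = v f + v h"
    "\<And>f c. f \<in> SF \<Longrightarrow> v (\<lambda>q. c * f q) = c * v f"
    "\<And>f h. f \<in> SF \<Longrightarrow> h \<in> SF \<Longrightarrow> v (\<lambda>q. f q * h q) = v f * h q + f q * v h"
    "\<And>f. f \<notin> SF \<Longrightarrow> v f = 0"
  shows "v \<in> T\<^sub>p q"
  using assms by (simp add: tangent_space_def)

lemma tangent_const: assumes "v \<in> T\<^sub>p q" shows "v (\<lambda>q. c) = 0"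
proof -
  have "v (\<lambda>q. 1 * 1) = v (\<lambda>q. 1) * 1 + 1 * v (\<lambda>q. 1)" by (rule tangent_mult[OF assms]) auto
  then have "v (\<lambda>q. 1) = 0" by simp
  moreover have "v (\<lambda>q. c * 1) = c * v (\<lambda>q. 1)" by (rule tangent_cmult[OF assms]) auto
  ultimately show ?thesis by simp
qed

lemma tangent_minus: assumes "v \<in> T\<^sub>p q" "f \<in> SF" shows "v (\<lambda>q. - f q) = - v f"
  using tangent_cmult[OF assms, of "- 1"] by simp

lemma tangent_diff:
  assumes "v \<in> T\<^sub>p q" "f \<in> SF" "h \<in> SF" shows "v (\<lambda>q. f q - h q) = v f - v h"
  using tangent_add[OF assms(1,2) SF_minus[OF assms(3)]] tangent_minus[OF assms(1,3)] by simp

lemma tangent_sum: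
  assumes v: "v \<in> T\<^sub>p q" shows "(\<And>i. i \<in> I \<Longrightarrow> f i \<in> SF) \<Longrightarrow> v (\<lambda>q. \<Sum>i\<in>I. f i q) = (\<Sum>i\<in>I. v (f i))"
  by (induction I rule: infinite_finite_induct)
    (simp_all add: tangent_const[OF v] tangent_add[OF v] SF_sum)

lemma tangent_power2: "v \<in> T\<^sub>p q \<Longrightarrow> f \<in> SF \<Longrightarrow> v (\<lambda>q. (f q)\<^sup>2) = 2 * f q * v f"
  by (simp add: power2_eq_square tangent_mult)

text \<open>For a bump \<beta> that vanishes off N, the product \<beta> (f - h) is identically zero.
  The Leibniz rule at q, where \<beta> = 1 and f - h = 0, leaves exactly v (f - h).\<close>

lemma tangent_local:
  assumes v: "v \<in> T\<^sub>p q" and "f \<in> SF" "h \<in> SF" "open N" "q \<in> N" "\<And>q'. q' \<in> N \<Longrightarrow> f q' = h q'"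
  shows "v f = v h"
proof -
  obtain \<beta> N' where b: "\<beta> \<in> SF" "q \<in> N'" "\<forall>q\<in>N'. \<beta> q = 1" "\<forall>q. q \<notin> N \<longrightarrow> \<beta> q = 0"
    by (rule bump_exists[OF assms(4,5)])
  have d: "(\<lambda>q. f q - h q) \<in> SF" by (rule SF_diff[OF assms(2,3)])
  have "(\<lambda>q. \<beta> q * (f q - h q)) = (\<lambda>q. 0)" using b(4) assms(6) by force
  then have "v (\<lambda>q. \<beta> q * (f q - h q)) = 0" using tangent_const[OF v] by simp
  moreover have "v (\<lambda>q. \<beta> q * (f q - h q)) = v \<beta> * (f q - h q) + \<beta> q * v (\<lambda>q. f q - h q)"
    by (rule tangent_mult[OF v b(1) d])
  ultimately show ?thesis using b(2,3) assms(5,6) tangent_diff[OF v assms(2,3)] by simp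
qed

lemma tangent_space_add: "v \<in> T\<^sub>p q \<Longrightarrow> w \<in> T\<^sub>p q \<Longrightarrow> (\<lambda>f. v f + w f) \<in> T\<^sub>p q"
  by (simp add: tangent_space_def algebra_simps)

lemma tangent_space_scale: "v \<in> T\<^sub>p q \<Longrightarrow> (\<lambda>f. c * v f) \<in> T\<^sub>p q"
  by (simp add: tangent_space_def algebra_simps)

lemma tangent_space_0: "(\<lambda>f. 0) \<in> T\<^sub>p q"
  by (simp add: tangent_space_def)

lemma tangent_space_sum: "(\<And>i. i \<in> I \<Longrightarrow> v i \<in> T\<^sub>p q) \<Longrightarrow> (\<lambda>f. \<Sum>i\<in>I. v i f) \<in> T\<^sub>p q"
  by (induction I rule: infinite_finite_induct) (simp_all add: tangent_space_0 tangent_space_add)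

lemma pushforward_tangent:
  assumes M: "manifold A'" and h: "\<And>f. f \<in> SF \<Longrightarrow> (\<lambda>p. f (h p)) \<in> smooth_functions A'"
    and v: "v \<in> tangent_space A' p"
  shows "pushforward A h v \<in> T\<^sub>p (h p)"
proof -
  interpret M: manifold A' by (rule M)
  show ?thesis
    by (rule tangentI)
      (simp_all add: pushforward_def comp_def h M.tangent_add[OF v] M.tangent_cmult[OF v]
        M.tangent_mult[OF v] SF_add SF_mult SF_cmult)
qed

lemma VF_tangent: "X \<in> VF \<Longrightarrow> X q \<in> T\<^sub>p q"
  by (simp add: vector_fields_def)

lemma VF_smooth: "X \<in> VF \<Longrightarrow> f \<in> SF \<Longrightarrow> vf_apply X f \<in> SF"
  by (simp add: vector_fields_def)

lemma VF_I: "(\<And>q. X q \<in> T\<^sub>p q) \<Longrightarrow> (\<And>f. f \<in> SF \<Longrightarrow> (\<lambda>q. X q f) \<in> SF) \<Longrightarrow> X \<in> VF"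
  by (simp add: vector_fields_def vf_apply_def)

text \<open>Tangent vectors are 0 on non-smooth functions, so f need not be smooth. Identities for
  brackets can thus be proved as equalities of functionals on all functions.\<close>

lemma VF_smooth_all: assumes "X \<in> VF" shows "vf_apply X f \<in> SF"
proof (cases "f \<in> SF")
  case False
  then have "vf_apply X f = (\<lambda>q. 0)"
    using tangent_nonsmooth[OF VF_tangent[OF assms]] by (auto simp: vf_apply_def)
  then show ?thesis by simp
qed (rule VF_smooth[OF assms])

lemma VF_apply: "X \<in> VF \<Longrightarrow> f \<in> SF \<Longrightarrow> (\<lambda>q. X q f) \<in> SF"
  using VF_smooth by (simp add: vf_apply_def)

lemma VF_add: assumes "X \<in> VF" "Y \<in> VF" shows "(\<lambda>p f. X p f + Y p f) \<in> VF"
proof (rule VF_I)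
  show "(\<lambda>f. X q f + Y q f) \<in> T\<^sub>p q" for q
    by (intro tangent_space_add VF_tangent assms)
  show "(\<lambda>q. X q f + Y q f) \<in> SF" if "f \<in> SF" for f
    using SF_add[OF VF_apply[OF assms(1) that] VF_apply[OF assms(2) that]] .
qed

lemma VF_fscale: assumes "h \<in> SF" "X \<in> VF" shows "fscale h X \<in> VF"
  unfolding fscale_def
proof (rule VF_I)
  show "(\<lambda>f. h q * X q f) \<in> T\<^sub>p q" for q
    by (intro tangent_space_scale VF_tangent assms)
  show "(\<lambda>q. h q * X q f) \<in> SF" if "f \<in> SF" for f
    using SF_mult[OF assms(1) VF_apply[OF assms(2) that]] .
qed

lemma VF_sum: assumes "\<And>i. i \<in> I \<Longrightarrow> X i \<in> VF" shows "(\<lambda>p f. \<Sum>i\<in>I. X i p f) \<in> VF"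
proof (rule VF_I)
  show "(\<lambda>f. \<Sum>i\<in>I. X i q f) \<in> T\<^sub>p q" for q
    by (intro tangent_space_sum VF_tangent assms)
  show "(\<lambda>q. \<Sum>i\<in>I. X i q f) \<in> SF" if "f \<in> SF" for f
    using SF_sum[of I "\<lambda>i q. X i q f"] VF_apply[OF assms that] .
qed

lemma vf_apply_add:
  assumes "X \<in> VF" "f \<in> SF" "h \<in> SF"
  shows "vf_apply X (\<lambda>q. f q + h q) = (\<lambda>q. vf_apply X f q + vf_apply X h q)"
  using tangent_add[OF VF_tangent[OF assms(1)] assms(2,3)] by (auto simp: vf_apply_def)

lemma vf_apply_cmult:
  assumes "X \<in> VF" "f \<in> SF"
  shows "vf_apply X (\<lambda>q. c * f q) = (\<lambda>q. c * vf_apply X f q)"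
  using tangent_cmult[OF VF_tangent[OF assms(1)] assms(2)] by (auto simp: vf_apply_def)

lemma vf_apply_mult:
  assumes "X \<in> VF" "f \<in> SF" "h \<in> SF"
  shows "vf_apply X (\<lambda>q. f q * h q) = (\<lambda>q. vf_apply X f q * h q + f q * vf_apply X h q)"
  using tangent_mult[OF VF_tangent[OF assms(1)] assms(2,3)] by (auto simp: vf_apply_def)

lemma vf_apply_const: "X \<in> VF \<Longrightarrow> vf_apply X (\<lambda>q. c) = (\<lambda>q. 0)"
  using tangent_const[OF VF_tangent] by (auto simp: vf_apply_def)

lemma vf_apply_minus: "X \<in> VF \<Longrightarrow> f \<in> SF \<Longrightarrow> vf_apply X (\<lambda>q. - f q) = (\<lambda>q. - vf_apply X f q)"
  using vf_apply_cmult[of X f "- 1"] by simp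

lemma vf_apply_diff:
  "X \<in> VF \<Longrightarrow> f \<in> SF \<Longrightarrow> h \<in> SF \<Longrightarrow> vf_apply X (\<lambda>q. f q - h q) = (\<lambda>q. vf_apply X f q - vf_apply X h q)"
  using tangent_diff[OF VF_tangent] by (simp add: vf_apply_def)

lemma vf_apply_power2:
  "X \<in> VF \<Longrightarrow> f \<in> SF \<Longrightarrow> vf_apply X (\<lambda>q. (f q)\<^sup>2) = (\<lambda>q. 2 * f q * vf_apply X f q)"
  using tangent_power2[OF VF_tangent] by (simp add: vf_apply_def)

lemma lie_bracket_VF:
  assumes X: "X \<in> VF" and Y: "Y \<in> VF"
  shows "lie_bracket X Y \<in> VF"
proof (rule VF_I)
  note Xs = VF_smooth[OF X] and Ys = VF_smooth[OF Y]
  show "lie_bracket X Y q \<in> T\<^sub>p q" for q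
  proof (rule tangentI)
    fix f h assume f: "f \<in> SF" and h: "h \<in> SF"
    show "lie_bracket X Y q (\<lambda>q. f q + h q) = lie_bracket X Y q f + lie_bracket X Y q h"
      by (simp add: lie_bracket_def vf_apply_add[OF X f h] vf_apply_add[OF Y f h]
          tangent_add[OF VF_tangent[OF X]] tangent_add[OF VF_tangent[OF Y]] Xs Ys f h)
    show "lie_bracket X Y q (\<lambda>q. f q * h q) = lie_bracket X Y q f * h q + f q * lie_bracket X Y q h"
      by (simp add: lie_bracket_def vf_apply_mult[OF X f h] vf_apply_mult[OF Y f h]
          tangent_add[OF VF_tangent[OF X]] tangent_add[OF VF_tangent[OF Y]] Xs Ys f h SF_mult
          tangent_mult[OF VF_tangent[OF X]] tangent_mult[OF VF_tangent[OF Y]] algebra_simps)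
        (simp add: vf_apply_def)
  next
    fix f c assume f: "f \<in> SF"
    show "lie_bracket X Y q (\<lambda>q. c * f q) = c * lie_bracket X Y q f"
      by (simp add: lie_bracket_def vf_apply_cmult[OF X f] vf_apply_cmult[OF Y f]
          tangent_cmult[OF VF_tangent[OF X]] tangent_cmult[OF VF_tangent[OF Y]] Xs Ys f algebra_simps)
  next
    fix f assume f: "f \<notin> SF"
    have "vf_apply X f = (\<lambda>q. 0)" "vf_apply Y f = (\<lambda>q. 0)"
      using tangent_nonsmooth[OF VF_tangent[OF X] f] tangent_nonsmooth[OF VF_tangent[OF Y] f]
      by (auto simp: vf_apply_def)
    then show "lie_bracket X Y q f = 0"
      by (simp add: lie_bracket_def tangent_const[OF VF_tangent[OF X]] tangent_const[OF VF_tangent[OF Y]])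
  qed
  show "(\<lambda>q. lie_bracket X Y q f) \<in> SF" if "f \<in> SF" for f
    using SF_diff[OF Xs[OF Ys[OF that]] Ys[OF Xs[OF that]]]
    by (simp add: lie_bracket_def vf_apply_def)
qed

text \<open>Coordinates and coordinate derivatives live on U only; a bump makes them global without
  changing them on N. The last clause is Hadamard's lemma: in f = f(q) + sum of (u_i - u_i(q)) h_i,
  a derivation at q picks out v(u_i) h_i(q), and h_i(q) is the i-th partial derivative. The explicit
  formula for \<open>E i\<close> is kept in the conclusion so that frames of a product chart can be
  compared with those of its factors.\<close>

lemma chart_frame:
  assumes c: "(U, \<phi>) \<in> A" and p: "p \<in> U"
  obtains N :: "'m set" and u :: "'e \<Rightarrow> 'm \<Rightarrow> real" and E :: "'e \<Rightarrow> 'm vfield"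
  where "open N" "p \<in> N" "N \<subseteq> U" "\<forall>i. u i \<in> SF" "\<forall>i. E i \<in> VF"
    "\<forall>i. \<forall>q\<in>N. u i q = inner (\<phi> q) i"
    "\<forall>i. \<forall>q\<in>N. \<forall>f\<in>SF. E i q f = frechet_derivative (f \<circ> inv_into U \<phi>) (at (\<phi> q)) i"
    "\<forall>q\<in>N. \<forall>v\<in>T\<^sub>p q. \<forall>f\<in>SF. v f = (\<Sum>i\<in>Basis. v (u i) * E i q f)"
proof -
  obtain \<beta> N where b: "\<beta> \<in> SF" "open N" "p \<in> N" "N \<subseteq> U" "\<forall>q\<in>N. \<beta> q = 1"
    "\<forall>f. smooth_fun_on A U f \<longrightarrow> (\<lambda>q. if q \<in> U then \<beta> q * f q else 0) \<in> SF"
    "\<forall>q. q \<notin> U \<longrightarrow> \<beta> q = 0"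
    by (rule bump_exists[OF chart(1)[OF c] p])
  note b = b(1-4) b(5-)[rule_format]
  define u where "u = (\<lambda>i q. if q \<in> U then \<beta> q * inner (\<phi> q) i else 0)"
  let ?F = "\<lambda>f. f \<circ> inv_into U \<phi>"
  \<comment> \<open>The test on f realises the convention that a tangent vector is 0 on functions
    that are not smooth.\<close>
  define E where "E = (\<lambda>i q f. if f \<in> SF \<and> q \<in> U
      then \<beta> q * frechet_derivative (?F f) (at (\<phi> q)) i else 0)"
  have on_chart: "smooth_fun_on A U (\<lambda>q. H (\<phi> q))" if "smooth_on (\<phi> ` U) H" for H :: "'e \<Rightarrow> real"
    using smooth_fun_on_subset[OF smooth_fun_on_chart[OF c chart(2)[OF c] that]] by auto
  have Fs: "smooth_on (\<phi> ` U) (?F f)" if "f \<in> SF" for f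
    using smooth_fun_onD[OF SF_smooth_on[OF that, of UNIV] c] by simp
  have Fd: "(?F f has_derivative frechet_derivative (?F f) (at (\<phi> q))) (at (\<phi> q))"
    if "f \<in> SF" "q \<in> U" for f q
    by (rule smooth_on_has_derivative[OF Fs[OF that(1)]]) (use that(2) in auto)
  have us: "u i \<in> SF" for i
    unfolding u_def
    by (intro b(6) on_chart smooth_on_bounded_linear bounded_linear_inner_left chart(2)[OF c])
  have Es: "E i \<in> VF" for i
  proof (rule VF_I)
    fix q
    show "E i q \<in> T\<^sub>p q"
    proof (cases "q \<in> U")
      case q: True
      show ?thesis
      proof (rule tangentI)
        fix f h assume f: "f \<in> SF" and h: "h \<in> SF"
        have "frechet_derivative (?F (\<lambda>q. f q + h q)) (at (\<phi> q))
            = (\<lambda>v. frechet_derivative (?F f) (at (\<phi> q)) v + frechet_derivative (?F h) (at (\<phi> q)) v)"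
          using has_derivative_add[OF Fd[OF f q] Fd[OF h q]]
          by (intro frechet_derivative_at[symmetric]) (simp add: comp_def)
        then show "E i q (\<lambda>q. f q + h q) = E i q f + E i q h"
          using f h by (simp add: E_def q SF_add algebra_simps)
        have "frechet_derivative (?F (\<lambda>q. f q * h q)) (at (\<phi> q))
            = (\<lambda>v. f q * frechet_derivative (?F h) (at (\<phi> q)) v + frechet_derivative (?F f) (at (\<phi> q)) v * h q)"
          using has_derivative_mult[OF Fd[OF f q] Fd[OF h q]]
          by (intro frechet_derivative_at[symmetric]) (simp add: comp_def chart_inv[OF c q])
        then show "E i q (\<lambda>q. f q * h q) = E i q f * h q + f q * E i q h"
          using f h by (simp add: E_def q SF_mult algebra_simps)
      next
        fix f and k :: real assume f: "f \<in> SF"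
        have "frechet_derivative (?F (\<lambda>q. k * f q)) (at (\<phi> q))
            = (\<lambda>v. k * frechet_derivative (?F f) (at (\<phi> q)) v)"
          using has_derivative_mult_right[OF Fd[OF f q], of k]
          by (intro frechet_derivative_at[symmetric]) (simp add: comp_def)
        then show "E i q (\<lambda>q. k * f q) = k * E i q f"
          using f by (simp add: E_def q SF_cmult algebra_simps)
      qed (simp add: E_def)
    next
      case False
      then have "E i q = (\<lambda>f. 0)" by (simp add: E_def fun_eq_iff)
      then show ?thesis using tangent_space_0 by simp
    qed
  next
    fix f assume f: "f \<in> SF"
    have "(\<lambda>q. if q \<in> U then \<beta> q * frechet_derivative (?F f) (at (\<phi> q)) i else 0) \<in> SF"
      by (intro b(6) on_chart smooth_on_frechet_derivative Fs f)
    then show "(\<lambda>q. E i q f) \<in> SF" using f by (simp add: E_def)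
  qed
  have EN: "E i q f = frechet_derivative (?F f) (at (\<phi> q)) i" if "q \<in> N" "f \<in> SF" for i q f
    using that b(4,5) by (auto simp: E_def)
  have uN: "u i q = inner (\<phi> q) i" if "q \<in> N" for i q
    using that b(4,5) by (auto simp: u_def)
  have "v f = (\<Sum>i\<in>Basis. v (u i) * E i q f)" if q: "q \<in> N" and v: "v \<in> T\<^sub>p q" and f: "f \<in> SF" for q v f
  proof -
    have qU: "q \<in> U" using q b(4) by auto
    obtain r where r: "r > 0" "ball (\<phi> q) r \<subseteq> \<phi> ` U"
      using chart(2)[OF c] qU open_contains_ball by blast
    obtain h where h: "\<And>i. smooth_on (ball (\<phi> q) (r / 2)) (h i)"
      "\<And>i. h i (\<phi> q) = frechet_derivative (?F f) (at (\<phi> q)) i"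
      "\<And>z. z \<in> ball (\<phi> q) (r / 2) \<Longrightarrow>
         ?F f z = ?F f (\<phi> q) + (\<Sum>i\<in>Basis. inner (z - \<phi> q) i * h i z)"
      using hadamard_expansion[OF smooth_on_subset[OF Fs[OF f] r(2)] r(1)] by blast
    \<comment> \<open>The coefficients \<open>h i\<close> exist only near \<open>\<phi> q\<close>. A
      second bump, supported in the corresponding neighbourhood, turns them into global smooth
      functions to which v applies.\<close>
    define S where "S = N \<inter> (U \<inter> \<phi> -` ball (\<phi> q) (r/2))"
    have S: "open S" "q \<in> S"
      using b(2) open_chart_preimage[OF c open_ball] q qU r(1) by (auto simp: S_def)
    obtain \<beta>' N' where "\<beta>' \<in> SF"
      and b': "open N'" "q \<in> N'" "N' \<subseteq> S" "\<forall>q\<in>N'. \<beta>' q = 1"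
      "\<forall>f. smooth_fun_on A S f \<longrightarrow> (\<lambda>q. if q \<in> S then \<beta>' q * f q else 0) \<in> SF"
      and "\<forall>q. q \<notin> S \<longrightarrow> \<beta>' q = 0"
      by (rule bump_exists[OF S])
    note b' = b'(1-3) b'(4-)[rule_format]
    define h' where "h' = (\<lambda>i q'. if q' \<in> S then \<beta>' q' * h i (\<phi> q') else 0)"
    have h's: "h' i \<in> SF" for i
      unfolding h'_def
      by (rule b'(5), rule smooth_fun_on_subset[OF smooth_fun_on_chart[OF c open_ball h(1)]])
        (auto simp: S_def)
    have h'N: "h' i q' = h i (\<phi> q')" if "q' \<in> N'" for i q'
      using that b'(3,4) by (auto simp: h'_def)
    have ex: "f q' = f q + (\<Sum>i\<in>Basis. (u i q' - u i q) * h' i q')" if "q' \<in> N'" for q'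
    proof -
      have i: "q' \<in> N" "q' \<in> U" "\<phi> q' \<in> ball (\<phi> q) (r/2)" using that b'(3) by (auto simp: S_def)
      show ?thesis using h(3)[OF i(3)]
        by (simp add: chart_inv[OF c] qU i uN q h'N that inner_diff_left)
    qed
    have sm: "(\<lambda>q'. (u i q' - u i q) * h' i q') \<in> SF" for i
      by (intro SF_intros us h's)
    have "v f = v (\<lambda>q'. f q + (\<Sum>i\<in>Basis. (u i q' - u i q) * h' i q'))"
      by (rule tangent_local[OF v f _ b'(1,2) ex]) (intro SF_intros us h's)
    also have "\<dots> = (\<Sum>i\<in>Basis. v (\<lambda>q'. (u i q' - u i q) * h' i q'))"
      by (simp add: tangent_add[OF v] tangent_const[OF v] tangent_sum[OF v] SF_sum sm)
    also have "\<dots> = (\<Sum>i\<in>Basis. v (u i) * E i q f)"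
      by (rule sum.cong) (simp_all add: tangent_mult[OF v] tangent_diff[OF v] tangent_const[OF v]
          SF_diff us h's h'N b'(2) h(2) EN q f)
    finally show ?thesis .
  qed
  then show thesis using us Es uN EN by (intro that[OF b(2,3,4), of u E]) auto
qed

text \<open>The chart-free form of the coordinate frame. Evaluating at \<open>u j\<close> recovers
  the coefficients of a linear combination of the \<open>E i\<close>, which serves the rank
  computations and the Gram determinant.\<close>

lemma local_frame:
  obtains N :: "'m set" and u :: "'e \<Rightarrow> 'm \<Rightarrow> real" and E :: "'e \<Rightarrow> 'm vfield"
  where "open N" "p \<in> N" "\<forall>i. u i \<in> SF" "\<forall>i. E i \<in> VF"
    "\<forall>q\<in>N. \<forall>i\<in>Basis. \<forall>j\<in>Basis. E i q (u j) = (if i = j then 1 else 0)"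
    "\<forall>q\<in>N. \<forall>v\<in>T\<^sub>p q. v = (\<lambda>f. \<Sum>i\<in>Basis. v (u i) * E i q f)"
proof -
  obtain U \<phi> where c: "(U, \<phi>) \<in> A" "p \<in> U" by (rule chart_exists)
  obtain N u E where f: "open N" "p \<in> N" "N \<subseteq> U" "\<forall>i. u i \<in> SF" "\<forall>i. E i \<in> VF"
    "\<forall>i. \<forall>q\<in>N. u i q = inner (\<phi> q) (i::'e)"
    "\<forall>i. \<forall>q\<in>N. \<forall>f\<in>SF. E i q f = frechet_derivative (f \<circ> inv_into U \<phi>) (at (\<phi> q)) i"
    "\<forall>q\<in>N. \<forall>v\<in>T\<^sub>p q. \<forall>f\<in>SF. v f = (\<Sum>i\<in>Basis. v (u i) * E i q f)"
    by (rule chart_frame[OF c])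
  note f = f(1-3) f(4-)[rule_format]
  show thesis
  proof (rule that[OF f(1,2)]; intro allI ballI)
    fix q v assume q: "q \<in> N" and v: "v \<in> T\<^sub>p q"
    show "v = (\<lambda>f. \<Sum>i\<in>Basis. v (u i) * E i q f)"
    proof
      fix h show "v h = (\<Sum>i\<in>Basis. v (u i) * E i q h)"
      proof (cases "h \<in> SF")
        case True then show ?thesis by (rule f(8)[OF q v])
      next
        case False
        then show ?thesis
          using tangent_nonsmooth[OF v False] tangent_nonsmooth[OF VF_tangent[OF f(5)] False] by simp
      qed
    qed
  next
    fix i j :: 'e and q assume q: "q \<in> N" and ij: "i \<in> Basis" "j \<in> Basis"
    have qU: "q \<in> U" using q f(3) by auto
    have o: "open (\<phi> ` (U \<inter> N))" by (rule open_chart_image[OF c(1) f(1)])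
    have "((u j \<circ> inv_into U \<phi>) has_derivative (\<lambda>z. inner z j)) (at (\<phi> q))"
      by (rule has_derivative_transform_within_open[OF bounded_linear_imp_has_derivative[OF
              bounded_linear_inner_left] o])
        (use q qU in \<open>auto simp: chart_inv[OF c(1)] f(6)\<close>)
    then have "frechet_derivative (u j \<circ> inv_into U \<phi>) (at (\<phi> q)) = (\<lambda>z. inner z j)"
      by (rule frechet_derivative_at[symmetric])
    then show "E i q (u j) = (if i = j then 1 else 0)"
      using f(7)[OF q f(4)] ij by (simp add: inner_Basis)
  qed (rule f)+
qed

end

text \<open>Linearity over the smooth functions, the condition under which the value at p depends
  only on the vector at p and \<open>form_at\<close> is well defined.\<close>

definition tensorial :: "('m, 'e::euclidean_space) atlas \<Rightarrow> 'm form \<Rightarrow> bool" where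
  "tensorial A \<omega> \<longleftrightarrow>
     (\<forall>X\<in>vector_fields A. \<forall>Y\<in>vector_fields A. \<forall>p. \<omega> (\<lambda>p f. X p f + Y p f) p = \<omega> X p + \<omega> Y p) \<and>
     (\<forall>h\<in>smooth_functions A. \<forall>X\<in>vector_fields A. \<forall>p. \<omega> (fscale h X) p = h p * \<omega> X p)"

context manifold
begin

lemma tangent_extends:
  assumes "v \<in> T\<^sub>p p"
  obtains X where "X \<in> VF" "X p = v"
proof -
  obtain N u and E :: "'e \<Rightarrow> 'm vfield" where N: "open N" "p \<in> N" and uE: "\<forall>i. u i \<in> SF" "\<forall>i. E i \<in> VF"
    and "\<forall>q\<in>N. \<forall>i\<in>Basis. \<forall>j\<in>Basis. E i q (u j) = (if i = j then 1 else 0)"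
    and r: "\<forall>q\<in>N. \<forall>v\<in>T\<^sub>p q. v = (\<lambda>f. \<Sum>i\<in>Basis. v (u i) * E i q f)"
    by (rule local_frame)
  define X where "X = (\<lambda>p f. \<Sum>i\<in>(Basis::'e set). fscale (\<lambda>q. v (u i)) (E i) p f)"
  have "X \<in> VF" unfolding X_def by (intro VF_sum VF_fscale SF_const) (use uE in auto)
  moreover have "X p = v"
  proof -
    have "v = (\<lambda>f. \<Sum>i\<in>Basis. v (u i) * E i p f)" using r N(2) assms by blast
    then show ?thesis by (simp add: X_def fscale_def)
  qed
  ultimately show thesis by (rule that)
qed

lemma tensorial_add:
  "tensorial A \<omega> \<Longrightarrow> X \<in> VF \<Longrightarrow> Y \<in> VF \<Longrightarrow> \<omega> (\<lambda>p f. X p f + Y p f) p = \<omega> X p + \<omega> Y p"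
  by (simp add: tensorial_def)

lemma tensorial_fscale:
  "tensorial A \<omega> \<Longrightarrow> h \<in> SF \<Longrightarrow> X \<in> VF \<Longrightarrow> \<omega> (fscale h X) p = h p * \<omega> X p"
  by (simp add: tensorial_def)

lemma VF_0: "(\<lambda>p f. 0) \<in> VF"
  by (rule VF_I) (simp_all add: tangent_space_0)

lemma tensorial_0: assumes "tensorial A \<omega>" shows "\<omega> (\<lambda>p f. 0) p = 0"
  using tensorial_fscale[OF assms SF_const VF_0, of 0 p] by (simp add: fscale_def)

lemma tensorial_sum:
  assumes "tensorial A \<omega>" "\<And>i. i \<in> I \<Longrightarrow> X i \<in> VF"
  shows "\<omega> (\<lambda>p f. \<Sum>i\<in>I. X i p f) p = (\<Sum>i\<in>I. \<omega> (X i) p)"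
  using assms(2)
  by (induction I rule: infinite_finite_induct)
    (simp_all add: tensorial_0[OF assms(1)] tensorial_add[OF assms(1)] VF_sum)

text \<open>The frame expansion of Z is valid on N only, but multiplied by a bump it becomes an
  identity between global fields, to which \<omega> can be applied. All its coefficients vanish at
  p.\<close>

lemma tensorial_vanish:
  assumes \<omega>: "tensorial A \<omega>" and Z: "Z \<in> VF" "Z p = (\<lambda>f. 0)"
  shows "\<omega> Z p = 0"
proof -
  obtain N u and E :: "'e \<Rightarrow> 'm vfield" where N: "open N" "p \<in> N" and uE: "\<forall>i. u i \<in> SF" "\<forall>i. E i \<in> VF"
    and "\<forall>q\<in>N. \<forall>i\<in>Basis. \<forall>j\<in>Basis. E i q (u j) = (if i = j then 1 else 0)"
    and r: "\<forall>q\<in>N. \<forall>v\<in>T\<^sub>p q. v = (\<lambda>f. \<Sum>i\<in>Basis. v (u i) * E i q f)"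
    by (rule local_frame)
  obtain \<beta> N' where b: "\<beta> \<in> SF" "p \<in> N'" "\<forall>q\<in>N'. \<beta> q = 1" "\<forall>q. q \<notin> N \<longrightarrow> \<beta> q = 0"
    by (rule bump_exists[OF N])
  let ?c = "\<lambda>i q. \<beta> q * vf_apply Z (u i) q"
  have c: "?c i \<in> SF" for i by (intro SF_mult b(1) VF_smooth Z(1)) (use uE in auto)
  have e: "fscale \<beta> Z = (\<lambda>q f. \<Sum>i\<in>(Basis::'e set). fscale (?c i) (E i) q f)"
  proof (intro ext)
    fix q f
    show "fscale \<beta> Z q f = (\<Sum>i\<in>(Basis::'e set). fscale (?c i) (E i) q f)"
    proof (cases "q \<in> N")
      case True
      have "Z q = (\<lambda>f. \<Sum>i\<in>Basis. Z q (u i) * E i q f)" using r True VF_tangent[OF Z(1)] by blast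
      from fun_cong[OF this, of f] show ?thesis
        by (simp add: fscale_def vf_apply_def sum_distrib_left mult.assoc)
    qed (use b(4) in \<open>simp add: fscale_def\<close>)
  qed
  have "\<beta> p * \<omega> Z p = (\<Sum>i\<in>(Basis::'e set). \<omega> (fscale (?c i) (E i)) p)"
    using tensorial_fscale[OF \<omega> b(1) Z(1)] tensorial_sum[OF \<omega>, of Basis "\<lambda>i. fscale (?c i) (E i)" p]
      VF_fscale[OF c] uE by (simp add: e)
  also have "\<dots> = 0"
    using tensorial_fscale[OF \<omega> c] uE Z(2) by (simp add: vf_apply_def)
  finally show ?thesis using b(2,3) by simp
qed

lemma tensorial_pointwise:
  assumes \<omega>: "tensorial A \<omega>" and "X \<in> VF" "Y \<in> VF" "X p = Y p"
  shows "\<omega> X p = \<omega> Y p"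
proof -
  have m: "fscale (\<lambda>q. - 1) Y \<in> VF" by (intro VF_fscale SF_const assms)
  have z: "(\<lambda>p f. X p f + fscale (\<lambda>q. - 1) Y p f) \<in> VF" by (intro VF_add m assms)
  have "\<omega> (\<lambda>p f. X p f + fscale (\<lambda>q. - 1) Y p f) p = 0"
    by (rule tensorial_vanish[OF \<omega> z]) (simp add: fscale_def assms)
  then show ?thesis
    using tensorial_add[OF \<omega> assms(2) m] tensorial_fscale[OF \<omega> SF_const assms(3)] by simp
qed

lemma form_at_eq:
  assumes "tensorial A \<omega>" "X \<in> VF"
  shows "form_at A \<omega> p (X p) = \<omega> X p"
proof -
  have "(THE c. \<forall>Z\<in>VF. Z p = X p \<longrightarrow> \<omega> Z p = c) = \<omega> X p"
    by (rule the_equality) (use tensorial_pointwise[OF assms(1)] assms(2) in blast)+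
  then show ?thesis using VF_tangent[OF assms(2)] by (simp add: form_at_def)
qed

lemma form_at_add:
  assumes "tensorial A \<omega>" "v \<in> T\<^sub>p p" "w \<in> T\<^sub>p p"
  shows "form_at A \<omega> p (\<lambda>f. v f + w f) = form_at A \<omega> p v + form_at A \<omega> p w"
proof -
  obtain X where X: "X \<in> VF" "X p = v" by (rule tangent_extends[OF assms(2)])
  obtain Y where Y: "Y \<in> VF" "Y p = w" by (rule tangent_extends[OF assms(3)])
  show ?thesis
    using form_at_eq[OF assms(1) VF_add[OF X(1) Y(1)], of p] form_at_eq[OF assms(1) X(1), of p]
      form_at_eq[OF assms(1) Y(1), of p] tensorial_add[OF assms(1) X(1) Y(1)] X(2) Y(2) by simp
qed

lemma form_at_scale:
  assumes "tensorial A \<omega>" "v \<in> T\<^sub>p p"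
  shows "form_at A \<omega> p (\<lambda>f. c * v f) = c * form_at A \<omega> p v"
proof -
  obtain X where X: "X \<in> VF" "X p = v" by (rule tangent_extends[OF assms(2)])
  show ?thesis
    using form_at_eq[OF assms(1) VF_fscale[OF SF_const X(1), of c], of p] form_at_eq[OF assms(1) X(1), of p]
      tensorial_fscale[OF assms(1) SF_const X(1)] X(2) by (simp add: fscale_def)
qed

section \<open>Determinants of smooth matrices, pointwise covectors and bracket rules\<close>

lemma SF_det:
  assumes G: "\<And>q. G q \<in> carrier_mat n n" and s: "\<And>i j. i < n \<Longrightarrow> j < n \<Longrightarrow> (\<lambda>q. G q $$ (i, j)) \<in> SF"
  shows "(\<lambda>q. Determinant.det (G q)) \<in> SF"
proof -
  have "(\<lambda>q. \<Sum>p\<in>{p. p permutes {0..<n}}. signof p * (\<Prod>i = 0..<n. G q $$ (i, p i))) \<in> SF"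
    by (intro SF_sum SF_mult SF_const SF_prod s) (auto dest: permutes_in_image)
  then show ?thesis by (simp add: det_def'[OF G])
qed

lemma SF_adj_mat:
  assumes G: "\<And>q. G q \<in> carrier_mat n n" and s: "\<And>i j. i < n \<Longrightarrow> j < n \<Longrightarrow> (\<lambda>q. G q $$ (i, j)) \<in> SF"
    and ij: "i < n" "j < n"
  shows "(\<lambda>q. adj_mat (G q) $$ (i, j)) \<in> SF"
proof -
  have d: "dim_row (G q) = n" "dim_col (G q) = n" for q using G[of q] by auto
  have "(\<lambda>q. Determinant.det (mat_delete (G q) j i)) \<in> SF"
  proof (rule SF_det[OF mat_delete_carrier[OF G]])
    fix k l assume "k < n - 1" "l < n - 1"
    then show "(\<lambda>q. mat_delete (G q) j i $$ (k, l)) \<in> SF"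
      using s by (simp add: mat_delete_def d)
  qed
  then have "(\<lambda>q. (- 1) ^ (j + i) * Determinant.det (mat_delete (G q) j i)) \<in> SF"
    by (intro SF_mult SF_const)
  then show ?thesis using ij by (simp add: adj_mat_def cofactor_def d)
qed

definition covector :: "'m \<Rightarrow> 'm covec \<Rightarrow> bool" where
  "covector p \<alpha> \<longleftrightarrow> (\<forall>v\<in>T\<^sub>p p. \<forall>w\<in>T\<^sub>p p. \<alpha> (\<lambda>f. v f + w f) = \<alpha> v + \<alpha> w) \<and>
     (\<forall>c. \<forall>v\<in>T\<^sub>p p. \<alpha> (\<lambda>f. c * v f) = c * \<alpha> v)"

lemma covector_add:
  "covector p \<alpha> \<Longrightarrow> v \<in> T\<^sub>p p \<Longrightarrow> w \<in> T\<^sub>p p \<Longrightarrow> \<alpha> (\<lambda>f. v f + w f) = \<alpha> v + \<alpha> w"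
  by (simp add: covector_def)

lemma covector_scale: "covector p \<alpha> \<Longrightarrow> v \<in> T\<^sub>p p \<Longrightarrow> \<alpha> (\<lambda>f. c * v f) = c * \<alpha> v"
  by (simp add: covector_def)

lemma covector_0: assumes "covector p \<alpha>" shows "\<alpha> (\<lambda>f. 0) = 0"
  using covector_scale[OF assms tangent_space_0, of 0] by simp

lemma covector_sum:
  assumes "covector p \<alpha>" "\<And>i. i \<in> I \<Longrightarrow> v i \<in> T\<^sub>p p"
  shows "\<alpha> (\<lambda>f. \<Sum>i\<in>I. c i * v i f) = (\<Sum>i\<in>I. c i * \<alpha> (v i))"
  using assms(2)
proof (induction I rule: infinite_finite_induct)
  case (insert i I)
  have T: "v i \<in> T\<^sub>p p" "(\<lambda>f. \<Sum>i\<in>I. (\<lambda>f. c i * v i f) f) \<in> T\<^sub>p p"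
    by (auto intro!: tangent_space_sum tangent_space_scale insert.prems)
  have "\<alpha> (\<lambda>f. (\<lambda>f. c i * v i f) f + (\<lambda>f. \<Sum>i\<in>I. (\<lambda>f. c i * v i f) f) f)
      = \<alpha> (\<lambda>f. c i * v i f) + \<alpha> (\<lambda>f. \<Sum>i\<in>I. (\<lambda>f. c i * v i f) f)"
    by (rule covector_add[OF assms(1) tangent_space_scale[OF T(1)] T(2)])
  moreover have "\<alpha> (\<lambda>f. c i * v i f) = c i * \<alpha> (v i)"
    by (rule covector_scale[OF assms(1) T(1)])
  ultimately show ?case using insert by simp
qed (simp_all add: covector_0[OF assms(1)])

lemma covector_form_at: "tensorial A \<omega> \<Longrightarrow> covector p (form_at A \<omega> p)"
  by (simp add: covector_def form_at_add form_at_scale)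

lemma lie_bracket_fscale_right:
  assumes "X \<in> VF" "Y \<in> VF" "h \<in> SF"
  shows "lie_bracket X (fscale h Y) p = (\<lambda>f. vf_apply X h p * Y p f + h p * lie_bracket X Y p f)"
proof
  fix f
  have "vf_apply (fscale h Y) f = (\<lambda>q. h q * vf_apply Y f q)" by (simp add: fscale_def vf_apply_def)
  then show "lie_bracket X (fscale h Y) p f = vf_apply X h p * Y p f + h p * lie_bracket X Y p f"
    using tangent_mult[OF VF_tangent[OF assms(1)] assms(3) VF_smooth_all[OF assms(2)], of p f]
    by (simp add: lie_bracket_def fscale_def algebra_simps) (simp add: vf_apply_def)
qed

lemma lie_bracket_swap: "lie_bracket X Y p = (\<lambda>f. - 1 * lie_bracket Y X p f)"
  by (simp add: lie_bracket_def fun_eq_iff)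

lemma lie_bracket_add_right:
  assumes "X \<in> VF" "Y \<in> VF" "Z \<in> VF"
  shows "lie_bracket X (\<lambda>p f. Y p f + Z p f) p = (\<lambda>f. lie_bracket X Y p f + lie_bracket X Z p f)"
proof
  fix f
  have "vf_apply (\<lambda>p f. Y p f + Z p f) f = (\<lambda>q. vf_apply Y f q + vf_apply Z f q)"
    by (simp add: vf_apply_def)
  then show "lie_bracket X (\<lambda>p f. Y p f + Z p f) p f = lie_bracket X Y p f + lie_bracket X Z p f"
    using tangent_add[OF VF_tangent[OF assms(1)] VF_smooth_all[OF assms(2)] VF_smooth_all[OF assms(3)]]
    by (simp add: lie_bracket_def)
qed

end

section \<open>Singular metrics, Koszul form and contraction\<close>

locale singular_metric = manifold A
  for A :: "('m::{t2_space,second_countable_topology}, 'e::euclidean_space) atlas" +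
  fixes g :: "'m metric_tensor"
  assumes singular_semi_riemannian: "singular_semi_riemannian A g"
begin

lemma g_sym: "v \<in> T\<^sub>p p \<Longrightarrow> w \<in> T\<^sub>p p \<Longrightarrow> g p v w = g p w v"
  using singular_semi_riemannian by (simp add: singular_semi_riemannian_def)

lemma g_add_left:
  assumes "u \<in> T\<^sub>p p" "v \<in> T\<^sub>p p" "w \<in> T\<^sub>p p"
  shows "g p (\<lambda>f. u f + v f) w = g p u w + g p v w"
proof -
  have "g p (u + v) w = g p u w + g p v w"
    using singular_semi_riemannian assms unfolding singular_semi_riemannian_def by blast
  then show ?thesis by (simp add: plus_fun_def)
qed

lemma g_scale_left:
  "v \<in> T\<^sub>p p \<Longrightarrow> w \<in> T\<^sub>p p \<Longrightarrow> g p (\<lambda>f. c * v f) w = c * g p v w"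
  using singular_semi_riemannian by (simp add: singular_semi_riemannian_def)

lemma g_add_right:
  assumes "u \<in> T\<^sub>p p" "v \<in> T\<^sub>p p" "w \<in> T\<^sub>p p"
  shows "g p w (\<lambda>f. u f + v f) = g p w u + g p w v"
  using g_add_left[OF assms] g_sym[OF tangent_space_add[OF assms(1,2)] assms(3)]
    g_sym[OF assms(1,3)] g_sym[OF assms(2,3)] by simp

lemma g_scale_right:
  assumes "v \<in> T\<^sub>p p" "w \<in> T\<^sub>p p" shows "g p w (\<lambda>f. c * v f) = c * g p w v"
  using g_scale_left[OF assms, of c] g_sym[OF tangent_space_scale[OF assms(1)] assms(2)]
    g_sym[OF assms] by simp

lemma g_0_left: "w \<in> T\<^sub>p p \<Longrightarrow> g p (\<lambda>f. 0) w = 0"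
  using g_scale_left[OF tangent_space_0, of w p 0] by simp

lemma g_sum_left:
  "(\<And>i. i \<in> I \<Longrightarrow> v i \<in> T\<^sub>p p) \<Longrightarrow> w \<in> T\<^sub>p p \<Longrightarrow> g p (\<lambda>f. \<Sum>i\<in>I. v i f) w = (\<Sum>i\<in>I. g p (v i) w)"
  by (induction I rule: infinite_finite_induct)
    (simp_all add: g_0_left g_add_left tangent_space_sum)

lemma g_sum_right:
  assumes "\<And>i. i \<in> I \<Longrightarrow> v i \<in> T\<^sub>p p" "w \<in> T\<^sub>p p"
  shows "g p w (\<lambda>f. \<Sum>i\<in>I. v i f) = (\<Sum>i\<in>I. g p w (v i))"
proof -
  have "g p w (\<lambda>f. \<Sum>i\<in>I. v i f) = (\<Sum>i\<in>I. g p (v i) w)"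
    using g_sum_left[of I v p w] g_sym[OF assms(2) tangent_space_sum[of I v p]] assms by simp
  also have "\<dots> = (\<Sum>i\<in>I. g p w (v i))"
    by (rule sum.cong) (simp_all add: g_sym assms)
  finally show ?thesis .
qed

lemma metric_apply_SF: "X \<in> VF \<Longrightarrow> Y \<in> VF \<Longrightarrow> metric_apply g X Y \<in> SF"
  using singular_semi_riemannian by (simp add: singular_semi_riemannian_def)

lemma metric_apply_sym: "X \<in> VF \<Longrightarrow> Y \<in> VF \<Longrightarrow> metric_apply g X Y = metric_apply g Y X"
  using g_sym[OF VF_tangent VF_tangent] by (auto simp: metric_apply_def)

lemma tensorial_metric_apply: assumes "X \<in> VF" shows "tensorial A (metric_apply g X)"
  unfolding tensorial_def metric_apply_def fscale_def
  using g_add_right[OF VF_tangent VF_tangent VF_tangent[OF assms]]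
    g_scale_right[OF VF_tangent VF_tangent[OF assms]] by auto

lemma koszul_SF:
  assumes "X \<in> VF" "Y \<in> VF" "Z \<in> VF" shows "koszul g X Y Z \<in> SF"
  unfolding koszul_def
  by (intro SF_mult SF_const SF_add SF_diff VF_smooth metric_apply_SF lie_bracket_VF assms)

text \<open>Replacing Z by hZ, the derivatives of h cancel in pairs: X(h) g(Y,Z) from the product
  rule against the bracket of hZ with X, and Y(h) g(Z,X) against the bracket of Y with hZ.\<close>

lemma tensorial_koszul:
  assumes X: "X \<in> VF" and Y: "Y \<in> VF"
  shows "tensorial A (koszul g X Y)"
  unfolding tensorial_def
proof (intro conjI ballI allI)
  note T = VF_tangent lie_bracket_VF
  fix Z W p assume Z: "Z \<in> VF" and W: "W \<in> VF"
  let ?S = "\<lambda>p f. Z p f + W p f"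
  have S: "?S \<in> VF" by (rule VF_add[OF Z W])
  have 1: "metric_apply g Y ?S = (\<lambda>q. metric_apply g Y Z q + metric_apply g Y W q)"
    using tensorial_add[OF tensorial_metric_apply[OF Y] Z W] by auto
  have 2: "metric_apply g ?S X = (\<lambda>q. metric_apply g Z X q + metric_apply g W X q)"
    using tensorial_add[OF tensorial_metric_apply[OF X] Z W]
      metric_apply_sym[OF S X] metric_apply_sym[OF Z X] metric_apply_sym[OF W X] by auto
  have 3: "metric_apply g X (lie_bracket Y ?S) p = metric_apply g X (lie_bracket Y Z) p + metric_apply g X (lie_bracket Y W) p"
    unfolding metric_apply_def lie_bracket_add_right[OF Y Z W]
    by (intro g_add_right VF_tangent lie_bracket_VF X Y Z W)
  have 4: "metric_apply g Y (lie_bracket ?S X) p = metric_apply g Y (lie_bracket Z X) p + metric_apply g Y (lie_bracket W X) p"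
  proof -
    have "lie_bracket ?S X p = (\<lambda>f. lie_bracket Z X p f + lie_bracket W X p f)"
      using lie_bracket_add_right[OF X Z W, of p] lie_bracket_swap[of ?S X p]
        lie_bracket_swap[of Z X p] lie_bracket_swap[of W X p] by simp
    then show ?thesis
      unfolding metric_apply_def by (simp add: g_add_right VF_tangent lie_bracket_VF X Y Z W)
  qed
  have 5: "metric_apply g ?S (lie_bracket X Y) p = metric_apply g Z (lie_bracket X Y) p + metric_apply g W (lie_bracket X Y) p"
    unfolding metric_apply_def by (intro g_add_left VF_tangent lie_bracket_VF X Y Z W)
  have 6: "vf_apply ?S (metric_apply g X Y) p = vf_apply Z (metric_apply g X Y) p + vf_apply W (metric_apply g X Y) p"
    by (simp add: vf_apply_def)
  show "koszul g X Y ?S p = koszul g X Y Z p + koszul g X Y W p"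
    unfolding koszul_def 1 2 3 4 5 6
    by (simp add: vf_apply_add[OF X] vf_apply_add[OF Y] metric_apply_SF X Y Z W) (simp add: field_simps)
next
  fix h Z p assume h: "h \<in> SF" and Z: "Z \<in> VF"
  let ?S = "fscale h Z"
  have S: "?S \<in> VF" by (rule VF_fscale[OF h Z])
  have 1: "metric_apply g Y ?S = (\<lambda>q. h q * metric_apply g Y Z q)"
    using tensorial_fscale[OF tensorial_metric_apply[OF Y] h Z] by auto
  have 2: "metric_apply g ?S X = (\<lambda>q. h q * metric_apply g Z X q)"
    using tensorial_fscale[OF tensorial_metric_apply[OF X] h Z]
      metric_apply_sym[OF S X] metric_apply_sym[OF Z X] by auto
  have 3: "metric_apply g X (lie_bracket Y ?S) p
      = vf_apply Y h p * metric_apply g X Z p + h p * metric_apply g X (lie_bracket Y Z) p"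
    unfolding metric_apply_def lie_bracket_fscale_right[OF Y Z h]
    by (simp add: g_add_right g_scale_right VF_tangent lie_bracket_VF tangent_space_scale X Y Z)
  have 4: "metric_apply g Y (lie_bracket ?S X) p
      = - vf_apply X h p * metric_apply g Y Z p + h p * metric_apply g Y (lie_bracket Z X) p"
  proof -
    have "lie_bracket ?S X p = (\<lambda>f. - vf_apply X h p * Z p f + h p * lie_bracket Z X p f)"
      using lie_bracket_fscale_right[OF X Z h, of p] lie_bracket_swap[of ?S X p]
        lie_bracket_swap[of Z X p] by (simp add: fun_eq_iff algebra_simps)
    then have e: "metric_apply g Y (lie_bracket ?S X) p
        = g p (Y p) (\<lambda>f. - vf_apply X h p * Z p f + h p * lie_bracket Z X p f)"
      by (simp add: metric_apply_def)
    show ?thesis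
      unfolding e unfolding metric_apply_def
      by (simp only: g_add_right g_scale_right VF_tangent lie_bracket_VF tangent_space_scale X Y Z)
  qed
  have 5: "metric_apply g ?S (lie_bracket X Y) p = h p * metric_apply g Z (lie_bracket X Y) p"
    unfolding metric_apply_def fscale_def by (intro g_scale_left VF_tangent lie_bracket_VF X Y Z)
  have 6: "vf_apply ?S (metric_apply g X Y) p = h p * vf_apply Z (metric_apply g X Y) p"
    by (simp add: vf_apply_def fscale_def)
  have 7: "metric_apply g Z X p = metric_apply g X Z p" using metric_apply_sym[OF X Z] by simp
  show "koszul g X Y ?S p = h p * koszul g X Y Z p"
    unfolding koszul_def 1 2 3 4 5 6
    by (simp add: vf_apply_mult[OF X] vf_apply_mult[OF Y] metric_apply_SF X Y Z h) (simp add: 7 algebra_simps)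
qed

text \<open>Metric compatibility of the lowered connection. Used from right to left, together with
  the vanishing torsion below, it turns derivatives of the metric of F and its values on brackets
  into Koszul forms, where the curvature terms cancel.\<close>

lemma koszul_compat:
  assumes "X \<in> VF" "Y \<in> VF" "Z \<in> VF"
  shows "koszul g X Y Z p + koszul g X Z Y p = vf_apply X (metric_apply g Y Z) p"
proof -
  have b: "metric_apply g U (lie_bracket V W) p = - metric_apply g U (lie_bracket W V) p"
    if "U \<in> VF" "V \<in> VF" "W \<in> VF" for U V W
    unfolding metric_apply_def
    by (subst lie_bracket_swap, subst g_scale_right) (simp_all add: VF_tangent lie_bracket_VF that)
  show ?thesis
    using b[OF assms(3,2,1)] b[OF assms(2,1,3)] b[OF assms(1,3,2)]
      metric_apply_sym[OF assms(2,1)] metric_apply_sym[OF assms(3,1)] metric_apply_sym[OF assms(3,2)]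
    by (simp add: koszul_def field_simps)
qed

lemma koszul_torsion:
  assumes "X \<in> VF" "Y \<in> VF" "Z \<in> VF"
  shows "koszul g X Y Z p - koszul g Y X Z p = metric_apply g (lie_bracket X Y) Z p"
proof -
  have b: "metric_apply g U (lie_bracket V W) p = - metric_apply g U (lie_bracket W V) p"
    if "U \<in> VF" "V \<in> VF" "W \<in> VF" for U V W
    unfolding metric_apply_def
    by (subst lie_bracket_swap, subst g_scale_right) (simp_all add: VF_tangent lie_bracket_VF that)
  show ?thesis
    using b[OF assms(3,2,1)] b[OF assms(2,1,3)] b[OF assms(1,3,2)]
      metric_apply_sym[OF assms(2,1)] metric_apply_sym[OF assms(3,1)] metric_apply_sym[OF assms(3,2)]
      metric_apply_sym[OF lie_bracket_VF[OF assms(1,2)] assms(3)]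
    by (simp add: koszul_def field_simps)
qed

section \<open>Contraction and rank of a singular metric\<close>

lemma flat_eq_iff: "flat A g p v = flat A g p w \<longleftrightarrow> (\<forall>u\<in>T\<^sub>p p. g p v u = g p w u)"
  by (auto simp: flat_def fun_eq_iff)

lemma form_at_eq_flat:
  assumes "tensorial A \<omega>" "\<And>X. X \<in> VF \<Longrightarrow> \<omega> X p = g p v (X p)"
  shows "form_at A \<omega> p = flat A g p v"
proof
  fix w show "form_at A \<omega> p w = flat A g p v w"
  proof (cases "w \<in> T\<^sub>p p")
    case True
    then obtain X where "X \<in> VF" "X p = w" by (rule tangent_extends)
    then show ?thesis using form_at_eq[OF assms(1), of X p] assms(2)[of X] True by (simp add: flat_def)
  qed (simp add: form_at_def flat_def)
qed

text \<open>Vectors with the same lowered covector pair equally with every vector. Exchanging the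
  representatives one at a time, with symmetry in between, shows that the product does not depend on
  them.\<close>

lemma g_bullet_flat:
  assumes "v \<in> T\<^sub>p p" "w \<in> T\<^sub>p p"
  shows "g_bullet A g p (flat A g p v) (flat A g p w) = g p v w"
  unfolding g_bullet_def
proof (rule the_equality)
  show "\<exists>v'\<in>T\<^sub>p p. \<exists>w'\<in>T\<^sub>p p. flat A g p v = flat A g p v' \<and> flat A g p w = flat A g p w' \<and> g p v w = g p v' w'"
    using assms by blast
next
  fix c assume "\<exists>v'\<in>T\<^sub>p p. \<exists>w'\<in>T\<^sub>p p. flat A g p v = flat A g p v' \<and> flat A g p w = flat A g p w' \<and> c = g p v' w'"
  then obtain v' w' where 1: "v' \<in> T\<^sub>p p" "w' \<in> T\<^sub>p p" "flat A g p v = flat A g p v'"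
    "flat A g p w = flat A g p w'" "c = g p v' w'" by blast
  have "g p v' w' = g p v w'" using 1 flat_eq_iff by simp
  also have "\<dots> = g p w' v" using g_sym assms 1 by simp
  also have "\<dots> = g p w v" using 1 assms flat_eq_iff by simp
  also have "\<dots> = g p v w" using g_sym assms by simp
  finally show "c = g p v w" using 1 by simp
qed

text \<open>The rank is the dimension of a space of covectors. This reduces it to spanning and
  independence conditions on real coefficients, which can be checked for the twisted metric both on
  and off the zeros of b.\<close>

lemma metric_rank_eq:
  assumes "finite I" "\<And>i. i \<in> I \<Longrightarrow> e i \<in> T\<^sub>p p"
    and span: "\<And>v. v \<in> T\<^sub>p p \<Longrightarrow> \<exists>c. \<forall>w\<in>T\<^sub>p p. g p v w = (\<Sum>i\<in>I. c i * g p (e i) w)"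
    and ind: "\<And>c i. (\<forall>w\<in>T\<^sub>p p. (\<Sum>i\<in>I. c i * g p (e i) w) = 0) \<Longrightarrow> i \<in> I \<Longrightarrow> c i = 0"
  shows "metric_rank A g p = card I"
proof -
  interpret cv: vector_space "\<lambda>(c::real) (\<alpha>::'m covec). \<lambda>v. c * \<alpha> v"
    by unfold_locales (auto simp: fun_eq_iff algebra_simps)
  let ?a = "\<lambda>i. flat A g p (e i)"
  have sum_ap: "(\<Sum>i\<in>J. F i) v = (\<Sum>i\<in>J. F i v)" for F :: "'j \<Rightarrow> 'm covec" and J v
    by (induction J rule: infinite_finite_induct) auto
  have inj: "inj_on ?a I"
  proof (rule inj_onI, rule ccontr)
    fix i j assume ij: "i \<in> I" "j \<in> I" "?a i = ?a j" "i \<noteq> j"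
    \<comment> \<open>Dependence is formulated for the set of covectors, so two indices must not
      yield the same covector; the coefficients 1 and -1 would otherwise violate independence of the
      indexed family.\<close>
    let ?c = "\<lambda>k. if k = i then 1 else if k = j then - 1 else (0::real)"
    have "(\<Sum>k\<in>I. ?c k * g p (e k) w) = 0" if "w \<in> T\<^sub>p p" for w
    proof -
      have "(\<Sum>k\<in>I. ?c k * g p (e k) w) = (\<Sum>k\<in>{i, j}. ?c k * g p (e k) w)"
        by (rule sum.mono_neutral_right[OF assms(1)]) (use ij in auto)
      also have "\<dots> = g p (e i) w - g p (e j) w" using ij(4) by simp
      finally show ?thesis using ij(3) that flat_eq_iff by simp
    qed
    then show False using ind[of ?c i] ij(1) by auto
  qed
  have "cv.dim (T_bullet A g p) = card (?a ` I)"
  proof (rule cv.dim_eq_card)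
    show "cv.independent (?a ` I)"
    proof
      assume "cv.dependent (?a ` I)"
      then obtain u where u: "\<exists>v\<in>?a ` I. u v \<noteq> 0" "(\<Sum>v\<in>?a ` I. (\<lambda>x. u v * v x)) = 0"
        unfolding cv.dependent_finite[OF finite_imageI[OF assms(1)]] by (elim exE conjE) (rule that)
      have "(\<Sum>i\<in>I. (\<lambda>x. u (?a i) * ?a i x)) = 0"
        using u(2) by (simp add: sum.reindex[OF inj] comp_def)
      then have s0: "(\<Sum>i\<in>I. u (?a i) * ?a i w) = 0" for w
        using sum_ap[of "\<lambda>i x. u (?a i) * ?a i x" I w] by simp
      have s1: "(\<Sum>i\<in>I. u (?a i) * ?a i w) = (\<Sum>i\<in>I. u (?a i) * g p (e i) w)"
        if "w \<in> T\<^sub>p p" for w using that unfolding flat_def by simp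
      have "\<forall>w\<in>T\<^sub>p p. (\<Sum>i\<in>I. u (?a i) * g p (e i) w) = 0"
        by (intro ballI) (rule trans[OF s1[symmetric] s0])
      from ind[OF this] u(1) show False by auto
    qed
    have "?a ` I \<subseteq> T_bullet A g p" using assms(2) by (auto simp: T_bullet_def)
    moreover have "T_bullet A g p \<subseteq> cv.span (?a ` I)"
    proof
      fix \<alpha> assume "\<alpha> \<in> T_bullet A g p"
      then obtain v where v: "v \<in> T\<^sub>p p" "\<alpha> = flat A g p v" by (auto simp: T_bullet_def)
      obtain c where c: "\<forall>w\<in>T\<^sub>p p. g p v w = (\<Sum>i\<in>I. c i * g p (e i) w)" using span[OF v(1)] by blast
      have "\<alpha> = (\<Sum>i\<in>I. (\<lambda>x. c i * ?a i x))"
      proof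
        fix x show "\<alpha> x = (\<Sum>i\<in>I. (\<lambda>x. c i * ?a i x)) x"
          unfolding sum_ap v(2) flat_def using c by simp
      qed
      then show "\<alpha> \<in> cv.span (?a ` I)"
        by (simp only:) (intro cv.span_sum cv.span_scale cv.span_base imageI)
    qed
    ultimately show "cv.span (?a ` I) = cv.span (T_bullet A g p)"
      unfolding cv.span_eq using cv.span_superset by (intro conjI) (rule subset_trans)
  qed
  then show ?thesis by (simp add: metric_rank_def card_image[OF inj])
qed

lemma metric_rank_nondegenerate:
  assumes nd: "\<And>v. v \<in> T\<^sub>p p \<Longrightarrow> \<forall>w\<in>T\<^sub>p p. g p v w = 0 \<Longrightarrow> v = (\<lambda>f. 0)"
  shows "metric_rank A g p = DIM('e)"
proof -
  obtain N u and E :: "'e \<Rightarrow> 'm vfield" where N: "open N" "p \<in> N" and uE: "\<forall>i. u i \<in> SF" "\<forall>i. E i \<in> VF"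
    and d: "\<forall>q\<in>N. \<forall>i\<in>Basis. \<forall>j\<in>Basis. E i q (u j) = (if i = j then 1 else 0)"
    and r: "\<forall>q\<in>N. \<forall>v\<in>T\<^sub>p q. v = (\<lambda>f. \<Sum>i\<in>Basis. v (u i) * E i q f)"
    by (rule local_frame)
  have ET: "E i p \<in> T\<^sub>p p" for i using uE(2) VF_tangent by blast
  show ?thesis
  proof (rule metric_rank_eq[where e = "\<lambda>i. E i p"])
    show "\<exists>c. \<forall>w\<in>T\<^sub>p p. g p v w = (\<Sum>i\<in>Basis. c i * g p (E i p) w)" if v: "v \<in> T\<^sub>p p" for v
    proof (intro exI[of _ "\<lambda>i. v (u i)"] ballI)
      fix w assume w: "w \<in> T\<^sub>p p"
      have "v = (\<lambda>f. \<Sum>i\<in>Basis. (\<lambda>f. v (u i) * E i p f) f)" using r N(2) v by simp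
      then have "g p v w = g p (\<lambda>f. \<Sum>i\<in>Basis. (\<lambda>f. v (u i) * E i p f) f) w" by (rule arg_cong)
      also have "\<dots> = (\<Sum>i\<in>Basis. v (u i) * g p (E i p) w)"
        by (subst g_sum_left) (simp_all add: g_scale_left ET w tangent_space_scale)
      finally show "g p v w = (\<Sum>i\<in>Basis. v (u i) * g p (E i p) w)" .
    qed
    fix c and j :: 'e assume c: "\<forall>w\<in>T\<^sub>p p. (\<Sum>i\<in>Basis. c i * g p (E i p) w) = 0" and j: "j \<in> Basis"
    let ?v = "\<lambda>f. \<Sum>i\<in>(Basis::'e set). (\<lambda>f. c i * E i p f) f"
    have "?v = (\<lambda>f. 0)"
    proof (rule nd)
      show "?v \<in> T\<^sub>p p" by (intro tangent_space_sum tangent_space_scale ET)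
      show "\<forall>w\<in>T\<^sub>p p. g p ?v w = 0"
      proof
        fix w assume w: "w \<in> T\<^sub>p p"
        have "g p ?v w = (\<Sum>i\<in>Basis. c i * g p (E i p) w)"
          by (subst g_sum_left) (simp_all add: g_scale_left ET w tangent_space_scale)
        then show "g p ?v w = 0" using c w by simp
      qed
    qed
    from fun_cong[OF this, of "u j"] have "(\<Sum>i\<in>Basis. c i * E i p (u j)) = 0" by simp
    moreover have "(\<Sum>i\<in>Basis. c i * E i p (u j)) = (\<Sum>i\<in>Basis. if i = j then c i else 0)"
      by (rule sum.cong) (use d N(2) j in auto)
    ultimately show "c j = 0" using j by simp
  qed (auto simp: ET)
qed

text \<open>The representing vectors show that h is a smooth extension of the pointwise product. It
  is the only one: a second extension would differ from h on a nonempty open set by continuity, and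
  density puts a regular point into that set.\<close>

lemma contraction_eqI:
  assumes dense: "\<And>S. open S \<Longrightarrow> S \<noteq> {} \<Longrightarrow> \<exists>p\<in>S. p \<in> regular_points A g"
    and h: "h \<in> SF"
    and eq: "\<And>p. \<exists>v\<in>T\<^sub>p p. \<exists>w\<in>T\<^sub>p p. form_at A \<omega> p = flat A g p v \<and> form_at A \<tau> p = flat A g p w \<and> h p = g p v w"
  shows "contraction A g \<omega> \<tau> = h"
  unfolding contraction_def
proof (rule the_equality)
  have hp: "h p = g_bullet A g p (form_at A \<omega> p) (form_at A \<tau> p)" for p
    using eq[of p] g_bullet_flat by auto
  then show "h \<in> SF \<and> (\<forall>p\<in>regular_points A g. h p = g_bullet A g p (form_at A \<omega> p) (form_at A \<tau> p))"
    using h by simp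
  fix k assume k: "k \<in> SF \<and> (\<forall>p\<in>regular_points A g. k p = g_bullet A g p (form_at A \<omega> p) (form_at A \<tau> p))"
  have "continuous_on UNIV (\<lambda>p. k p - h p)" using SF_continuous[OF SF_diff] k h by blast
  then have "open ((\<lambda>p. k p - h p) -` (- {0}))" by (intro open_vimage) auto
  then have "(\<lambda>p. k p - h p) -` (- {0}) = {}" using dense k hp by fastforce
  then show "k = h" by (auto simp: fun_eq_iff)
qed

end

locale nondegenerate_metric = singular_metric A g
  for A :: "('m::{t2_space,second_countable_topology}, 'e::euclidean_space) atlas"
    and g :: "'m metric_tensor" +
  assumes nondegenerate: "nondegenerate A g"
begin

lemma nondeg_0: assumes "v \<in> T\<^sub>p p" "\<forall>w\<in>T\<^sub>p p. g p v w = 0" shows "v = (\<lambda>f. 0)"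
proof -
  have "v = 0" using nondegenerate assms unfolding nondegenerate_def by blast
  then show ?thesis by (simp add: zero_fun_def)
qed

lemma nondeg_eq:
  assumes "v \<in> T\<^sub>p p" "v' \<in> T\<^sub>p p" "\<And>w. w \<in> T\<^sub>p p \<Longrightarrow> g p v w = g p v' w"
  shows "v = v'"
proof -
  let ?d = "\<lambda>f. v f + (\<lambda>f. - 1 * v' f) f"
  have m: "(\<lambda>f. - 1 * v' f) \<in> T\<^sub>p p" by (rule tangent_space_scale[OF assms(2)])
  have "?d = (\<lambda>f. 0)"
  proof (rule nondeg_0)
    show "?d \<in> T\<^sub>p p" by (rule tangent_space_add[OF assms(1) m])
    show "\<forall>w\<in>T\<^sub>p p. g p ?d w = 0"
      using g_add_left[OF assms(1) m] g_scale_left[OF assms(2), of _ "- 1"] assms(3) by simp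
  qed
  then show ?thesis by (auto simp: fun_eq_iff)
qed

lemma regular_points_UNIV: "regular_points A g = UNIV"
  using metric_rank_nondegenerate[OF nondeg_0] unfolding regular_points_def by auto

text \<open>\<open>E'\<close> is the metric dual of a coordinate frame \<open>E\<close>: its i-th
  member is the combination of the \<open>E k\<close> with coefficients from row i of the inverse
  Gram matrix. The coordinates of v become pairings g(v, E'_i), so components can be read off from
  the metric.\<close>

lemma dual_frame:
  obtains N :: "'m set" and E E' :: "nat \<Rightarrow> 'm vfield"
  where "open N" "p \<in> N" "\<forall>i. E i \<in> VF" "\<forall>i. E' i \<in> VF"
    "\<forall>q\<in>N. \<forall>v\<in>T\<^sub>p q. v = (\<lambda>f. \<Sum>i<DIM('e). g q v (E' i q) * E i q f)"
proof -
  obtain N u and E0 :: "'e \<Rightarrow> 'm vfield" where N: "open N" "p \<in> N" and uE: "\<forall>i. u i \<in> SF" "\<forall>i. E0 i \<in> VF"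
    and d: "\<forall>q\<in>N. \<forall>i\<in>Basis. \<forall>j\<in>Basis. E0 i q (u j) = (if i = j then 1 else 0)"
    and r: "\<forall>q\<in>N. \<forall>v\<in>T\<^sub>p q. v = (\<lambda>f. \<Sum>i\<in>Basis. v (u i) * E0 i q f)"
    by (rule local_frame)
  \<comment> \<open>Matrices are indexed by natural numbers, so the basis is enumerated and the
    frame reindexed along the enumeration.\<close>
  obtain bs where bs: "set bs = (Basis::'e set)" "distinct bs" using finite_distinct_list[OF finite_Basis] by blast
  define n where "n = DIM('e)"
  have ln: "length bs = n" using distinct_card[OF bs(2)] bs(1) by (simp add: n_def)
  have bij: "bij_betw (\<lambda>i. bs ! i) {..<n} Basis"
    using bij_betw_nth[OF bs(2)] bs(1) ln by blast
  have bB: "bs ! i \<in> Basis" if "i < n" for i using that ln bs(1) nth_mem[of i bs] by simp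
  have bij_eq: "bs ! i = bs ! j \<longleftrightarrow> i = j" if "i < n" "j < n" for i j
    using that ln nth_eq_iff_index_eq[OF bs(2)] by simp
  define E where "E = (\<lambda>i. E0 (bs ! i))"
  define w where "w = (\<lambda>i. u (bs ! i))"
  have EV: "E i \<in> VF" for i using uE by (simp add: E_def)
  have ET: "E i q \<in> T\<^sub>p q" for i q by (rule VF_tangent[OF EV])
  have dw: "E i q (w j) = (if i = j then 1 else 0)" if "q \<in> N" "i < n" "j < n" for i j q
    using d that bB bij_eq by (simp add: E_def w_def)
  have rep: "v = (\<lambda>f. \<Sum>i<n. v (w i) * E i q f)" if "q \<in> N" "v \<in> T\<^sub>p q" for q v
  proof -
    have "v = (\<lambda>f. \<Sum>i\<in>Basis. v (u i) * E0 i q f)" using r that by blast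
    then show ?thesis unfolding E_def w_def
      by (subst sum.reindex_bij_betw[OF bij, of "\<lambda>i. v (u i) * E0 i q f" for f])
  qed
  define G where "G = (\<lambda>q. Matrix.mat n n (\<lambda>(i, j). metric_apply g (E i) (E j) q))"
  have Gc: "G q \<in> carrier_mat n n" for q by (simp add: G_def)
  have Gij: "G q $$ (i, j) = metric_apply g (E i) (E j) q" if "i < n" "j < n" for i j q
    using that by (simp add: G_def)
  have Gs: "(\<lambda>q. G q $$ (i, j)) \<in> SF" if "i < n" "j < n" for i j
    using metric_apply_SF[OF EV EV] by (simp add: Gij that)
  \<comment> \<open>A kernel vector of the Gram matrix combines the frame into a tangent vector
    orthogonal to every frame member. Non-degeneracy makes that vector zero, and evaluation on the
    coordinates \<open>w k\<close> makes its coefficients zero.\<close>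
  have det0: "Determinant.det (G q) \<noteq> 0" if q: "q \<in> N" for q
  proof
    assume "Determinant.det (G q) = 0"
    then obtain v where v: "v \<in> carrier_vec n" "v \<noteq> 0\<^sub>v n" "G q *\<^sub>v v = 0\<^sub>v n"
      using det_0_iff_vec_prod_zero[OF Gc] by blast
    let ?z = "\<lambda>f. \<Sum>j<n. (\<lambda>f. v $ j * E j q f) f"
    have z: "?z \<in> T\<^sub>p q" by (intro tangent_space_sum tangent_space_scale ET)
    have zE: "g q (E i q) ?z = 0" if "i < n" for i
    proof -
      have "g q (E i q) ?z = (\<Sum>j<n. v $ j * g q (E i q) (E j q))"
        by (subst g_sum_right) (simp_all add: g_scale_right ET tangent_space_scale)
      also have "\<dots> = (G q *\<^sub>v v) $ i"
        using that v(1) by (simp add: G_def mult_mat_vec_def scalar_prod_def metric_apply_def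
            atLeast0LessThan mult.commute)
      finally show ?thesis using v(3) that by simp
    qed
    have "?z = (\<lambda>f. 0)"
    proof (rule nondeg_0[OF z], rule ballI)
      fix x assume x: "x \<in> T\<^sub>p q"
      have "g q ?z x = g q x ?z" by (rule g_sym[OF z x])
      also have "\<dots> = g q (\<lambda>f. \<Sum>i<n. (\<lambda>f. x (w i) * E i q f) f) ?z" using rep[OF q x] by simp
      also have "\<dots> = (\<Sum>i<n. x (w i) * g q (E i q) ?z)"
        by (subst g_sum_left[OF _ z]) (simp_all add: g_scale_left[OF ET z] ET tangent_space_scale)
      finally show "g q ?z x = 0" using zE by simp
    qed
    then have "(\<Sum>j<n. v $ j * E j q (w k)) = 0" for k by (rule fun_cong)
    moreover have "(\<Sum>j<n. v $ j * E j q (w k)) = v $ k" if "k < n" for k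
    proof -
      have "(\<Sum>j<n. v $ j * E j q (w k)) = (\<Sum>j<n. if j = k then v $ j else 0)"
        by (rule sum.cong) (use dw[OF q] that in auto)
      then show ?thesis using that by simp
    qed
    ultimately have "v = 0\<^sub>v n" using v(1) by (intro eq_vecI) auto
    then show False using v(2) by simp
  qed
  obtain \<beta> N' where "\<beta> \<in> SF" and b: "open N'" "p \<in> N'" "N' \<subseteq> N" "\<forall>q\<in>N'. \<beta> q = 1"
    "\<forall>f. smooth_fun_on A N f \<longrightarrow> (\<lambda>q. if q \<in> N then \<beta> q * f q else 0) \<in> SF"
    "\<forall>q. q \<notin> N \<longrightarrow> \<beta> q = 0"
    by (rule bump_exists[OF N])
  \<comment> \<open>The determinant is known to be nonzero on N only, so the inverse matrix is cut
    off by a bump before it multiplies global fields.\<close>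
  define H where "H = (\<lambda>i k q. if q \<in> N then \<beta> q * (adj_mat (G q) $$ (i, k) * inverse (Determinant.det (G q))) else 0)"
  have Hs: "H i k \<in> SF" if "i < n" "k < n" for i k
    unfolding H_def
    by (intro b(5)[rule_format] smooth_fun_on_mult smooth_fun_on_inverse SF_smooth_on SF_det[OF Gc Gs]
        SF_adj_mat[OF Gc Gs] that det0 N)
  \<comment> \<open>The default 0 for indices from n on makes \<open>E' i\<close> a vector field for
    every natural number i.\<close>
  define E' where "E' = (\<lambda>i q f. if i < n then \<Sum>k<n. fscale (H i k) (E k) q f else 0)"
  have E'V: "E' i \<in> VF" for i
  proof (cases "i < n")
    case True
    have "(\<lambda>q f. \<Sum>k<n. fscale (H i k) (E k) q f) \<in> VF"
      by (intro VF_sum VF_fscale Hs EV) (use True in auto)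
    then show ?thesis using True by (simp add: E'_def)
  next
    case False
    then show ?thesis using VF_0 by (simp add: E'_def)
  qed
  have dual: "g q (E j q) (E' i q) = (if i = j then 1 else 0)" if q: "q \<in> N'" and ij: "i < n" "j < n" for i j q
  proof -
    have qN: "q \<in> N" "\<beta> q = 1" using q b by auto
    have "g q (E j q) (E' i q) = g q (E j q) (\<lambda>f. \<Sum>k<n. (\<lambda>f. H i k q * E k q f) f)"
      using ij by (simp add: E'_def fscale_def)
    also have "\<dots> = (\<Sum>k<n. H i k q * g q (E k q) (E j q))"
      by (subst g_sum_right) (simp_all add: g_scale_right ET tangent_space_scale g_sym[where v = "E j q", OF ET ET])
    also have "\<dots> = (\<Sum>k<n. adj_mat (G q) $$ (i, k) * G q $$ (k, j)) * inverse (Determinant.det (G q))"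
      using ij qN by (simp add: H_def Gij metric_apply_def sum_distrib_left mult_ac)
    also have "(\<Sum>k<n. adj_mat (G q) $$ (i, k) * G q $$ (k, j)) = (adj_mat (G q) * G q) $$ (i, j)"
      using ij adj_mat(1)[OF Gc, of q] Gc[of q]
      by (simp add: scalar_prod_def atLeast0LessThan)
    also have "\<dots> = (if i = j then Determinant.det (G q) else 0)"
      using ij by (simp add: adj_mat(3)[OF Gc])
    finally show ?thesis using det0[OF qN(1)] by simp
  qed
  show thesis
  proof (rule that[OF b(1,2)]; intro allI ballI)
    show "E i \<in> VF" for i by (rule EV)
    show "E' i \<in> VF" for i by (rule E'V)
    fix q v assume q: "q \<in> N'" and v: "v \<in> T\<^sub>p q"
    have r: "v = (\<lambda>f. \<Sum>i<n. v (w i) * E i q f)" using rep v q b(3) by blast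
    have "g q v (E' i q) = v (w i)" if "i < n" for i
    proof -
      have "g q v (E' i q) = g q (\<lambda>f. \<Sum>j<n. (\<lambda>f. v (w j) * E j q f) f) (E' i q)" using r by simp
      also have "\<dots> = (\<Sum>j<n. v (w j) * g q (E j q) (E' i q))"
        by (subst g_sum_left) (simp_all add: g_scale_left ET VF_tangent E'V tangent_space_scale)
      also have "\<dots> = (\<Sum>j<n. if j = i then v (w j) else 0)"
        by (rule sum.cong) (use dual q that in auto)
      finally show ?thesis using that by simp
    qed
    then have "(\<Sum>i<DIM('e). g q v (E' i q) * E i q f) = (\<Sum>i<n. v (w i) * E i q f)" for f
      unfolding n_def[symmetric] by (intro sum.cong) auto
    then show "v = (\<lambda>f. \<Sum>i<DIM('e). g q v (E' i q) * E i q f)" using r by simp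
  qed
qed

text \<open>Expresses an inner product through pairings with fixed smooth fields. For sections along
  a map these pairings are the only data known to be smooth.\<close>

lemma dual_expansion:
  obtains N :: "'m set" and E E' :: "nat \<Rightarrow> 'm vfield"
  where "open N" "p \<in> N" "\<forall>i. E i \<in> VF" "\<forall>i. E' i \<in> VF"
    "\<forall>q\<in>N. \<forall>v\<in>T\<^sub>p q. \<forall>w\<in>T\<^sub>p q. g q v w = (\<Sum>i<DIM('e). g q v (E i q) * g q w (E' i q))"
proof -
  obtain N and E E' :: "nat \<Rightarrow> 'm vfield" where N: "open N" "p \<in> N" and E: "\<forall>i. E i \<in> VF" "\<forall>i. E' i \<in> VF"
    and r: "\<forall>q\<in>N. \<forall>v\<in>T\<^sub>p q. v = (\<lambda>f. \<Sum>i<DIM('e). g q v (E' i q) * E i q f)"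
    by (rule dual_frame)
  show thesis
  proof (rule that[OF N E], intro ballI)
    fix q v w assume q: "q \<in> N" and v: "v \<in> T\<^sub>p q" and w: "w \<in> T\<^sub>p q"
    have ET: "E i q \<in> T\<^sub>p q" for i using E VF_tangent by blast
    have "w = (\<lambda>f. \<Sum>i<DIM('e). (\<lambda>f. g q w (E' i q) * E i q f) f)" using r q w by blast
    then have "g q v w = g q v (\<lambda>f. \<Sum>i<DIM('e). (\<lambda>f. g q w (E' i q) * E i q f) f)" by simp
    also have "\<dots> = (\<Sum>i<DIM('e). g q w (E' i q) * g q v (E i q))"
      by (subst g_sum_right) (simp_all add: g_scale_right ET v tangent_space_scale)
    finally show "g q v w = (\<Sum>i<DIM('e). g q v (E i q) * g q w (E' i q))" by (simp add: mult.commute)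
  qed
qed

lemma sharp_eq:
  assumes "covector p \<alpha>"
  shows "sharp A g p \<alpha> \<in> T\<^sub>p p" "\<And>w. w \<in> T\<^sub>p p \<Longrightarrow> g p (sharp A g p \<alpha>) w = \<alpha> w"
proof -
  obtain N and E E' :: "nat \<Rightarrow> 'm vfield" where N: "open N" "p \<in> N" and E: "\<forall>i. E i \<in> VF" "\<forall>i. E' i \<in> VF"
    and r: "\<forall>q\<in>N. \<forall>v\<in>T\<^sub>p q. v = (\<lambda>f. \<Sum>i<DIM('e). g q v (E' i q) * E i q f)"
    by (rule dual_frame)
  have T: "E i p \<in> T\<^sub>p p" "E' i p \<in> T\<^sub>p p" for i using E VF_tangent by blast+
  \<comment> \<open>The raised index in a dual frame: pairing with w gives the sum of \<alpha>(E_i)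
    g(w, E'_i), which is \<alpha> of the frame expansion of w.\<close>
  let ?v = "\<lambda>f. \<Sum>i<DIM('e). (\<lambda>f. \<alpha> (E i p) * E' i p f) f"
  have v: "?v \<in> T\<^sub>p p" by (intro tangent_space_sum tangent_space_scale T)
  have e: "g p ?v w = \<alpha> w" if w: "w \<in> T\<^sub>p p" for w
  proof -
    have "w = (\<lambda>f. \<Sum>i<DIM('e). g p w (E' i p) * E i p f)" using r N(2) w by blast
    then have "\<alpha> w = \<alpha> (\<lambda>f. \<Sum>i<DIM('e). g p w (E' i p) * E i p f)" by simp
    also have "\<dots> = (\<Sum>i<DIM('e). g p w (E' i p) * \<alpha> (E i p))"
      by (rule covector_sum[OF assms]) (rule T)
    also have "\<dots> = (\<Sum>i<DIM('e). \<alpha> (E i p) * g p (E' i p) w)"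
      using g_sym[OF w T(2)] by (simp add: mult.commute)
    also have "\<dots> = g p ?v w"
      by (subst g_sum_left) (simp_all add: g_scale_left T w tangent_space_scale)
    finally show ?thesis by simp
  qed
  have "sharp A g p \<alpha> = ?v"
    unfolding sharp_def
  proof (rule the_equality)
    show "?v \<in> T\<^sub>p p \<and> (\<forall>w\<in>T\<^sub>p p. g p ?v w = \<alpha> w)" using v e by blast
    fix x assume "x \<in> T\<^sub>p p \<and> (\<forall>w\<in>T\<^sub>p p. g p x w = \<alpha> w)"
    then show "x = ?v" using e v by (intro nondeg_eq) auto
  qed
  then show "sharp A g p \<alpha> \<in> T\<^sub>p p" "\<And>w. w \<in> T\<^sub>p p \<Longrightarrow> g p (sharp A g p \<alpha>) w = \<alpha> w"
    using v e by simp_all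
qed

lemma contraction_nondegenerate:
  assumes "tensorial A \<omega>" "tensorial A \<tau>" "\<And>p. c p \<in> T\<^sub>p p" "\<And>p. d p \<in> T\<^sub>p p"
    "\<And>X p. X \<in> VF \<Longrightarrow> \<omega> X p = g p (c p) (X p)" "\<And>X p. X \<in> VF \<Longrightarrow> \<tau> X p = g p (d p) (X p)"
    "(\<lambda>p. g p (c p) (d p)) \<in> SF"
  shows "contraction A g \<omega> \<tau> = (\<lambda>p. g p (c p) (d p))"
proof (rule contraction_eqI[OF _ assms(7)])
  show "\<exists>p\<in>S. p \<in> regular_points A g" if "open S" "S \<noteq> {}" for S
    using that by (auto simp: regular_points_UNIV)
  show "\<exists>v\<in>T\<^sub>p p. \<exists>w\<in>T\<^sub>p p. form_at A \<omega> p = flat A g p v \<and> form_at A \<tau> p = flat A g p w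
      \<and> g p (c p) (d p) = g p v w" for p
    using form_at_eq_flat[OF assms(1,5)] form_at_eq_flat[OF assms(2,6)] assms(3,4) by blast
qed

text \<open>The Levi-Civita derivative, obtained from the Koszul form by raising the index, which is
  possible on the factors because their metrics are non-degenerate.\<close>

definition nabla :: "'m vfield \<Rightarrow> 'm vfield \<Rightarrow> 'm vfield" where
  "nabla X Y p = sharp A g p (form_at A (koszul g X Y) p)"

lemma nabla:
  assumes "X \<in> VF" "Y \<in> VF"
  shows "nabla X Y p \<in> T\<^sub>p p" "Z \<in> VF \<Longrightarrow> g p (nabla X Y p) (Z p) = koszul g X Y Z p"
  using sharp_eq[OF covector_form_at[OF tensorial_koszul[OF assms]]]
    form_at_eq[OF tensorial_koszul[OF assms]] VF_tangent
  by (simp_all add: nabla_def)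

end

text \<open>Since the metric is non-degenerate, smoothness of a section along \<open>\<pi>\<close> can be tested by pairing it
  with the vector fields of the target.\<close>

locale metric_along = nondegenerate_metric A g + M: manifold A'
  for A :: "('m::{t2_space,second_countable_topology}, 'e::euclidean_space) atlas"
    and g :: "'m metric_tensor"
    and A' :: "('p::{t2_space,second_countable_topology}, 'h::euclidean_space) atlas" +
  fixes \<pi> :: "'p \<Rightarrow> 'm"
  assumes pullback_smooth: "f \<in> SF \<Longrightarrow> (\<lambda>p. f (\<pi> p)) \<in> smooth_functions A'"
    and continuous: "continuous_on UNIV \<pi>"
begin

definition smooth_section :: "('p \<Rightarrow> 'm tvec) \<Rightarrow> bool" where
  "smooth_section c \<longleftrightarrow> (\<forall>p. c p \<in> T\<^sub>p (\<pi> p)) \<and> (\<forall>X\<in>VF. (\<lambda>p. g (\<pi> p) (c p) (X (\<pi> p))) \<in> M.SF)"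

lemma section_tangent: "smooth_section c \<Longrightarrow> c p \<in> T\<^sub>p (\<pi> p)"
  unfolding smooth_section_def by blast

lemma section_smooth: "smooth_section c \<Longrightarrow> X \<in> VF \<Longrightarrow> (\<lambda>p. g (\<pi> p) (c p) (X (\<pi> p))) \<in> M.SF"
  unfolding smooth_section_def by blast

lemma section_inner:
  assumes c: "smooth_section c" and c': "smooth_section c'"
  shows "(\<lambda>p. g (\<pi> p) (c p) (c' p)) \<in> M.SF"
proof (rule M.SF_local)
  fix p
  obtain N and E E' :: "nat \<Rightarrow> 'm vfield" where N: "open N" "\<pi> p \<in> N"
    and E: "\<forall>i. E i \<in> VF" "\<forall>i. E' i \<in> VF"
    and r: "\<forall>q\<in>N. \<forall>v\<in>T\<^sub>p q. \<forall>w\<in>T\<^sub>p q. g q v w = (\<Sum>i<DIM('e). g q v (E i q) * g q w (E' i q))"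
    by (rule dual_expansion)
  let ?h = "\<lambda>q. \<Sum>i<DIM('e). g (\<pi> q) (c q) (E i (\<pi> q)) * g (\<pi> q) (c' q) (E' i (\<pi> q))"
  have "?h \<in> M.SF"
    using section_smooth[OF c] section_smooth[OF c'] E by (intro M.SF_sum M.SF_mult) blast+
  moreover have "g (\<pi> q) (c q) (c' q) = ?h q" if "q \<in> \<pi> -` N" for q
    using r that section_tangent[OF c, of q] section_tangent[OF c', of q] by simp
  moreover have "open (\<pi> -` N)" by (rule open_vimage[OF N(1) continuous])
  ultimately show "\<exists>N h. open N \<and> p \<in> N \<and> h \<in> M.SF \<and> (\<forall>q\<in>N. g (\<pi> q) (c q) (c' q) = h q)"
    using N by (intro exI[of _ "\<pi> -` N"] exI[of _ ?h]) simp
qed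

lemma section_add:
  assumes "smooth_section c" "smooth_section c'" shows "smooth_section (\<lambda>p f. c p f + c' p f)"
  unfolding smooth_section_def
proof (intro conjI allI ballI)
  note T = section_tangent[OF assms(1)] section_tangent[OF assms(2)]
  show "(\<lambda>f. c p f + c' p f) \<in> T\<^sub>p (\<pi> p)" for p by (rule tangent_space_add[OF T])
  show "(\<lambda>p. g (\<pi> p) (\<lambda>f. c p f + c' p f) (X (\<pi> p))) \<in> M.SF" if X: "X \<in> VF" for X
    unfolding g_add_left[OF T VF_tangent[OF X]] by (intro M.SF_add section_smooth assms X)
qed

lemma section_scale:
  assumes "h \<in> M.SF" "smooth_section c" shows "smooth_section (\<lambda>p f. h p * c p f)"
  unfolding smooth_section_def
proof (intro conjI allI ballI)
  note T = section_tangent[OF assms(2)]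
  show "(\<lambda>f. h p * c p f) \<in> T\<^sub>p (\<pi> p)" for p by (rule tangent_space_scale[OF T])
  show "(\<lambda>p. g (\<pi> p) (\<lambda>f. h p * c p f) (X (\<pi> p))) \<in> M.SF" if X: "X \<in> VF" for X
    unfolding g_scale_left[OF T VF_tangent[OF X]] by (intro M.SF_mult section_smooth assms X)
qed

lemma section_0: "smooth_section (\<lambda>p f. 0)"
  by (simp add: smooth_section_def tangent_space_0 g_0_left[OF VF_tangent])

lemma section_VF: assumes "X \<in> VF" shows "smooth_section (\<lambda>p. X (\<pi> p))"
  using pullback_smooth[OF metric_apply_SF[OF assms]] VF_tangent[OF assms]
  by (simp add: smooth_section_def metric_apply_def)

lemma section_nabla: assumes "X \<in> VF" "Y \<in> VF" shows "smooth_section (\<lambda>p. nabla X Y (\<pi> p))"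
  using pullback_smooth[OF koszul_SF[OF assms]] nabla[OF assms] by (simp add: smooth_section_def)

text \<open>In a frame of the target the coefficients of the pushed-forward vector are W applied to
  the pulled-back coordinates, hence smooth. This makes the twisted metric smooth on arbitrary
  vector fields of the product, not only on lifts.\<close>

lemma section_push: assumes W: "W \<in> M.VF" shows "smooth_section (\<lambda>p. pushforward A \<pi> (W p))"
  unfolding smooth_section_def
proof (intro conjI allI ballI)
  show T: "pushforward A \<pi> (W p) \<in> T\<^sub>p (\<pi> p)" for p
    by (rule pushforward_tangent[OF M.manifold_axioms pullback_smooth M.VF_tangent[OF W]])
  fix X assume X: "X \<in> VF"
  show "(\<lambda>p. g (\<pi> p) (pushforward A \<pi> (W p)) (X (\<pi> p))) \<in> M.SF"
  proof (rule M.SF_local)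
    fix p
    obtain N u and E :: "'e \<Rightarrow> 'm vfield" where N: "open N" "\<pi> p \<in> N" and uE: "\<forall>i. u i \<in> SF" "\<forall>i. E i \<in> VF"
      and "\<forall>q\<in>N. \<forall>i\<in>Basis. \<forall>j\<in>Basis. E i q (u j) = (if i = j then 1 else 0)"
      and r: "\<forall>q\<in>N. \<forall>v\<in>T\<^sub>p q. v = (\<lambda>f. \<Sum>i\<in>Basis. v (u i) * E i q f)"
      by (rule local_frame)
    have ET: "E i q \<in> T\<^sub>p q" for i q using uE(2) VF_tangent by blast
    let ?w = "\<lambda>q. pushforward A \<pi> (W q)"
    let ?h = "\<lambda>q. \<Sum>i\<in>(Basis::'e set). vf_apply W (\<lambda>p. u i (\<pi> p)) q * metric_apply g (E i) X (\<pi> q)"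
    have "?h \<in> M.SF"
      by (intro M.SF_sum M.SF_mult M.VF_smooth[OF W] pullback_smooth metric_apply_SF X) (use uE in auto)
    moreover have "g (\<pi> q) (?w q) (X (\<pi> q)) = ?h q" if q: "q \<in> \<pi> -` N" for q
    proof -
      have "?w q = (\<lambda>f. \<Sum>i\<in>Basis. (\<lambda>f. ?w q (u i) * E i (\<pi> q) f) f)" using r q T[of q] by auto
      then have "g (\<pi> q) (?w q) (X (\<pi> q)) = g (\<pi> q) (\<lambda>f. \<Sum>i\<in>Basis. (\<lambda>f. ?w q (u i) * E i (\<pi> q) f) f) (X (\<pi> q))"
        by (rule arg_cong)
      also have "\<dots> = (\<Sum>i\<in>Basis. ?w q (u i) * g (\<pi> q) (E i (\<pi> q)) (X (\<pi> q)))"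
        by (subst g_sum_left)
          (simp_all add: g_scale_left[OF ET VF_tangent[OF X]] ET VF_tangent[OF X] tangent_space_scale)
      also have "\<dots> = ?h q" using uE(1) by (simp add: pushforward_def comp_def vf_apply_def metric_apply_def)
      finally show ?thesis .
    qed
    moreover have "open (\<pi> -` N)" by (rule open_vimage[OF N(1) continuous])
    ultimately show "\<exists>N h. open N \<and> p \<in> N \<and> h \<in> M.SF \<and> (\<forall>q\<in>N. g (\<pi> q) (?w q) (X (\<pi> q)) = h q)"
      using N by (intro exI[of _ "\<pi> -` N"] exI[of _ ?h]) simp
  qed
qed

end

section \<open>Product manifolds\<close>

locale product_manifold = B: manifold A\<^sub>B + F: manifold A\<^sub>F
  for A\<^sub>B :: "('b::{t2_space,second_countable_topology}, 'e::euclidean_space) atlas"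
    and A\<^sub>F :: "('f::{t2_space,second_countable_topology}, 'd::euclidean_space) atlas"
begin

abbreviation "M \<equiv> prod_atlas A\<^sub>B A\<^sub>F"

lemma prod_chart: "(U, \<phi>) \<in> A\<^sub>B \<Longrightarrow> (V, \<psi>) \<in> A\<^sub>F \<Longrightarrow> (U \<times> V, map_prod \<phi> \<psi>) \<in> M"
  unfolding prod_atlas_def by auto

lemma prod_chartE:
  assumes "(S, \<Phi>) \<in> M"
  obtains U \<phi> V \<psi> where "S = U \<times> V" "\<Phi> = map_prod \<phi> \<psi>" "(U, \<phi>) \<in> A\<^sub>B" "(V, \<psi>) \<in> A\<^sub>F"
  using assms unfolding prod_atlas_def by auto

lemma inv_into_map_prod:
  assumes "(U, \<phi>) \<in> A\<^sub>B" "(V, \<psi>) \<in> A\<^sub>F" "u \<in> \<phi> ` U" "v \<in> \<psi> ` V"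
  shows "inv_into (U \<times> V) (map_prod \<phi> \<psi>) (u, v) = (inv_into U \<phi> u, inv_into V \<psi> v)"
proof (rule inv_into_f_eq)
  show "inj_on (map_prod \<phi> \<psi>) (U \<times> V)"
    using map_prod_inj_on[OF B.chart(4)[OF assms(1)] F.chart(4)[OF assms(2)]] .
qed (use assms in \<open>auto intro: inv_into_into f_inv_into_f\<close>)

lemma map_prod_image: "map_prod \<phi> \<psi> ` (U \<times> V) = \<phi> ` U \<times> \<psi> ` V"
  by (auto simp: map_prod_def image_iff)

lemma prod_smooth_manifold: "smooth_manifold M"
  unfolding smooth_manifold_def
proof (intro conjI)
  show "(\<Union>(U, \<phi>)\<in>M. U) = UNIV"
  proof (rule UNIV_eq_I[symmetric])
    fix p :: "'b \<times> 'f"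
    obtain U \<phi> where c: "(U, \<phi>) \<in> A\<^sub>B" "fst p \<in> U" by (rule B.chart_exists)
    obtain V \<psi> where d: "(V, \<psi>) \<in> A\<^sub>F" "snd p \<in> V" by (rule F.chart_exists)
    have "p \<in> U \<times> V" using c d by (simp add: mem_Times_iff)
    then show "p \<in> (\<Union>(U, \<phi>)\<in>M. U)" using prod_chart[OF c(1) d(1)] by (intro UN_I) auto
  qed
  show "\<forall>(S, \<Phi>)\<in>M. open S \<and> open (\<Phi> ` S) \<and> homeomorphism S (\<Phi> ` S) \<Phi> (inv_into S \<Phi>)"
  proof (clarify)
    fix S \<Phi> assume "(S, \<Phi>) \<in> M"
    then obtain U \<phi> V \<psi> where e: "S = U \<times> V" "\<Phi> = map_prod \<phi> \<psi>" "(U, \<phi>) \<in> A\<^sub>B" "(V, \<psi>) \<in> A\<^sub>F"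
      by (rule prod_chartE)
    note b = B.chart[OF e(3)] and f = F.chart[OF e(4)]
    have inv: "inv_into S \<Phi> z = (inv_into U \<phi> (fst z), inv_into V \<psi> (snd z))" if "z \<in> \<phi> ` U \<times> \<psi> ` V" for z
      using inv_into_map_prod[OF e(3,4), of "fst z" "snd z"] that by (auto simp: e)
    have im: "\<Phi> ` S = \<phi> ` U \<times> \<psi> ` V" by (simp add: e map_prod_image)
    have \<Phi>: "\<Phi> = (\<lambda>p. (\<phi> (fst p), \<psi> (snd p)))" by (auto simp: e map_prod_def fun_eq_iff)
    have "homeomorphism S (\<Phi> ` S) \<Phi> (inv_into S \<Phi>)"
      unfolding homeomorphism_def
    proof (intro conjI ballI)
      show "continuous_on S \<Phi>"
        unfolding \<Phi> e(1)
        by (intro continuous_on_Pair continuous_on_compose2[OF b(5)] continuous_on_compose2[OF f(5)]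
            continuous_on_fst continuous_on_snd continuous_on_id) auto
      have "continuous_on (\<phi> ` U \<times> \<psi> ` V) (\<lambda>z. (inv_into U \<phi> (fst z), inv_into V \<psi> (snd z)))"
        by (intro continuous_on_Pair continuous_on_compose2[OF b(6)] continuous_on_compose2[OF f(6)]
            continuous_on_fst continuous_on_snd continuous_on_id) auto
      then show "continuous_on (\<Phi> ` S) (inv_into S \<Phi>)"
        unfolding im by (rule continuous_on_eq) (simp add: inv)
      show 1: "inv_into S \<Phi> (\<Phi> p) = p" if "p \<in> S" for p
        using inv[of "\<Phi> p"] that B.chart_inv[OF e(3)] F.chart_inv[OF e(4)] by (auto simp: \<Phi> e(1))
      show "inv_into S \<Phi> ` (\<Phi> ` S) = S" using 1 by (auto simp: image_image)
      show "\<Phi> (inv_into S \<Phi> z) = z" if "z \<in> \<Phi> ` S" for z using that by (rule f_inv_into_f)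
    qed simp
    then show "open S \<and> open (\<Phi> ` S) \<and> homeomorphism S (\<Phi> ` S) \<Phi> (inv_into S \<Phi>)"
      using b f by (simp add: im) (simp add: e open_Times)
  qed
  show "\<forall>(S, \<Phi>)\<in>M. \<forall>(S', \<Phi>')\<in>M. smooth_on (\<Phi> ` (S \<inter> S')) (\<Phi>' \<circ> inv_into S \<Phi>)"
  proof (clarify)
    fix S \<Phi> S' \<Phi>' assume 1: "(S, \<Phi>) \<in> M" and 2: "(S', \<Phi>') \<in> M"
    obtain U \<phi> V \<psi> where e: "S = U \<times> V" "\<Phi> = map_prod \<phi> \<psi>" "(U, \<phi>) \<in> A\<^sub>B" "(V, \<psi>) \<in> A\<^sub>F"
      using 1 by (rule prod_chartE)
    obtain U' \<phi>' V' \<psi>' where e': "S' = U' \<times> V'" "\<Phi>' = map_prod \<phi>' \<psi>'" "(U', \<phi>') \<in> A\<^sub>B" "(V', \<psi>') \<in> A\<^sub>F"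
      using 2 by (rule prod_chartE)
    let ?P = "\<phi> ` (U \<inter> U')" and ?Q = "\<psi> ` (V \<inter> V')"
    have o: "open ?P" "open ?Q"
      using B.open_chart_image[OF e(3)] F.open_chart_image[OF e(4)] B.chart(1)[OF e'(3)] F.chart(1)[OF e'(4)]
      by blast+
    have oPQ: "open (?P \<times> ?Q)" using o by (rule open_Times)
    have im: "\<Phi> ` (S \<inter> S') = ?P \<times> ?Q"
      by (simp add: e e'(1) Times_Int_Times map_prod_image)
    have "smooth_on (?P \<times> ?Q) (\<lambda>z. (\<phi>' (inv_into U \<phi> (fst z)), \<psi>' (inv_into V \<psi> (snd z))))"
    proof (rule smooth_on_Pair[OF oPQ])
      show "smooth_on (?P \<times> ?Q) (\<lambda>z. \<phi>' (inv_into U \<phi> (fst z)))"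
        by (rule smooth_on_compose[OF oPQ o(1) smooth_on_bounded_linear[OF oPQ bounded_linear_fst] _
              B.chart_transition[OF e(3) e'(3), unfolded comp_def]]) auto
      show "smooth_on (?P \<times> ?Q) (\<lambda>z. \<psi>' (inv_into V \<psi> (snd z)))"
        by (rule smooth_on_compose[OF oPQ o(2) smooth_on_bounded_linear[OF oPQ bounded_linear_snd] _
              F.chart_transition[OF e(4) e'(4), unfolded comp_def]]) auto
    qed
    moreover have "(\<phi>' (inv_into U \<phi> (fst z)), \<psi>' (inv_into V \<psi> (snd z))) = (\<Phi>' \<circ> inv_into S \<Phi>) z"
      if "z \<in> ?P \<times> ?Q" for z
      using inv_into_map_prod[OF e(3,4), of "fst z" "snd z"] that by (auto simp: e(1,2) e'(2))
    ultimately show "smooth_on (\<Phi> ` (S \<inter> S')) (\<Phi>' \<circ> inv_into S \<Phi>)"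
      unfolding im by (rule smooth_on_transform[OF oPQ])
  qed
qed

end

sublocale product_manifold \<subseteq> M: manifold "prod_atlas A\<^sub>B A\<^sub>F"
  by unfold_locales (rule prod_smooth_manifold)

context product_manifold
begin

section \<open>Smooth functions on the product and on its slices\<close>

lemma SF_prodI:
  assumes "\<And>U \<phi> V \<psi>. (U, \<phi>) \<in> A\<^sub>B \<Longrightarrow> (V, \<psi>) \<in> A\<^sub>F \<Longrightarrow> open (\<phi> ` U \<times> \<psi> ` V) \<Longrightarrow>
    smooth_on (\<phi> ` U \<times> \<psi> ` V) (\<lambda>z. f (inv_into U \<phi> (fst z), inv_into V \<psi> (snd z)))"
  shows "f \<in> M.SF"
proof -
  have "smooth_on (\<Phi> ` S) (f \<circ> inv_into S \<Phi>)" if ch: "(S, \<Phi>) \<in> M" for S \<Phi>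
  proof -
    obtain U \<phi> V \<psi> where e: "S = U \<times> V" "\<Phi> = map_prod \<phi> \<psi>" "(U, \<phi>) \<in> A\<^sub>B" "(V, \<psi>) \<in> A\<^sub>F"
      using ch by (rule prod_chartE)
    have o: "open (\<phi> ` U \<times> \<psi> ` V)" using B.chart(2)[OF e(3)] F.chart(2)[OF e(4)] by (rule open_Times)
    have "f (inv_into U \<phi> (fst z), inv_into V \<psi> (snd z)) = (f \<circ> inv_into S \<Phi>) z"
      if "z \<in> \<phi> ` U \<times> \<psi> ` V" for z
      using inv_into_map_prod[OF e(3,4), of "fst z" "snd z"] that by (auto simp: e(1,2))
    from smooth_on_transform[OF o assms[OF e(3,4) o] this] show ?thesis
      by (simp only: e(1,2) map_prod_image)
  qed
  then show ?thesis unfolding smooth_functions_def by auto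
qed

lemma SF_fst: assumes "f \<in> B.SF" shows "(\<lambda>p. f (fst p)) \<in> M.SF"
proof (rule SF_prodI)
  fix U \<phi> V \<psi> assume c: "(U, \<phi>) \<in> A\<^sub>B" and "(V, \<psi>) \<in> A\<^sub>F" and o: "open (\<phi> ` U \<times> \<psi> ` V)"
  have "smooth_on (\<phi> ` U) (f \<circ> inv_into U \<phi>)"
    using B.smooth_fun_onD[OF B.SF_smooth_on[OF assms, of UNIV] c] by simp
  from smooth_on_compose[OF o B.chart(2)[OF c] smooth_on_bounded_linear[OF o bounded_linear_fst] _ this]
  show "smooth_on (\<phi> ` U \<times> \<psi> ` V) (\<lambda>z. f (fst (inv_into U \<phi> (fst z), inv_into V \<psi> (snd z))))" by auto
qed

lemma SF_snd: assumes "f \<in> F.SF" shows "(\<lambda>p. f (snd p)) \<in> M.SF"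
proof (rule SF_prodI)
  fix U \<phi> V \<psi> assume "(U, \<phi>) \<in> A\<^sub>B" and d: "(V, \<psi>) \<in> A\<^sub>F" and o: "open (\<phi> ` U \<times> \<psi> ` V)"
  have "smooth_on (\<psi> ` V) (f \<circ> inv_into V \<psi>)"
    using F.smooth_fun_onD[OF F.SF_smooth_on[OF assms, of UNIV] d] by simp
  from smooth_on_compose[OF o F.chart(2)[OF d] smooth_on_bounded_linear[OF o bounded_linear_snd] _ this]
  show "smooth_on (\<phi> ` U \<times> \<psi> ` V) (\<lambda>z. f (snd (inv_into U \<phi> (fst z), inv_into V \<psi> (snd z))))" by auto
qed

lemma smooth_on_prod_chart:
  assumes "f \<in> M.SF" "(U, \<phi>) \<in> A\<^sub>B" "(V, \<psi>) \<in> A\<^sub>F"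
  shows "smooth_on (\<phi> ` U \<times> \<psi> ` V) (f \<circ> inv_into (U \<times> V) (map_prod \<phi> \<psi>))"
  using M.smooth_fun_onD[OF M.SF_smooth_on[OF assms(1), of UNIV] prod_chart[OF assms(2,3)]]
  by (simp add: map_prod_image)

lemma SF_slice_fst: assumes "f \<in> M.SF" shows "(\<lambda>x. f (x, y)) \<in> B.SF"
proof -
  obtain V \<psi> where d: "(V, \<psi>) \<in> A\<^sub>F" "y \<in> V" by (rule F.chart_exists)
  have "smooth_on (\<phi> ` U) ((\<lambda>x. f (x, y)) \<circ> inv_into U \<phi>)" if c: "(U, \<phi>) \<in> A\<^sub>B" for U \<phi>
  proof -
    note o = B.chart(2)[OF c]
    have i: "(\<lambda>u. (u, \<psi> y)) ` \<phi> ` U \<subseteq> \<phi> ` U \<times> \<psi> ` V" using d(2) by auto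
    have p: "smooth_on (\<phi> ` U) (\<lambda>u. (u, \<psi> y))"
      by (intro smooth_on_Pair smooth_on_bounded_linear smooth_on_const bounded_linear_ident o)
    have "smooth_on (\<phi> ` U) (\<lambda>u. (f \<circ> inv_into (U \<times> V) (map_prod \<phi> \<psi>)) (u, \<psi> y))"
      by (rule smooth_on_compose[OF o open_Times[OF o F.chart(2)[OF d(1)]] p i smooth_on_prod_chart[OF assms c d(1)]])
    moreover have "(f \<circ> inv_into (U \<times> V) (map_prod \<phi> \<psi>)) (u, \<psi> y) = ((\<lambda>x. f (x, y)) \<circ> inv_into U \<phi>) u"
      if "u \<in> \<phi> ` U" for u
      using inv_into_map_prod[OF c d(1) that, of "\<psi> y"] d(2) by (simp add: F.chart_inv[OF d])
    ultimately show ?thesis by (rule smooth_on_transform[OF o])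
  qed
  then show ?thesis unfolding smooth_functions_def by auto
qed

lemma SF_slice_snd: assumes "f \<in> M.SF" shows "(\<lambda>y. f (x, y)) \<in> F.SF"
proof -
  obtain U \<phi> where c: "(U, \<phi>) \<in> A\<^sub>B" "x \<in> U" by (rule B.chart_exists)
  have "smooth_on (\<psi> ` V) ((\<lambda>y. f (x, y)) \<circ> inv_into V \<psi>)" if d: "(V, \<psi>) \<in> A\<^sub>F" for V \<psi>
  proof -
    note o = F.chart(2)[OF d]
    have i: "(\<lambda>u. (\<phi> x, u)) ` \<psi> ` V \<subseteq> \<phi> ` U \<times> \<psi> ` V" using c(2) by auto
    have p: "smooth_on (\<psi> ` V) (\<lambda>u. (\<phi> x, u))"
      by (intro smooth_on_Pair smooth_on_bounded_linear smooth_on_const bounded_linear_ident o)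
    have "smooth_on (\<psi> ` V) (\<lambda>u. (f \<circ> inv_into (U \<times> V) (map_prod \<phi> \<psi>)) (\<phi> x, u))"
      by (rule smooth_on_compose[OF o open_Times[OF B.chart(2)[OF c(1)] o] p i smooth_on_prod_chart[OF assms c(1) d]])
    moreover have "(f \<circ> inv_into (U \<times> V) (map_prod \<phi> \<psi>)) (\<phi> x, u) = ((\<lambda>y. f (x, y)) \<circ> inv_into V \<psi>) u"
      if "u \<in> \<psi> ` V" for u
      using inv_into_map_prod[OF c(1) d _ that, of "\<phi> x"] c(2) by (simp add: B.chart_inv[OF c])
    ultimately show ?thesis by (rule smooth_on_transform[OF o])
  qed
  then show ?thesis unfolding smooth_functions_def by auto
qed

text \<open>The slice map is affine in product coordinates, with derivative v to (v, 0), so the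
  chain rule matches a coordinate field of B with the one of the product having index (i,
  0).\<close>

lemma frechet_derivative_slice_fst:
  assumes f: "f \<in> M.SF" and c: "(U, \<phi>) \<in> A\<^sub>B" "x \<in> U" and d: "(V, \<psi>) \<in> A\<^sub>F" "y \<in> V"
  shows "frechet_derivative ((\<lambda>x. f (x, y)) \<circ> inv_into U \<phi>) (at (\<phi> x)) i
    = frechet_derivative (f \<circ> inv_into (U \<times> V) (map_prod \<phi> \<psi>)) (at (\<phi> x, \<psi> y)) (i, 0)"
proof -
  let ?F = "f \<circ> inv_into (U \<times> V) (map_prod \<phi> \<psi>)"
  have "(?F has_derivative frechet_derivative ?F (at (\<phi> x, \<psi> y))) (at (\<phi> x, \<psi> y))"
    by (rule smooth_on_has_derivative[OF smooth_on_prod_chart[OF f c(1) d(1)]]) (use c d in auto)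
  moreover have "((\<lambda>u. (u, \<psi> y)) has_derivative (\<lambda>v. (v, 0))) (at (\<phi> x))"
    by (auto intro!: derivative_eq_intros)
  ultimately have "((\<lambda>u. ?F (u, \<psi> y)) has_derivative (\<lambda>v. frechet_derivative ?F (at (\<phi> x, \<psi> y)) (v, 0))) (at (\<phi> x))"
    using has_derivative_compose by blast
  then have "(((\<lambda>x. f (x, y)) \<circ> inv_into U \<phi>) has_derivative (\<lambda>v. frechet_derivative ?F (at (\<phi> x, \<psi> y)) (v, 0))) (at (\<phi> x))"
  proof (rule has_derivative_transform_within_open)
    show "?F (u, \<psi> y) = ((\<lambda>x. f (x, y)) \<circ> inv_into U \<phi>) u" if "u \<in> \<phi> ` U" for u
      using inv_into_map_prod[OF c(1) d(1) that, of "\<psi> y"] d(2) by (simp add: F.chart_inv[OF d])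
  qed (use B.chart(2)[OF c(1)] c(2) in auto)
  from frechet_derivative_at[OF this, symmetric] show ?thesis by simp
qed

lemma frechet_derivative_slice_snd:
  assumes f: "f \<in> M.SF" and c: "(U, \<phi>) \<in> A\<^sub>B" "x \<in> U" and d: "(V, \<psi>) \<in> A\<^sub>F" "y \<in> V"
  shows "frechet_derivative ((\<lambda>y. f (x, y)) \<circ> inv_into V \<psi>) (at (\<psi> y)) i
    = frechet_derivative (f \<circ> inv_into (U \<times> V) (map_prod \<phi> \<psi>)) (at (\<phi> x, \<psi> y)) (0, i)"
proof -
  let ?F = "f \<circ> inv_into (U \<times> V) (map_prod \<phi> \<psi>)"
  have "(?F has_derivative frechet_derivative ?F (at (\<phi> x, \<psi> y))) (at (\<phi> x, \<psi> y))"
    by (rule smooth_on_has_derivative[OF smooth_on_prod_chart[OF f c(1) d(1)]]) (use c d in auto)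
  moreover have "((\<lambda>u. (\<phi> x, u)) has_derivative (\<lambda>v. (0, v))) (at (\<psi> y))"
    by (auto intro!: derivative_eq_intros)
  ultimately have "((\<lambda>u. ?F (\<phi> x, u)) has_derivative (\<lambda>v. frechet_derivative ?F (at (\<phi> x, \<psi> y)) (0, v))) (at (\<psi> y))"
    using has_derivative_compose by blast
  then have "(((\<lambda>y. f (x, y)) \<circ> inv_into V \<psi>) has_derivative (\<lambda>v. frechet_derivative ?F (at (\<phi> x, \<psi> y)) (0, v))) (at (\<psi> y))"
  proof (rule has_derivative_transform_within_open)
    show "?F (\<phi> x, u) = ((\<lambda>y. f (x, y)) \<circ> inv_into V \<psi>) u" if "u \<in> \<psi> ` V" for u
      using inv_into_map_prod[OF c(1) d(1) _ that, of "\<phi> x"] c(2) by (simp add: B.chart_inv[OF c])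
  qed (use F.chart(2)[OF d(1)] d(2) in auto)
  from frechet_derivative_at[OF this, symmetric] show ?thesis by simp
qed

text \<open>The basis of the model space of the product consists of the vectors (i, 0) and (0, i),
  and the corresponding coordinate fields act as those of B and F along the slices through q.
  Consequently they annihilate functions vanishing on the respective slice; these last two clauses
  are what the splitting of derivations needs.\<close>

lemma product_frame:
  obtains N :: "('b \<times> 'f) set" and u :: "'e \<Rightarrow> 'b \<Rightarrow> real" and w :: "'d \<Rightarrow> 'f \<Rightarrow> real"
    and z :: "'e \<times> 'd \<Rightarrow> 'b \<times> 'f \<Rightarrow> real" and D :: "'e \<times> 'd \<Rightarrow> ('b \<times> 'f) vfield"
  where "open N" "p \<in> N" "\<forall>i. u i \<in> B.SF" "\<forall>i. w i \<in> F.SF" "\<forall>k. D k \<in> M.VF"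
    "\<forall>q\<in>N. \<forall>v\<in>M.T\<^sub>p q. \<forall>f\<in>M.SF. v f = (\<Sum>k\<in>Basis. v (z k) * D k q f)"
    "\<forall>q\<in>N. \<forall>v\<in>B.T\<^sub>p (fst q). \<forall>f\<in>M.SF. v (\<lambda>x. f (x, snd q)) = (\<Sum>i\<in>Basis. v (u i) * D (i, 0) q f)"
    "\<forall>q\<in>N. \<forall>v\<in>F.T\<^sub>p (snd q). \<forall>f\<in>M.SF. v (\<lambda>y. f (fst q, y)) = (\<Sum>i\<in>Basis. v (w i) * D (0, i) q f)"
    "\<forall>q\<in>N. \<forall>f\<in>M.SF. \<forall>i. (\<forall>x. f (x, snd q) = 0) \<longrightarrow> D (i, 0) q f = 0"
    "\<forall>q\<in>N. \<forall>f\<in>M.SF. \<forall>i. (\<forall>y. f (fst q, y) = 0) \<longrightarrow> D (0, i) q f = 0"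
proof -
  obtain U \<phi> where c: "(U, \<phi>) \<in> A\<^sub>B" "fst p \<in> U" by (rule B.chart_exists)
  obtain V \<psi> where d: "(V, \<psi>) \<in> A\<^sub>F" "snd p \<in> V" by (rule F.chart_exists)
  have pUV: "p \<in> U \<times> V" using c d by (simp add: mem_Times_iff)
  obtain N1 u and E :: "'e \<Rightarrow> 'b vfield" where b1: "open N1" "fst p \<in> N1" "N1 \<subseteq> U"
    and b2: "\<forall>i. u i \<in> B.SF" "\<forall>i. E i \<in> B.VF" and "\<forall>i. \<forall>q\<in>N1. u i q = inner (\<phi> q) i"
    and b3: "\<forall>i. \<forall>q\<in>N1. \<forall>f\<in>B.SF. E i q f = frechet_derivative (f \<circ> inv_into U \<phi>) (at (\<phi> q)) i"
    and b4: "\<forall>q\<in>N1. \<forall>v\<in>B.T\<^sub>p q. \<forall>f\<in>B.SF. v f = (\<Sum>i\<in>Basis. v (u i) * E i q f)"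
    by (rule B.chart_frame[OF c])
  obtain N2 w and H :: "'d \<Rightarrow> 'f vfield" where f1: "open N2" "snd p \<in> N2" "N2 \<subseteq> V"
    and f2: "\<forall>i. w i \<in> F.SF" "\<forall>i. H i \<in> F.VF" and "\<forall>i. \<forall>q\<in>N2. w i q = inner (\<psi> q) i"
    and f3: "\<forall>i. \<forall>q\<in>N2. \<forall>f\<in>F.SF. H i q f = frechet_derivative (f \<circ> inv_into V \<psi>) (at (\<psi> q)) i"
    and f4: "\<forall>q\<in>N2. \<forall>v\<in>F.T\<^sub>p q. \<forall>f\<in>F.SF. v f = (\<Sum>i\<in>Basis. v (w i) * H i q f)"
    by (rule F.chart_frame[OF d])
  obtain N3 z and D :: "'e \<times> 'd \<Rightarrow> ('b \<times> 'f) vfield" where m1: "open N3" "p \<in> N3" "N3 \<subseteq> U \<times> V"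
    and m2: "\<forall>i. z i \<in> M.SF" "\<forall>i. D i \<in> M.VF" and "\<forall>i. \<forall>q\<in>N3. z i q = inner (map_prod \<phi> \<psi> q) i"
    and m3: "\<forall>i. \<forall>q\<in>N3. \<forall>f\<in>M.SF. D i q f
      = frechet_derivative (f \<circ> inv_into (U \<times> V) (map_prod \<phi> \<psi>)) (at (map_prod \<phi> \<psi> q)) i"
    and m4: "\<forall>q\<in>N3. \<forall>v\<in>M.T\<^sub>p q. \<forall>f\<in>M.SF. v f = (\<Sum>i\<in>Basis. v (z i) * D i q f)"
    by (rule M.chart_frame[OF prod_chart[OF c(1) d(1)] pUV])
  define N where "N = (N1 \<times> N2) \<inter> N3"
  have N: "fst q \<in> N1" "snd q \<in> N2" "q \<in> N3" "fst q \<in> U" "snd q \<in> V" if "q \<in> N" for q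
    using that b1(3) f1(3) by (auto simp: N_def)
  have mp: "map_prod \<phi> \<psi> q = (\<phi> (fst q), \<psi> (snd q))" for q by (cases q) simp
  have D1: "D (i, 0) q f = E i (fst q) (\<lambda>x. f (x, snd q))" if "q \<in> N" "f \<in> M.SF" for i q f
    using that m3 b3 N frechet_derivative_slice_fst[OF _ c(1) _ d(1)] SF_slice_fst by (simp add: mp)
  have D2: "D (0, i) q f = H i (snd q) (\<lambda>y. f (fst q, y))" if "q \<in> N" "f \<in> M.SF" for i q f
    using that m3 f3 N frechet_derivative_slice_snd[OF _ c(1) _ d(1)] SF_slice_snd by (simp add: mp)
  have E0: "E i x (\<lambda>x. 0) = 0" and H0: "H j y (\<lambda>y. 0) = 0" for i j x y
    using B.tangent_const[OF B.VF_tangent] F.tangent_const[OF F.VF_tangent] b2(2) f2(2) by simp_all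
  show thesis
  proof (rule that[of N u w D z])
    show "open N" using b1(1) f1(1) m1(1) by (simp add: N_def open_Times open_Int)
    show "p \<in> N" using b1(2) f1(2) m1(2) by (simp add: N_def mem_Times_iff)
    show "\<forall>q\<in>N. \<forall>v\<in>M.T\<^sub>p q. \<forall>f\<in>M.SF. v f = (\<Sum>k\<in>Basis. v (z k) * D k q f)"
      using m4 N(3) by blast
    show "\<forall>q\<in>N. \<forall>v\<in>B.T\<^sub>p (fst q). \<forall>f\<in>M.SF. v (\<lambda>x. f (x, snd q)) = (\<Sum>i\<in>Basis. v (u i) * D (i, 0) q f)"
    proof (intro ballI)
      fix q v f assume h: "q \<in> N" "v \<in> B.T\<^sub>p (fst q)" "f \<in> M.SF"
      show "v (\<lambda>x. f (x, snd q)) = (\<Sum>i\<in>Basis. v (u i) * D (i, 0) q f)"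
        unfolding D1[OF h(1,3)] using b4 N(1)[OF h(1)] h(2) SF_slice_fst[OF h(3)] by blast
    qed
    show "\<forall>q\<in>N. \<forall>v\<in>F.T\<^sub>p (snd q). \<forall>f\<in>M.SF. v (\<lambda>y. f (fst q, y)) = (\<Sum>i\<in>Basis. v (w i) * D (0, i) q f)"
    proof (intro ballI)
      fix q v f assume h: "q \<in> N" "v \<in> F.T\<^sub>p (snd q)" "f \<in> M.SF"
      show "v (\<lambda>y. f (fst q, y)) = (\<Sum>i\<in>Basis. v (w i) * D (0, i) q f)"
        unfolding D2[OF h(1,3)] using f4 N(2)[OF h(1)] h(2) SF_slice_snd[OF h(3)] by blast
    qed
    show "\<forall>q\<in>N. \<forall>f\<in>M.SF. \<forall>i. (\<forall>x. f (x, snd q) = 0) \<longrightarrow> D (i, 0) q f = 0"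
      by (simp add: D1 E0)
    show "\<forall>q\<in>N. \<forall>f\<in>M.SF. \<forall>i. (\<forall>y. f (fst q, y) = 0) \<longrightarrow> D (0, i) q f = 0"
      by (simp add: D2 H0)
  qed (rule b2 f2 m2)+
qed

section \<open>Splitting of tangent vectors, lifts and their brackets\<close>

abbreviation "L\<^sub>B \<equiv> lift_fst A\<^sub>B A\<^sub>F"
abbreviation "L\<^sub>F \<equiv> lift_snd A\<^sub>B A\<^sub>F"
abbreviation "push_fst \<equiv> pushforward A\<^sub>B (fst :: 'b \<times> 'f \<Rightarrow> 'b)"
abbreviation "push_snd \<equiv> pushforward A\<^sub>F (snd :: 'b \<times> 'f \<Rightarrow> 'f)"
abbreviation "incl_fst y \<equiv> pushforward M (\<lambda>x'. (x', y))"
abbreviation "incl_snd x \<equiv> pushforward M (\<lambda>y'. (x, y'))"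

lemma push_fst_apply: "push_fst v f = (if f \<in> B.SF then v (\<lambda>p. f (fst p)) else 0)"
  by (simp add: pushforward_def comp_def)

lemma push_snd_apply: "push_snd v f = (if f \<in> F.SF then v (\<lambda>p. f (snd p)) else 0)"
  by (simp add: pushforward_def comp_def)

lemma incl_fst_apply: "incl_fst y v f = (if f \<in> M.SF then v (\<lambda>x. f (x, y)) else 0)"
  by (simp add: pushforward_def comp_def)

lemma incl_snd_apply: "incl_snd x v f = (if f \<in> M.SF then v (\<lambda>y. f (x, y)) else 0)"
  by (simp add: pushforward_def comp_def)

lemma lift_fst_eq: "L\<^sub>B X p = incl_fst (snd p) (X (fst p))"
  by (simp add: lift_fst_def case_prod_beta)

lemma lift_snd_eq: "L\<^sub>F U p = incl_snd (fst p) (U (snd p))"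
  by (simp add: lift_snd_def case_prod_beta)

lemma push_fst_tangent: "v \<in> M.T\<^sub>p p \<Longrightarrow> push_fst v \<in> B.T\<^sub>p (fst p)"
  by (rule B.pushforward_tangent[OF M.manifold_axioms SF_fst])

lemma push_snd_tangent: "v \<in> M.T\<^sub>p p \<Longrightarrow> push_snd v \<in> F.T\<^sub>p (snd p)"
  by (rule F.pushforward_tangent[OF M.manifold_axioms SF_snd])

lemma incl_fst_tangent: "v \<in> B.T\<^sub>p x \<Longrightarrow> incl_fst y v \<in> M.T\<^sub>p (x, y)"
  by (rule M.pushforward_tangent[OF B.manifold_axioms SF_slice_fst])

lemma incl_snd_tangent: "v \<in> F.T\<^sub>p y \<Longrightarrow> incl_snd x v \<in> M.T\<^sub>p (x, y)"
  by (rule M.pushforward_tangent[OF F.manifold_axioms SF_slice_snd])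

lemma push_fst_incl_fst: assumes "v \<in> B.T\<^sub>p x" shows "push_fst (incl_fst y v) = v"
proof
  fix f show "push_fst (incl_fst y v) f = v f"
    using B.tangent_nonsmooth[OF assms, of f]
    by (cases "f \<in> B.SF") (simp_all add: push_fst_apply incl_fst_apply SF_fst)
qed

lemma push_snd_incl_snd: assumes "v \<in> F.T\<^sub>p y" shows "push_snd (incl_snd x v) = v"
proof
  fix f show "push_snd (incl_snd x v) f = v f"
    using F.tangent_nonsmooth[OF assms, of f]
    by (cases "f \<in> F.SF") (simp_all add: push_snd_apply incl_snd_apply SF_snd)
qed

lemma push_snd_incl_fst: assumes "v \<in> B.T\<^sub>p x" shows "push_snd (incl_fst y v) = (\<lambda>f. 0)"
proof
  fix f show "push_snd (incl_fst y v) f = 0"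
    by (simp add: push_snd_apply incl_fst_apply SF_snd B.tangent_const[OF assms])
qed

lemma push_fst_incl_snd: assumes "v \<in> F.T\<^sub>p y" shows "push_fst (incl_snd x v) = (\<lambda>f. 0)"
proof
  fix f show "push_fst (incl_snd x v) f = 0"
    by (simp add: push_fst_apply incl_snd_apply SF_fst F.tangent_const[OF assms])
qed

text \<open>The combination f - f(., y) - f(x, .) + f(x, y) vanishes on both slices through (x, y).
  All its coordinate derivatives at that point are therefore zero, and so is the value of any
  derivation on it.\<close>

lemma tangent_split_smooth:
  assumes v: "v \<in> M.T\<^sub>p (x, y)" and f: "f \<in> M.SF"
  shows "v f = v (\<lambda>p. f (fst p, y)) + v (\<lambda>p. f (x, snd p))"
proof -
  obtain N u w z and D :: "'e \<times> 'd \<Rightarrow> ('b \<times> 'f) vfield" where N: "open N" "(x, y) \<in> N" and u: "\<forall>i. u i \<in> B.SF" and w: "\<forall>i. w i \<in> F.SF" and D: "\<forall>k. D k \<in> M.VF"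
    and r: "\<forall>q\<in>N. \<forall>v\<in>M.T\<^sub>p q. \<forall>f\<in>M.SF. v f = (\<Sum>k\<in>Basis. v (z k) * D k q f)"
    and r1: "\<forall>q\<in>N. \<forall>v\<in>B.T\<^sub>p (fst q). \<forall>f\<in>M.SF. v (\<lambda>x. f (x, snd q)) = (\<Sum>i\<in>Basis. v (u i) * D (i, 0) q f)"
    and r2: "\<forall>q\<in>N. \<forall>v\<in>F.T\<^sub>p (snd q). \<forall>f\<in>M.SF. v (\<lambda>y. f (fst q, y)) = (\<Sum>i\<in>Basis. v (w i) * D (0, i) q f)"
    and D1: "\<forall>q\<in>N. \<forall>f\<in>M.SF. \<forall>i. (\<forall>x. f (x, snd q) = 0) \<longrightarrow> D (i, 0) q f = 0"
    and D2: "\<forall>q\<in>N. \<forall>f\<in>M.SF. \<forall>i. (\<forall>y. f (fst q, y) = 0) \<longrightarrow> D (0, i) q f = 0"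
    by (rule product_frame)
  have s: "(\<lambda>p. f (fst p, y)) \<in> M.SF" "(\<lambda>p. f (x, snd p)) \<in> M.SF"
    using SF_fst[OF SF_slice_fst[OF f]] SF_snd[OF SF_slice_snd[OF f]] by simp_all
  define h where "h = (\<lambda>p. f p - f (fst p, y) - f (x, snd p) + f (x, y))"
  have h: "h \<in> M.SF" unfolding h_def by (intro M.SF_add M.SF_diff M.SF_const f s)
  have "D k (x, y) h = 0" if "k \<in> Basis" for k
    using that D1 D2 N(2) h by (auto simp: Basis_prod_def h_def)
  moreover have "v h = (\<Sum>k\<in>Basis. v (z k) * D k (x, y) h)" using r N(2) v h by blast
  ultimately have "v h = 0" by simp
  moreover have "v h = v f - v (\<lambda>p. f (fst p, y)) - v (\<lambda>p. f (x, snd p))"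
    unfolding h_def
    by (simp add: M.tangent_add[OF v] M.tangent_diff[OF v] M.tangent_const[OF v] M.SF_diff f s)
  ultimately show ?thesis by simp
qed

lemma tangent_split:
  assumes v: "v \<in> M.T\<^sub>p (x, y)"
  shows "v = (\<lambda>f. incl_fst y (push_fst v) f + incl_snd x (push_snd v) f)"
proof
  fix f show "v f = incl_fst y (push_fst v) f + incl_snd x (push_snd v) f"
    using tangent_split_smooth[OF v, of f] M.tangent_nonsmooth[OF v, of f]
    by (cases "f \<in> M.SF")
      (simp_all add: incl_fst_apply incl_snd_apply push_fst_apply push_snd_apply SF_slice_fst SF_slice_snd)
qed

lemma lift_fst_VF: assumes X: "X \<in> B.VF" shows "L\<^sub>B X \<in> M.VF"
proof (rule M.VF_I)
  show "L\<^sub>B X q \<in> M.T\<^sub>p q" for q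
    using incl_fst_tangent[OF B.VF_tangent[OF X], of "snd q" "fst q"] by (simp add: lift_fst_eq)
  fix f assume f: "f \<in> M.SF"
  show "(\<lambda>q. L\<^sub>B X q f) \<in> M.SF"
  proof (rule M.SF_local)
    fix p
    obtain N u w z and D :: "'e \<times> 'd \<Rightarrow> ('b \<times> 'f) vfield" where N: "open N" "p \<in> N" and u: "\<forall>i. u i \<in> B.SF" and w: "\<forall>i. w i \<in> F.SF" and D: "\<forall>k. D k \<in> M.VF"
      and r: "\<forall>q\<in>N. \<forall>v\<in>M.T\<^sub>p q. \<forall>f\<in>M.SF. v f = (\<Sum>k\<in>Basis. v (z k) * D k q f)"
      and r1: "\<forall>q\<in>N. \<forall>v\<in>B.T\<^sub>p (fst q). \<forall>f\<in>M.SF. v (\<lambda>x. f (x, snd q)) = (\<Sum>i\<in>Basis. v (u i) * D (i, 0) q f)"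
      and r2: "\<forall>q\<in>N. \<forall>v\<in>F.T\<^sub>p (snd q). \<forall>f\<in>M.SF. v (\<lambda>y. f (fst q, y)) = (\<Sum>i\<in>Basis. v (w i) * D (0, i) q f)"
      and D1: "\<forall>q\<in>N. \<forall>f\<in>M.SF. \<forall>i. (\<forall>x. f (x, snd q) = 0) \<longrightarrow> D (i, 0) q f = 0"
      and D2: "\<forall>q\<in>N. \<forall>f\<in>M.SF. \<forall>i. (\<forall>y. f (fst q, y) = 0) \<longrightarrow> D (0, i) q f = 0"
      by (rule product_frame)
    \<comment> \<open>The lift in local coordinates: its coefficients are pulled back from B, and
      the fields \<open>D (i, 0)\<close> are smooth on the product.\<close>
    let ?h = "\<lambda>q. \<Sum>i\<in>Basis. vf_apply X (u i) (fst q) * vf_apply (D (i, 0)) f q"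
    have "?h \<in> M.SF"
      by (intro M.SF_sum M.SF_mult SF_fst B.VF_smooth[OF X] M.VF_smooth f) (use u D in auto)
    moreover have "L\<^sub>B X q f = ?h q" if q: "q \<in> N" for q
      using r1 q f B.VF_tangent[OF X, of "fst q"] by (simp add: lift_fst_eq incl_fst_apply vf_apply_def)
    ultimately show "\<exists>N h. open N \<and> p \<in> N \<and> h \<in> M.SF \<and> (\<forall>q\<in>N. L\<^sub>B X q f = h q)"
      using N by (intro exI[of _ N] exI[of _ ?h]) simp
  qed
qed

lemma lift_snd_VF: assumes U: "U \<in> F.VF" shows "L\<^sub>F U \<in> M.VF"
proof (rule M.VF_I)
  show "L\<^sub>F U q \<in> M.T\<^sub>p q" for q
    using incl_snd_tangent[OF F.VF_tangent[OF U], of "fst q" "snd q"] by (simp add: lift_snd_eq)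
  fix f assume f: "f \<in> M.SF"
  show "(\<lambda>q. L\<^sub>F U q f) \<in> M.SF"
  proof (rule M.SF_local)
    fix p
    obtain N u w z and D :: "'e \<times> 'd \<Rightarrow> ('b \<times> 'f) vfield" where N: "open N" "p \<in> N" and u: "\<forall>i. u i \<in> B.SF" and w: "\<forall>i. w i \<in> F.SF" and D: "\<forall>k. D k \<in> M.VF"
      and r: "\<forall>q\<in>N. \<forall>v\<in>M.T\<^sub>p q. \<forall>f\<in>M.SF. v f = (\<Sum>k\<in>Basis. v (z k) * D k q f)"
      and r1: "\<forall>q\<in>N. \<forall>v\<in>B.T\<^sub>p (fst q). \<forall>f\<in>M.SF. v (\<lambda>x. f (x, snd q)) = (\<Sum>i\<in>Basis. v (u i) * D (i, 0) q f)"
      and r2: "\<forall>q\<in>N. \<forall>v\<in>F.T\<^sub>p (snd q). \<forall>f\<in>M.SF. v (\<lambda>y. f (fst q, y)) = (\<Sum>i\<in>Basis. v (w i) * D (0, i) q f)"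
      and D1: "\<forall>q\<in>N. \<forall>f\<in>M.SF. \<forall>i. (\<forall>x. f (x, snd q) = 0) \<longrightarrow> D (i, 0) q f = 0"
      and D2: "\<forall>q\<in>N. \<forall>f\<in>M.SF. \<forall>i. (\<forall>y. f (fst q, y) = 0) \<longrightarrow> D (0, i) q f = 0"
      by (rule product_frame)
    let ?h = "\<lambda>q. \<Sum>i\<in>Basis. vf_apply U (w i) (snd q) * vf_apply (D (0, i)) f q"
    have "?h \<in> M.SF"
      by (intro M.SF_sum M.SF_mult SF_snd F.VF_smooth[OF U] M.VF_smooth f) (use w D in auto)
    moreover have "L\<^sub>F U q f = ?h q" if q: "q \<in> N" for q
      using r2 q f F.VF_tangent[OF U, of "snd q"] by (simp add: lift_snd_eq incl_snd_apply vf_apply_def)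
    ultimately show "\<exists>N h. open N \<and> p \<in> N \<and> h \<in> M.SF \<and> (\<forall>q\<in>N. L\<^sub>F U q f = h q)"
      using N by (intro exI[of _ N] exI[of _ ?h]) simp
  qed
qed

lemma lift_fst_fst: "h \<in> B.SF \<Longrightarrow> vf_apply (L\<^sub>B X) (\<lambda>p. h (fst p)) = (\<lambda>p. vf_apply X h (fst p))"
  by (simp add: vf_apply_def lift_fst_eq incl_fst_apply SF_fst)

lemma lift_fst_snd:
  "X \<in> B.VF \<Longrightarrow> h \<in> F.SF \<Longrightarrow> vf_apply (L\<^sub>B X) (\<lambda>p. h (snd p)) = (\<lambda>p. 0)"
  by (simp add: vf_apply_def lift_fst_eq incl_fst_apply SF_snd B.tangent_const[OF B.VF_tangent])

lemma lift_snd_snd: "h \<in> F.SF \<Longrightarrow> vf_apply (L\<^sub>F U) (\<lambda>p. h (snd p)) = (\<lambda>p. vf_apply U h (snd p))"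
  by (simp add: vf_apply_def lift_snd_eq incl_snd_apply SF_snd)

lemma lift_snd_fst:
  "U \<in> F.VF \<Longrightarrow> h \<in> B.SF \<Longrightarrow> vf_apply (L\<^sub>F U) (\<lambda>p. h (fst p)) = (\<lambda>p. 0)"
  by (simp add: vf_apply_def lift_snd_eq incl_snd_apply SF_fst F.tangent_const[OF F.VF_tangent])

lemma lie_bracket_lift_fst:
  assumes X: "X \<in> B.VF" and Y: "Y \<in> B.VF"
  shows "lie_bracket (L\<^sub>B X) (L\<^sub>B Y) = L\<^sub>B (lie_bracket X Y)"
proof (intro ext)
  fix p f
  show "lie_bracket (L\<^sub>B X) (L\<^sub>B Y) p f = L\<^sub>B (lie_bracket X Y) p f"
  proof (cases "f \<in> M.SF")
    case True
    have s: "(\<lambda>x. vf_apply (L\<^sub>B Z) f (x, y)) = vf_apply Z (\<lambda>x. f (x, y))" for Z y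
      using True by (auto simp: vf_apply_def lift_fst_eq incl_fst_apply)
    show ?thesis
      using True M.VF_smooth[OF lift_fst_VF[OF X] True] M.VF_smooth[OF lift_fst_VF[OF Y] True]
      by (simp add: lie_bracket_def lift_fst_eq[of _ p] incl_fst_apply s)
  next
    case False
    then show ?thesis
      using M.tangent_nonsmooth[OF M.VF_tangent[OF M.lie_bracket_VF[OF lift_fst_VF[OF X] lift_fst_VF[OF Y]]] False]
      by (simp add: lift_fst_eq incl_fst_apply)
  qed
qed

lemma lie_bracket_lift_snd:
  assumes X: "X \<in> F.VF" and Y: "Y \<in> F.VF"
  shows "lie_bracket (L\<^sub>F X) (L\<^sub>F Y) = L\<^sub>F (lie_bracket X Y)"
proof (intro ext)
  fix p f
  show "lie_bracket (L\<^sub>F X) (L\<^sub>F Y) p f = L\<^sub>F (lie_bracket X Y) p f"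
  proof (cases "f \<in> M.SF")
    case True
    have s: "(\<lambda>y. vf_apply (L\<^sub>F Z) f (x, y)) = vf_apply Z (\<lambda>y. f (x, y))" for Z x
      using True by (auto simp: vf_apply_def lift_snd_eq incl_snd_apply)
    show ?thesis
      using True M.VF_smooth[OF lift_snd_VF[OF X] True] M.VF_smooth[OF lift_snd_VF[OF Y] True]
      by (simp add: lie_bracket_def lift_snd_eq[of _ p] incl_snd_apply s)
  next
    case False
    then show ?thesis
      using M.tangent_nonsmooth[OF M.VF_tangent[OF M.lie_bracket_VF[OF lift_snd_VF[OF X] lift_snd_VF[OF Y]]] False]
      by (simp add: lift_snd_eq incl_snd_apply)
  qed
qed

text \<open>A derivation of the product is determined by its values on functions of one factor, so the
  mixed brackets vanish without appeal to the symmetry of second derivatives.\<close>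

lemma lie_bracket_lift_mixed:
  assumes X: "X \<in> B.VF" and U: "U \<in> F.VF"
  shows "lie_bracket (L\<^sub>B X) (L\<^sub>F U) = (\<lambda>p f. 0)" "lie_bracket (L\<^sub>F U) (L\<^sub>B X) = (\<lambda>p f. 0)"
proof -
  let ?w = "lie_bracket (L\<^sub>B X) (L\<^sub>F U)"
  note LX = lift_fst_VF[OF X] and LU = lift_snd_VF[OF U]
  have 1: "?w p (\<lambda>p. h (fst p)) = 0" if "h \<in> B.SF" for p h
    using fun_cong[OF lift_snd_fst[OF U B.VF_smooth[OF X that]], of p, unfolded vf_apply_def[of "L\<^sub>F U"]]
    by (simp add: lie_bracket_def lift_snd_fst[OF U that] lift_fst_fst[OF that]
        M.tangent_const[OF M.VF_tangent[OF LX]])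
  have 2: "?w p (\<lambda>p. h (snd p)) = 0" if "h \<in> F.SF" for p h
    using fun_cong[OF lift_fst_snd[OF X F.VF_smooth[OF U that]], of p, unfolded vf_apply_def[of "L\<^sub>B X"]]
    by (simp add: lie_bracket_def lift_fst_snd[OF X that] lift_snd_snd[OF that]
        M.tangent_const[OF M.VF_tangent[OF LU]])
  have "?w p f = 0" for p f
  proof (cases "f \<in> M.SF")
    case True
    have "?w p \<in> M.T\<^sub>p (fst p, snd p)" using M.VF_tangent[OF M.lie_bracket_VF[OF LX LU]] by simp
    from tangent_split_smooth[OF this True] show ?thesis
      using 1[OF SF_slice_fst[OF True]] 2[OF SF_slice_snd[OF True]] by simp
  next
    case False
    then show ?thesis using M.tangent_nonsmooth[OF M.VF_tangent[OF M.lie_bracket_VF[OF LX LU]]] by simp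
  qed
  then show "?w = (\<lambda>p f. 0)" by (intro ext)
  then show "lie_bracket (L\<^sub>F U) (L\<^sub>B X) = (\<lambda>p f. 0)"
    by (auto simp: fun_eq_iff lie_bracket_def)
qed

end

section \<open>Twisted products\<close>

locale twisted_product = B: nondegenerate_metric A\<^sub>B g\<^sub>B + F: nondegenerate_metric A\<^sub>F g\<^sub>F
  for A\<^sub>B :: "('b::{t2_space,second_countable_topology}, 'e::euclidean_space) atlas"
    and g\<^sub>B :: "'b metric_tensor"
    and A\<^sub>F :: "('f::{t2_space,second_countable_topology}, 'd::euclidean_space) atlas"
    and g\<^sub>F :: "'f metric_tensor" +
  fixes b :: "'b \<times> 'f \<Rightarrow> real"
  assumes b_smooth: "b \<in> smooth_functions (prod_atlas A\<^sub>B A\<^sub>F)"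
    and db_zero: "b p = 0 \<Longrightarrow> differential (prod_atlas A\<^sub>B A\<^sub>F) b p = 0"

sublocale twisted_product \<subseteq> product_manifold A\<^sub>B A\<^sub>F
  by unfold_locales

sublocale twisted_product \<subseteq> pB: metric_along A\<^sub>B g\<^sub>B "prod_atlas A\<^sub>B A\<^sub>F" fst
  by unfold_locales (auto intro: SF_fst continuous_on_fst continuous_on_id)

sublocale twisted_product \<subseteq> pF: metric_along A\<^sub>F g\<^sub>F "prod_atlas A\<^sub>B A\<^sub>F" snd
  by unfold_locales (auto intro: SF_snd continuous_on_snd continuous_on_id)

context twisted_product
begin

abbreviation "g \<equiv> twisted_metric A\<^sub>B A\<^sub>F g\<^sub>B g\<^sub>F b"

lemma g_eq: "g p v w = g\<^sub>B (fst p) (push_fst v) (push_fst w) + (b p)\<^sup>2 * g\<^sub>F (snd p) (push_snd v) (push_snd w)"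
  by (simp add: twisted_metric_def)

lemma push_fst_add: "push_fst (\<lambda>f. u f + v f) = (\<lambda>f. push_fst u f + push_fst v f)"
  by (auto simp: push_fst_apply)

lemma push_snd_add: "push_snd (\<lambda>f. u f + v f) = (\<lambda>f. push_snd u f + push_snd v f)"
  by (auto simp: push_snd_apply)

lemma push_fst_scale: "push_fst (\<lambda>f. c * v f) = (\<lambda>f. c * push_fst v f)"
  by (auto simp: push_fst_apply)

lemma push_snd_scale: "push_snd (\<lambda>f. c * v f) = (\<lambda>f. c * push_snd v f)"
  by (auto simp: push_snd_apply)

lemma twisted_singular: "singular_semi_riemannian M g"
  unfolding singular_semi_riemannian_def
proof (intro conjI allI ballI)
  note T = push_fst_tangent push_snd_tangent
  show "g p v w = g p w v" if "v \<in> M.T\<^sub>p p" "w \<in> M.T\<^sub>p p" for p v w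
    using B.g_sym[OF T(1)[OF that(1)] T(1)[OF that(2)]] F.g_sym[OF T(2)[OF that(1)] T(2)[OF that(2)]]
    by (simp add: g_eq)
  show "g p (u + v) w = g p u w + g p v w" if "u \<in> M.T\<^sub>p p" "v \<in> M.T\<^sub>p p" "w \<in> M.T\<^sub>p p" for p u v w
    using B.g_add_left[OF T(1)[OF that(1)] T(1)[OF that(2)] T(1)[OF that(3)]]
      F.g_add_left[OF T(2)[OF that(1)] T(2)[OF that(2)] T(2)[OF that(3)]]
    by (simp add: g_eq plus_fun_def push_fst_add push_snd_add algebra_simps)
  show "g p (\<lambda>f. c * v f) w = c * g p v w" if "v \<in> M.T\<^sub>p p" "w \<in> M.T\<^sub>p p" for p c v w
    using B.g_scale_left[OF T(1)[OF that(1)] T(1)[OF that(2)]] F.g_scale_left[OF T(2)[OF that(1)] T(2)[OF that(2)]]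
    by (simp add: g_eq push_fst_scale push_snd_scale algebra_simps)
  show "metric_apply g X Y \<in> M.SF" if "X \<in> M.VF" "Y \<in> M.VF" for X Y
    unfolding metric_apply_def g_eq
    by (intro M.SF_add M.SF_mult M.SF_power b_smooth pB.section_inner pF.section_inner
        pB.section_push pF.section_push that)
qed

end

sublocale twisted_product \<subseteq> M: singular_metric "prod_atlas A\<^sub>B A\<^sub>F" "twisted_metric A\<^sub>B A\<^sub>F g\<^sub>B g\<^sub>F b"
  by unfold_locales (rule twisted_singular)

context twisted_product
begin

lemma push_lift_fst: "X \<in> B.VF \<Longrightarrow> push_fst (L\<^sub>B X p) = X (fst p)" "X \<in> B.VF \<Longrightarrow> push_snd (L\<^sub>B X p) = (\<lambda>f. 0)"
  by (simp_all add: lift_fst_eq push_fst_incl_fst[OF B.VF_tangent] push_snd_incl_fst[OF B.VF_tangent])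

lemma push_lift_snd: "U \<in> F.VF \<Longrightarrow> push_snd (L\<^sub>F U p) = U (snd p)" "U \<in> F.VF \<Longrightarrow> push_fst (L\<^sub>F U p) = (\<lambda>f. 0)"
  by (simp_all add: lift_snd_eq push_snd_incl_snd[OF F.VF_tangent] push_fst_incl_snd[OF F.VF_tangent])

lemma g_0_right: "v \<in> B.T\<^sub>p x \<Longrightarrow> g\<^sub>B x v (\<lambda>f. 0) = 0" "w \<in> F.T\<^sub>p y \<Longrightarrow> g\<^sub>F y w (\<lambda>f. 0) = 0"
  using B.g_sym[OF _ B.tangent_space_0] B.g_0_left F.g_sym[OF _ F.tangent_space_0] F.g_0_left by simp_all

lemma metric_lift:
  "X \<in> B.VF \<Longrightarrow> Y \<in> B.VF \<Longrightarrow> metric_apply g (L\<^sub>B X) (L\<^sub>B Y) = (\<lambda>p. metric_apply g\<^sub>B X Y (fst p))"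
  "X \<in> B.VF \<Longrightarrow> U \<in> F.VF \<Longrightarrow> metric_apply g (L\<^sub>B X) (L\<^sub>F U) = (\<lambda>p. 0)"
  "X \<in> B.VF \<Longrightarrow> U \<in> F.VF \<Longrightarrow> metric_apply g (L\<^sub>F U) (L\<^sub>B X) = (\<lambda>p. 0)"
  "U \<in> F.VF \<Longrightarrow> V \<in> F.VF \<Longrightarrow> metric_apply g (L\<^sub>F U) (L\<^sub>F V) = (\<lambda>p. (b p)\<^sup>2 * metric_apply g\<^sub>F U V (snd p))"
  by (simp_all add: metric_apply_def g_eq push_lift_fst push_lift_snd g_0_right B.VF_tangent F.VF_tangent
      B.g_0_left F.g_0_left B.tangent_space_0 F.tangent_space_0)

lemma metric_apply_0: "W \<in> M.VF \<Longrightarrow> metric_apply g W (\<lambda>p f. 0) = (\<lambda>p. 0)"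
  using M.tensorial_0[OF M.tensorial_metric_apply] by (simp add: fun_eq_iff)

lemma lift_b2_fst:
  assumes X: "X \<in> B.VF" and h: "h \<in> F.SF"
  shows "vf_apply (L\<^sub>B X) (\<lambda>p. (b p)\<^sup>2 * h (snd p)) = (\<lambda>p. 2 * b p * vf_apply (L\<^sub>B X) b p * h (snd p))"
proof
  fix p
  note T = M.VF_tangent[OF lift_fst_VF[OF X], of p]
  show "vf_apply (L\<^sub>B X) (\<lambda>p. (b p)\<^sup>2 * h (snd p)) p = 2 * b p * vf_apply (L\<^sub>B X) b p * h (snd p)"
    using fun_cong[OF lift_fst_snd[OF X h], of p]
    by (simp add: vf_apply_def M.tangent_mult[OF T M.SF_power[OF b_smooth] SF_snd[OF h]]
        M.tangent_power2[OF T b_smooth])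
qed

lemma lift_b2_snd:
  assumes U: "U \<in> F.VF" and h: "h \<in> F.SF"
  shows "vf_apply (L\<^sub>F U) (\<lambda>p. (b p)\<^sup>2 * h (snd p))
    = (\<lambda>p. 2 * b p * vf_apply (L\<^sub>F U) b p * h (snd p) + (b p)\<^sup>2 * vf_apply U h (snd p))"
proof
  fix p
  note T = M.VF_tangent[OF lift_snd_VF[OF U], of p]
  show "vf_apply (L\<^sub>F U) (\<lambda>p. (b p)\<^sup>2 * h (snd p)) p
      = 2 * b p * vf_apply (L\<^sub>F U) b p * h (snd p) + (b p)\<^sup>2 * vf_apply U h (snd p)"
    using fun_cong[OF lift_snd_snd[OF h, of U], of p]
    by (simp add: vf_apply_def M.tangent_mult[OF T M.SF_power[OF b_smooth] SF_snd[OF h]]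
        M.tangent_power2[OF T b_smooth])
qed

lemmas lift_rules = metric_lift lie_bracket_lift_fst lie_bracket_lift_snd lie_bracket_lift_mixed
  metric_apply_0 lift_fst_VF lift_snd_VF B.lie_bracket_VF F.lie_bracket_VF
  lift_fst_fst lift_snd_snd lift_snd_fst lift_b2_fst lift_b2_snd
  B.metric_apply_SF F.metric_apply_SF M.vf_apply_const

section \<open>The Koszul form of the twisted metric on lifts\<close>

lemma koszul_lift_BBB:
  "X \<in> B.VF \<Longrightarrow> Y \<in> B.VF \<Longrightarrow> Z \<in> B.VF \<Longrightarrow>
    koszul g (L\<^sub>B X) (L\<^sub>B Y) (L\<^sub>B Z) = (\<lambda>p. koszul g\<^sub>B X Y Z (fst p))"
  by (simp add: koszul_def lift_rules)

lemma koszul_lift_BBF: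
  "X \<in> B.VF \<Longrightarrow> Y \<in> B.VF \<Longrightarrow> W \<in> F.VF \<Longrightarrow> koszul g (L\<^sub>B X) (L\<^sub>B Y) (L\<^sub>F W) = (\<lambda>p. 0)"
  "X \<in> B.VF \<Longrightarrow> Y \<in> B.VF \<Longrightarrow> W \<in> F.VF \<Longrightarrow> koszul g (L\<^sub>B X) (L\<^sub>F W) (L\<^sub>B Y) = (\<lambda>p. 0)"
  "X \<in> B.VF \<Longrightarrow> Y \<in> B.VF \<Longrightarrow> W \<in> F.VF \<Longrightarrow> koszul g (L\<^sub>F W) (L\<^sub>B X) (L\<^sub>B Y) = (\<lambda>p. 0)"
  by (simp_all add: koszul_def lift_rules)

text \<open>The only surviving term of the Koszul formula is the derivative of b^2 g_F(V,W) along X,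
  namely 2 b X(b) g_F(V,W). Its sign is negative exactly when X stands in the last place.\<close>

lemma koszul_lift_BFF:
  assumes "X \<in> B.VF" "V \<in> F.VF" "W \<in> F.VF"
  shows "koszul g (L\<^sub>B X) (L\<^sub>F V) (L\<^sub>F W) = (\<lambda>p. b p * vf_apply (L\<^sub>B X) b p * metric_apply g\<^sub>F V W (snd p))"
    "koszul g (L\<^sub>F V) (L\<^sub>B X) (L\<^sub>F W) = (\<lambda>p. b p * vf_apply (L\<^sub>B X) b p * metric_apply g\<^sub>F V W (snd p))"
    "koszul g (L\<^sub>F V) (L\<^sub>F W) (L\<^sub>B X) = (\<lambda>p. - b p * vf_apply (L\<^sub>B X) b p * metric_apply g\<^sub>F V W (snd p))"
  using assms F.metric_apply_sym[OF assms(2,3)] by (simp_all add: koszul_def lift_rules mult.assoc)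

lemma koszul_lift_FFF:
  assumes "U \<in> F.VF" "V \<in> F.VF" "W \<in> F.VF"
  shows "koszul g (L\<^sub>F U) (L\<^sub>F V) (L\<^sub>F W) = (\<lambda>p. (b p)\<^sup>2 * koszul g\<^sub>F U V W (snd p)
    + b p * vf_apply (L\<^sub>F U) b p * metric_apply g\<^sub>F V W (snd p)
    + b p * vf_apply (L\<^sub>F V) b p * metric_apply g\<^sub>F U W (snd p)
    - b p * vf_apply (L\<^sub>F W) b p * metric_apply g\<^sub>F U V (snd p))"
  using assms F.metric_apply_sym[OF assms(1,3)]
  by (simp add: koszul_def lift_rules) (simp add: field_simps)

section \<open>Rank and regular points of the twisted metric\<close>

lemma incl_fst_0: "incl_fst y (\<lambda>f. 0) = (\<lambda>f. 0)"
  by (auto simp: incl_fst_apply)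

lemma incl_snd_0: "incl_snd x (\<lambda>f. 0) = (\<lambda>f. 0)"
  by (auto simp: incl_snd_apply)

lemma g_incl_fst:
  "v \<in> B.T\<^sub>p x \<Longrightarrow> w \<in> M.T\<^sub>p (x, y) \<Longrightarrow> g (x, y) (incl_fst y v) w = g\<^sub>B x v (push_fst w)"
  using push_snd_tangent[of w "(x, y)"]
  by (simp add: g_eq push_fst_incl_fst push_snd_incl_fst F.g_0_left)

lemma metric_rank_nonzero:
  assumes "b p \<noteq> 0" shows "metric_rank M g p = DIM('e \<times> 'd)"
proof (rule M.metric_rank_nondegenerate)
  obtain x y where p: "p = (x, y)" by (cases p)
  fix v assume v: "v \<in> M.T\<^sub>p p" and 0: "\<forall>w\<in>M.T\<^sub>p p. g p v w = 0"
  note v' = v[unfolded p]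
  note T = push_fst_tangent[OF v'] push_snd_tangent[OF v']
  have "push_fst v = (\<lambda>f. 0)"
  proof (rule B.nondeg_0)
    show "push_fst v \<in> B.T\<^sub>p x" using T by simp
    show "\<forall>w\<in>B.T\<^sub>p x. g\<^sub>B x (push_fst v) w = 0"
    proof
      fix w assume w: "w \<in> B.T\<^sub>p x"
      have "g p v (incl_fst y w) = 0" using 0 incl_fst_tangent[OF w] by (simp add: p)
      then show "g\<^sub>B x (push_fst v) w = 0"
        using T by (simp add: p g_eq push_fst_incl_fst[OF w] push_snd_incl_fst[OF w] g_0_right)
    qed
  qed
  moreover have "push_snd v = (\<lambda>f. 0)"
  proof (rule F.nondeg_0)
    show "push_snd v \<in> F.T\<^sub>p y" using T by simp
    show "\<forall>w\<in>F.T\<^sub>p y. g\<^sub>F y (push_snd v) w = 0"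
    proof
      fix w assume w: "w \<in> F.T\<^sub>p y"
      have "g p v (incl_snd x w) = 0" using 0 incl_snd_tangent[OF w] by (simp add: p)
      then show "g\<^sub>F y (push_snd v) w = 0"
        using T assms by (simp add: p g_eq push_snd_incl_snd[OF w] push_fst_incl_snd[OF w] g_0_right)
    qed
  qed
  ultimately show "v = (\<lambda>f. 0)"
    using tangent_split[OF v'] by (simp add: incl_fst_0 incl_snd_0)
qed

text \<open>Where b = 0 the metric is the pullback of g_B, so the lowered covectors come from
  vectors of B, and an included frame of B yields a basis of them.\<close>

lemma metric_rank_zero:
  assumes "b p = 0" shows "metric_rank M g p = DIM('e)"
proof -
  obtain x y where p: "p = (x, y)" by (cases p)
  obtain N u and E :: "'e \<Rightarrow> 'b vfield" where N: "open N" "x \<in> N" and uE: "\<forall>i. u i \<in> B.SF" "\<forall>i. E i \<in> B.VF"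
    and d: "\<forall>q\<in>N. \<forall>i\<in>Basis. \<forall>j\<in>Basis. E i q (u j) = (if i = j then 1 else 0)"
    and r: "\<forall>q\<in>N. \<forall>v\<in>B.T\<^sub>p q. v = (\<lambda>f. \<Sum>i\<in>Basis. v (u i) * E i q f)"
    by (rule B.local_frame)
  have ET: "E i q \<in> B.T\<^sub>p q" for i q using uE(2) B.VF_tangent by blast
  have comb: "g\<^sub>B x (\<lambda>f. \<Sum>i\<in>Basis. (\<lambda>f. c i * E i x f) f) w = (\<Sum>i\<in>(Basis::'e set). c i * g\<^sub>B x (E i x) w)"
    if "w \<in> B.T\<^sub>p x" for c w
    by (subst B.g_sum_left[OF _ that])
      (simp_all add: B.g_scale_left[OF ET that] ET B.tangent_space_scale)
  show ?thesis
  proof (rule M.metric_rank_eq[where e = "\<lambda>i. incl_fst y (E i x)"])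
    show "finite (Basis::'e set)" by simp
    show "incl_fst y (E i x) \<in> M.T\<^sub>p p" for i using incl_fst_tangent[OF ET] by (simp add: p)
    show "\<exists>c. \<forall>w\<in>M.T\<^sub>p p. g p v w = (\<Sum>i\<in>Basis. c i * g p (incl_fst y (E i x)) w)" if v: "v \<in> M.T\<^sub>p p" for v
    proof (intro exI[of _ "\<lambda>i. push_fst v (u i)"] ballI)
      fix w assume w: "w \<in> M.T\<^sub>p p"
      have T: "push_fst v \<in> B.T\<^sub>p x" "push_fst w \<in> B.T\<^sub>p x"
        using push_fst_tangent[OF v] push_fst_tangent[OF w] by (simp_all add: p)
      have "push_fst v = (\<lambda>f. \<Sum>i\<in>Basis. (\<lambda>f. push_fst v (u i) * E i x f) f)" using r N(2) T(1) by blast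
      then have "g\<^sub>B x (push_fst v) (push_fst w)
          = g\<^sub>B x (\<lambda>f. \<Sum>i\<in>Basis. (\<lambda>f. push_fst v (u i) * E i x f) f) (push_fst w)" by (rule arg_cong)
      also have "\<dots> = (\<Sum>i\<in>Basis. push_fst v (u i) * g\<^sub>B x (E i x) (push_fst w))" by (rule comb[OF T(2)])
      finally show "g p v w = (\<Sum>i\<in>Basis. push_fst v (u i) * g p (incl_fst y (E i x)) w)"
        using g_incl_fst[OF ET w[unfolded p]] assms by (simp add: p g_eq)
    qed
    fix c and j :: 'e assume c: "\<forall>w\<in>M.T\<^sub>p p. (\<Sum>i\<in>Basis. c i * g p (incl_fst y (E i x)) w) = 0" and j: "j \<in> Basis"
    let ?v = "\<lambda>f. \<Sum>i\<in>(Basis::'e set). (\<lambda>f. c i * E i x f) f"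
    have "?v = (\<lambda>f. 0)"
    proof (rule B.nondeg_0)
      show "?v \<in> B.T\<^sub>p x" by (intro B.tangent_space_sum B.tangent_space_scale ET)
      show "\<forall>w\<in>B.T\<^sub>p x. g\<^sub>B x ?v w = 0"
      proof
        fix w assume w: "w \<in> B.T\<^sub>p x"
        note iw = incl_fst_tangent[OF w, of y]
        have "(\<Sum>i\<in>Basis. c i * g p (incl_fst y (E i x)) (incl_fst y w)) = 0" using c iw by (simp add: p)
        then show "g\<^sub>B x ?v w = 0"
          unfolding comb[OF w] by (simp add: p g_incl_fst[OF ET iw] push_fst_incl_fst[OF w])
      qed
    qed
    from fun_cong[OF this, of "u j"] have "(\<Sum>i\<in>Basis. c i * E i x (u j)) = 0" by simp
    moreover have "(\<Sum>i\<in>Basis. c i * E i x (u j)) = (\<Sum>i\<in>Basis. if i = j then c i else 0)"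
      by (rule sum.cong) (use d N(2) j in auto)
    ultimately show "c j = 0" using j by simp
  qed
qed

text \<open>Either the open set contains a point with b nonzero, and the rank is maximal in a
  neighbourhood of that point, or b vanishes throughout the set and the rank is constant on
  it.\<close>

lemma regular_points_dense:
  assumes "open S" "S \<noteq> {}" shows "\<exists>p\<in>S. p \<in> regular_points M g"
proof (cases "\<exists>q\<in>S. b q \<noteq> 0")
  case True
  then obtain q where q: "q \<in> S" "b q \<noteq> 0" by blast
  have "open (b -` (- {0}))" using M.SF_continuous[OF b_smooth] by (intro open_vimage) auto
  then have "q \<in> regular_points M g"
    unfolding regular_points_def using q(2) metric_rank_nonzero
    by (intro CollectI exI[of _ "b -` (- {0})"]) auto
  then show ?thesis using q by blast
next
  case False
  obtain p where p: "p \<in> S" using assms(2) by blast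
  have "p \<in> regular_points M g"
    unfolding regular_points_def using p False metric_rank_zero assms(1)
    by (intro CollectI exI[of _ S]) auto
  then show ?thesis using p by blast
qed

text \<open>The \<open>F\<close>-part of a Koszul form is divisible by \<open>b\<close>; splitting off this factor makes the
  contraction smooth across the zeros of \<open>b\<close>, where the metric drops rank.\<close>

definition represents :: "('b \<times> 'f) form \<Rightarrow> ('b \<times> 'f \<Rightarrow> 'b tvec) \<Rightarrow> ('b \<times> 'f \<Rightarrow> 'f tvec) \<Rightarrow> bool" where
  "represents \<omega> c d \<longleftrightarrow> tensorial M \<omega> \<and> pB.smooth_section c \<and> pF.smooth_section d \<and>
     (\<forall>p. b p = 0 \<longrightarrow> d p = (\<lambda>f. 0)) \<and>
     (\<forall>X\<in>B.VF. \<omega> (L\<^sub>B X) = (\<lambda>p. g\<^sub>B (fst p) (c p) (X (fst p)))) \<and>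
     (\<forall>U\<in>F.VF. \<omega> (L\<^sub>F U) = (\<lambda>p. b p * g\<^sub>F (snd p) (d p) (U (snd p))))"

text \<open>At the zeros of \<open>b\<close> the convention \<open>inverse 0 = 0\<close> removes the \<open>F\<close>-part, as it should.\<close>

lemma represents_flat:
  assumes r: "represents \<omega> c d"
  defines "v \<equiv> \<lambda>p f. incl_fst (snd p) (c p) f + incl_snd (fst p) (\<lambda>f. inverse (b p) * d p f) f"
  shows "v p \<in> M.T\<^sub>p p" "form_at M \<omega> p = flat M g p (v p)"
    "push_fst (v p) = c p" "push_snd (v p) = (\<lambda>f. inverse (b p) * d p f)"
proof -
  obtain x y where p: "p = (x, y)" by (cases p)
  have T: "c (x, y) \<in> B.T\<^sub>p x" "d (x, y) \<in> F.T\<^sub>p y" and t: "tensorial M \<omega>"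
    using r pB.section_tangent[of c "(x, y)"] pF.section_tangent[of d "(x, y)"] unfolding represents_def by auto
  have Td: "(\<lambda>f. inverse (b (x, y)) * d (x, y) f) \<in> F.T\<^sub>p y" by (rule F.tangent_space_scale[OF T(2)])
  note I = incl_fst_tangent[OF T(1), of y] incl_snd_tangent[OF Td, of x]
  show vT: "v p \<in> M.T\<^sub>p p" using M.tangent_space_add[OF I] by (simp add: v_def p)
  show p1: "push_fst (v p) = c p"
    by (simp add: v_def p push_fst_add push_fst_incl_fst[OF T(1)] push_fst_incl_snd[OF Td])
  show p2: "push_snd (v p) = (\<lambda>f. inverse (b p) * d p f)"
    by (simp add: v_def p push_snd_add push_snd_incl_fst[OF T(1)] push_snd_incl_snd[OF Td])
  show "form_at M \<omega> p = flat M g p (v p)"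
  proof
    fix w show "form_at M \<omega> p w = flat M g p (v p) w"
    proof (cases "w \<in> M.T\<^sub>p p")
      case True
      have W: "push_fst w \<in> B.T\<^sub>p x" "push_snd w \<in> F.T\<^sub>p y"
        using push_fst_tangent[OF True] push_snd_tangent[OF True] by (simp_all add: p)
      obtain X where X: "X \<in> B.VF" "X x = push_fst w" by (rule B.tangent_extends[OF W(1)])
      obtain U where U: "U \<in> F.VF" "U y = push_snd w" by (rule F.tangent_extends[OF W(2)])
      have "w = (\<lambda>f. L\<^sub>B X p f + L\<^sub>F U p f)"
        using tangent_split[OF True[unfolded p]] X(2) U(2) by (simp add: p lift_fst_eq lift_snd_eq)
      then have "form_at M \<omega> p w = form_at M \<omega> p (L\<^sub>B X p) + form_at M \<omega> p (L\<^sub>F U p)"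
        using M.form_at_add[OF t M.VF_tangent[OF lift_fst_VF[OF X(1)]] M.VF_tangent[OF lift_snd_VF[OF U(1)]], of p]
        by simp
      also have "\<dots> = \<omega> (L\<^sub>B X) p + \<omega> (L\<^sub>F U) p"
        using M.form_at_eq[OF t lift_fst_VF[OF X(1)]] M.form_at_eq[OF t lift_snd_VF[OF U(1)]] by simp
      also have "\<dots> = g\<^sub>B x (c p) (push_fst w) + b p * g\<^sub>F y (d p) (push_snd w)"
        using r X U unfolding represents_def by (simp add: p)
      \<comment> \<open>The metric scales the F-part by b^2, so pairing with d/b gives b g_F(d, .).
        At a zero of b both sides reduce to the B-part.\<close>
      also have "\<dots> = g p (v p) w"
        unfolding g_eq p1 p2
        using F.g_scale_left[OF T(2) W(2), of "inverse (b p)"]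
        by (cases "b p = 0") (simp_all add: p power2_eq_square)
      finally show ?thesis using True by (simp add: flat_def)
    qed (simp add: form_at_def flat_def)
  qed
qed

lemma contraction_represented:
  assumes r: "represents \<omega> c d" and r': "represents \<tau> c' d'"
  shows "contraction M g \<omega> \<tau> = (\<lambda>p. g\<^sub>B (fst p) (c p) (c' p) + g\<^sub>F (snd p) (d p) (d' p))"
proof (rule M.contraction_eqI[OF regular_points_dense])
  have s: "pB.smooth_section c" "pF.smooth_section d" "pB.smooth_section c'" "pF.smooth_section d'"
    using r r' unfolding represents_def by blast+
  show "(\<lambda>p. g\<^sub>B (fst p) (c p) (c' p) + g\<^sub>F (snd p) (d p) (d' p)) \<in> M.SF"
    by (intro M.SF_add pB.section_inner pF.section_inner s)
  fix p
  let ?v = "\<lambda>f. incl_fst (snd p) (c p) f + incl_snd (fst p) (\<lambda>f. inverse (b p) * d p f) f"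
  let ?w = "\<lambda>f. incl_fst (snd p) (c' p) f + incl_snd (fst p) (\<lambda>f. inverse (b p) * d' p f) f"
  note v = represents_flat[OF r, of p] and w = represents_flat[OF r', of p]
  note T = pF.section_tangent[OF s(2), of p] pF.section_tangent[OF s(4), of p]
  have "g\<^sub>B (fst p) (c p) (c' p) + g\<^sub>F (snd p) (d p) (d' p) = g p ?v ?w"
  \<comment> \<open>At a zero of b the metric discards the F-part while d is zero. Elsewhere b^2
    cancels the two reciprocals of b.\<close>
  proof (cases "b p = 0")
    case True
    then have "d p = (\<lambda>f. 0)" using r unfolding represents_def by blast
    then show ?thesis using True F.g_0_left[OF T(2)] unfolding g_eq v(3) w(3) by simp
  next
    case False
    then show ?thesis unfolding g_eq v(3,4) w(3,4)
      by (simp add: F.g_scale_left F.g_scale_right F.tangent_space_scale T power2_eq_square)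
        (simp add: field_simps)
  qed
  then show "\<exists>v\<in>M.T\<^sub>p p. \<exists>w\<in>M.T\<^sub>p p. form_at M \<omega> p = flat M g p v \<and> form_at M \<tau> p = flat M g p w \<and>
      g\<^sub>B (fst p) (c p) (c' p) + g\<^sub>F (snd p) (d p) (d' p) = g p v w"
    by (intro bexI[OF _ v(1)] bexI[OF _ w(1)] conjI v(2) w(2))
qed

section \<open>Partial gradients of the twisting function\<close>

definition grad_fst :: "'b \<times> 'f \<Rightarrow> 'b tvec" where
  "grad_fst p = sharp A\<^sub>B g\<^sub>B (fst p) (restrict_fst A\<^sub>B A\<^sub>F p (differential M b p))"

text \<open>The index is raised with g_F rather than b^2 g_F, so the gradient exists and is smooth
  also at the zeros of b.\<close>

definition grad_snd :: "'b \<times> 'f \<Rightarrow> 'f tvec" where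
  "grad_snd p = sharp A\<^sub>F g\<^sub>F (snd p) (restrict_snd A\<^sub>B A\<^sub>F p (differential M b p))"

lemma restrict_fst_apply:
  assumes "v \<in> B.T\<^sub>p (fst p)"
  shows "restrict_fst A\<^sub>B A\<^sub>F p (differential M b p) v = v (\<lambda>x. b (x, snd p))"
  using incl_fst_tangent[OF assms, of "snd p"] assms b_smooth
  by (simp add: restrict_fst_def differential_def incl_fst_apply)

lemma restrict_snd_apply:
  assumes "v \<in> F.T\<^sub>p (snd p)"
  shows "restrict_snd A\<^sub>B A\<^sub>F p (differential M b p) v = v (\<lambda>y. b (fst p, y))"
  using incl_snd_tangent[OF assms, of "fst p"] assms b_smooth
  by (simp add: restrict_snd_def differential_def incl_snd_apply)

lemma covector_restrict_fst: "B.covector (fst p) (restrict_fst A\<^sub>B A\<^sub>F p (differential M b p))"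
  unfolding B.covector_def by (simp add: restrict_fst_apply B.tangent_space_add B.tangent_space_scale)

lemma covector_restrict_snd: "F.covector (snd p) (restrict_snd A\<^sub>B A\<^sub>F p (differential M b p))"
  unfolding F.covector_def by (simp add: restrict_snd_apply F.tangent_space_add F.tangent_space_scale)

lemma grad_fst:
  "grad_fst p \<in> B.T\<^sub>p (fst p)"
  "X \<in> B.VF \<Longrightarrow> g\<^sub>B (fst p) (grad_fst p) (X (fst p)) = vf_apply (L\<^sub>B X) b p"
  using B.sharp_eq[OF covector_restrict_fst] B.VF_tangent b_smooth
  by (simp_all add: grad_fst_def restrict_fst_apply vf_apply_def lift_fst_eq incl_fst_apply)

lemma grad_snd:
  "grad_snd p \<in> F.T\<^sub>p (snd p)"
  "U \<in> F.VF \<Longrightarrow> g\<^sub>F (snd p) (grad_snd p) (U (snd p)) = vf_apply (L\<^sub>F U) b p"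
  using F.sharp_eq[OF covector_restrict_snd] F.VF_tangent b_smooth
  by (simp_all add: grad_snd_def restrict_snd_apply vf_apply_def lift_snd_eq incl_snd_apply)

lemma section_grad_fst: "pB.smooth_section grad_fst"
  unfolding pB.smooth_section_def
  by (intro conjI allI ballI) (simp_all only: grad_fst M.VF_smooth[OF lift_fst_VF b_smooth])

lemma section_grad_snd: "pF.smooth_section grad_snd"
  unfolding pF.smooth_section_def
  by (intro conjI allI ballI) (simp_all only: grad_snd M.VF_smooth[OF lift_snd_VF b_smooth])

lemma db_zero_vf: assumes "W \<in> M.VF" "b p = 0" shows "vf_apply W b p = 0"
proof -
  have "differential M b p (W p) = 0" using db_zero[OF assms(2)] by simp
  then show ?thesis using M.VF_tangent[OF assms(1)] by (simp add: differential_def vf_apply_def)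
qed

lemma grad_snd_zero: assumes "b p = 0" shows "grad_snd p = (\<lambda>f. 0)"
proof (rule F.nondeg_0[OF grad_snd(1)], rule ballI)
  fix w assume "w \<in> F.T\<^sub>p (snd p)"
  then obtain U where U: "U \<in> F.VF" "U (snd p) = w" by (rule F.tangent_extends)
  then show "g\<^sub>F (snd p) (grad_snd p) w = 0"
    using grad_snd(2)[OF U(1), of p] db_zero_vf[OF lift_snd_VF[OF U(1)] assms] by simp
qed

end

section \<open>The semi-symmetric non-metric curvature\<close>

locale twisted_product_field = twisted_product A\<^sub>B g\<^sub>B A\<^sub>F g\<^sub>F b
  for A\<^sub>B :: "('b::{t2_space,second_countable_topology}, 'e::euclidean_space) atlas"
    and g\<^sub>B :: "'b metric_tensor"
    and A\<^sub>F :: "('f::{t2_space,second_countable_topology}, 'd::euclidean_space) atlas"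
    and g\<^sub>F :: "'f metric_tensor" and b :: "'b \<times> 'f \<Rightarrow> real" +
  fixes P :: "'b vfield"
  assumes P: "P \<in> B.VF"
begin

abbreviation "K\<^sub>P \<equiv> koszul_ssnm g (L\<^sub>B P)"
abbreviation "db W \<equiv> vf_apply W b"

text \<open>The lift of P is orthogonal to all lifts from F, so the correction appears only when the
  second argument comes from B, and then the first and third must come from the same factor. Among
  the mixed types only (V, X, W) changes, in contrast to (X, V, W): the connection acquires torsion.
  The added term carries b^2 and so remains divisible by b.\<close>

lemma koszul_ssnm_lift:
  "X \<in> B.VF \<Longrightarrow> Y \<in> B.VF \<Longrightarrow> Z \<in> B.VF \<Longrightarrow>
    K\<^sub>P (L\<^sub>B X) (L\<^sub>B Y) (L\<^sub>B Z) = (\<lambda>p. koszul_ssnm g\<^sub>B P X Y Z (fst p))"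
  "X \<in> B.VF \<Longrightarrow> Y \<in> B.VF \<Longrightarrow> W \<in> F.VF \<Longrightarrow> K\<^sub>P (L\<^sub>B X) (L\<^sub>B Y) (L\<^sub>F W) = (\<lambda>p. 0)"
  "X \<in> B.VF \<Longrightarrow> Y \<in> B.VF \<Longrightarrow> W \<in> F.VF \<Longrightarrow> K\<^sub>P (L\<^sub>B X) (L\<^sub>F W) (L\<^sub>B Y) = (\<lambda>p. 0)"
  "X \<in> B.VF \<Longrightarrow> Y \<in> B.VF \<Longrightarrow> W \<in> F.VF \<Longrightarrow> K\<^sub>P (L\<^sub>F W) (L\<^sub>B X) (L\<^sub>B Y) = (\<lambda>p. 0)"
  "X \<in> B.VF \<Longrightarrow> V \<in> F.VF \<Longrightarrow> W \<in> F.VF \<Longrightarrow> K\<^sub>P (L\<^sub>B X) (L\<^sub>F V) (L\<^sub>F W)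
    = (\<lambda>p. b p * db (L\<^sub>B X) p * metric_apply g\<^sub>F V W (snd p))"
  "X \<in> B.VF \<Longrightarrow> V \<in> F.VF \<Longrightarrow> W \<in> F.VF \<Longrightarrow> K\<^sub>P (L\<^sub>F V) (L\<^sub>B X) (L\<^sub>F W)
    = (\<lambda>p. b p * db (L\<^sub>B X) p * metric_apply g\<^sub>F V W (snd p)
        + metric_apply g\<^sub>B X P (fst p) * ((b p)\<^sup>2 * metric_apply g\<^sub>F V W (snd p)))"
  "X \<in> B.VF \<Longrightarrow> V \<in> F.VF \<Longrightarrow> W \<in> F.VF \<Longrightarrow> K\<^sub>P (L\<^sub>F V) (L\<^sub>F W) (L\<^sub>B X)
    = (\<lambda>p. - b p * db (L\<^sub>B X) p * metric_apply g\<^sub>F V W (snd p))"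
  "U \<in> F.VF \<Longrightarrow> V \<in> F.VF \<Longrightarrow> W \<in> F.VF \<Longrightarrow> K\<^sub>P (L\<^sub>F U) (L\<^sub>F V) (L\<^sub>F W)
    = (\<lambda>p. (b p)\<^sup>2 * koszul g\<^sub>F U V W (snd p) + b p * db (L\<^sub>F U) p * metric_apply g\<^sub>F V W (snd p)
        + b p * db (L\<^sub>F V) p * metric_apply g\<^sub>F U W (snd p)
        - b p * db (L\<^sub>F W) p * metric_apply g\<^sub>F U V (snd p))"
  by (simp_all add: koszul_ssnm_def koszul_lift_BBB koszul_lift_BBF koszul_lift_BFF koszul_lift_FFF
      metric_lift P)

lemma tensorial_koszul_ssnm:
  assumes "X \<in> M.VF" "Y \<in> M.VF" shows "tensorial M (K\<^sub>P X Y)"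
  using M.tensorial_koszul[OF assms] M.tensorial_metric_apply[OF assms(1)]
  unfolding tensorial_def koszul_ssnm_def by (simp add: algebra_simps)

text \<open>These five sections are read off from \<open>koszul_ssnm_lift\<close> by removing the
  factor b from the F-part and raising the index. The capital letters name the factors of the first
  two arguments of the Koszul form; c is the B-part and d the F-part. The parts that are not defined
  are zero.\<close>

definition cBB :: "'b vfield \<Rightarrow> 'b vfield \<Rightarrow> 'b \<times> 'f \<Rightarrow> 'b tvec" where
  "cBB X Y = (\<lambda>p f. B.nabla X Y (fst p) f + metric_apply g\<^sub>B Y P (fst p) * X (fst p) f)"
definition dBF where
  "dBF X V = (\<lambda>p f. db (L\<^sub>B X) p * V (snd p) f)"
definition dFB where
  "dFB V X = (\<lambda>p f. (db (L\<^sub>B X) p + b p * metric_apply g\<^sub>B X P (fst p)) * V (snd p) f)"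
definition cFF where
  "cFF U V = (\<lambda>p f. (- b p * metric_apply g\<^sub>F U V (snd p)) * grad_fst p f)"
definition dFF where
  "dFF U V = (\<lambda>p f. (b p * F.nabla U V (snd p) f + db (L\<^sub>F U) p * V (snd p) f)
    + (db (L\<^sub>F V) p * U (snd p) f + (- metric_apply g\<^sub>F U V (snd p)) * grad_snd p f))"

lemmas T_rules = B.tangent_space_add B.tangent_space_scale B.tangent_space_0 B.VF_tangent B.nabla(1) grad_fst(1)
  F.tangent_space_add F.tangent_space_scale F.tangent_space_0 F.VF_tangent F.nabla(1) grad_snd(1)

lemmas bilinear_rules = B.g_add_left B.g_add_right B.g_scale_left B.g_scale_right B.g_0_left
  F.g_add_left F.g_add_right F.g_scale_left F.g_scale_right F.g_0_left g_0_right

lemmas smooth_rules = b_smooth M.VF_smooth lift_fst_VF lift_snd_VF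
  SF_fst SF_snd B.metric_apply_SF F.metric_apply_SF B.koszul_SF F.koszul_SF P

lemma represents_BB:
  assumes X: "X \<in> B.VF" and Y: "Y \<in> B.VF"
  shows "represents (K\<^sub>P (L\<^sub>B X) (L\<^sub>B Y)) (cBB X Y) (\<lambda>p f. 0)"
  unfolding represents_def
proof (intro conjI ballI allI impI)
  show "tensorial M (K\<^sub>P (L\<^sub>B X) (L\<^sub>B Y))" by (intro tensorial_koszul_ssnm lift_fst_VF X Y)
  show "pB.smooth_section (cBB X Y)" unfolding cBB_def
    by (intro pB.section_add pB.section_scale pB.section_nabla pB.section_VF SF_fst B.metric_apply_SF X Y P)
  fix Z assume Z: "Z \<in> B.VF"
  show "K\<^sub>P (L\<^sub>B X) (L\<^sub>B Y) (L\<^sub>B Z) = (\<lambda>p. g\<^sub>B (fst p) (cBB X Y p) (Z (fst p)))"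
    unfolding koszul_ssnm_lift(1)[OF X Y Z] cBB_def
    by (simp add: bilinear_rules T_rules X Y Z B.nabla(2) koszul_ssnm_def metric_apply_def)
next
  fix U assume U: "U \<in> F.VF"
  show "K\<^sub>P (L\<^sub>B X) (L\<^sub>B Y) (L\<^sub>F U) = (\<lambda>p. b p * g\<^sub>F (snd p) (\<lambda>f. 0) (U (snd p)))"
    by (simp add: koszul_ssnm_lift X Y U bilinear_rules T_rules)
qed (rule pF.section_0 refl)+

lemma represents_BF:
  assumes X: "X \<in> B.VF" and V: "V \<in> F.VF"
  shows "represents (K\<^sub>P (L\<^sub>B X) (L\<^sub>F V)) (\<lambda>p f. 0) (dBF X V)"
  unfolding represents_def
proof (intro conjI ballI allI impI)
  show "tensorial M (K\<^sub>P (L\<^sub>B X) (L\<^sub>F V))" by (intro tensorial_koszul_ssnm lift_fst_VF lift_snd_VF X V)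
  show "pF.smooth_section (dBF X V)" unfolding dBF_def
    by (intro pF.section_scale pF.section_VF M.VF_smooth b_smooth lift_fst_VF X V)
  show "dBF X V p = (\<lambda>f. 0)" if "b p = 0" for p
    using db_zero_vf[OF lift_fst_VF[OF X] that] by (simp add: dBF_def)
  fix Z assume Z: "Z \<in> B.VF"
  show "K\<^sub>P (L\<^sub>B X) (L\<^sub>F V) (L\<^sub>B Z) = (\<lambda>p. g\<^sub>B (fst p) (\<lambda>f. 0) (Z (fst p)))"
    by (simp add: koszul_ssnm_lift X V Z bilinear_rules T_rules)
next
  fix U assume U: "U \<in> F.VF"
  show "K\<^sub>P (L\<^sub>B X) (L\<^sub>F V) (L\<^sub>F U) = (\<lambda>p. b p * g\<^sub>F (snd p) (dBF X V p) (U (snd p)))"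
    by (simp add: koszul_ssnm_lift X V U bilinear_rules T_rules dBF_def metric_apply_def mult.assoc)
qed (rule pB.section_0)

lemma represents_FB:
  assumes X: "X \<in> B.VF" and V: "V \<in> F.VF"
  shows "represents (K\<^sub>P (L\<^sub>F V) (L\<^sub>B X)) (\<lambda>p f. 0) (dFB V X)"
  unfolding represents_def
proof (intro conjI ballI allI impI)
  show "tensorial M (K\<^sub>P (L\<^sub>F V) (L\<^sub>B X))" by (intro tensorial_koszul_ssnm lift_fst_VF lift_snd_VF X V)
  show "pF.smooth_section (dFB V X)" unfolding dFB_def
    by (intro pF.section_scale pF.section_VF M.SF_add M.SF_mult SF_fst B.metric_apply_SF
        M.VF_smooth b_smooth lift_fst_VF X V P)
  show "dFB V X p = (\<lambda>f. 0)" if "b p = 0" for p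
    using db_zero_vf[OF lift_fst_VF[OF X] that] that by (simp add: dFB_def)
  fix Z assume Z: "Z \<in> B.VF"
  show "K\<^sub>P (L\<^sub>F V) (L\<^sub>B X) (L\<^sub>B Z) = (\<lambda>p. g\<^sub>B (fst p) (\<lambda>f. 0) (Z (fst p)))"
    by (simp add: koszul_ssnm_lift X V Z bilinear_rules T_rules)
next
  fix U assume U: "U \<in> F.VF"
  show "K\<^sub>P (L\<^sub>F V) (L\<^sub>B X) (L\<^sub>F U) = (\<lambda>p. b p * g\<^sub>F (snd p) (dFB V X p) (U (snd p)))"
    unfolding koszul_ssnm_lift(6)[OF X V U] dFB_def
    by (simp only: bilinear_rules T_rules V U)
      (simp add: metric_apply_def power2_eq_square algebra_simps)
qed (rule pB.section_0)

lemma represents_FF: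
  assumes U: "U \<in> F.VF" and V: "V \<in> F.VF"
  shows "represents (K\<^sub>P (L\<^sub>F U) (L\<^sub>F V)) (cFF U V) (dFF U V)"
  unfolding represents_def
proof (intro conjI ballI allI impI)
  show "tensorial M (K\<^sub>P (L\<^sub>F U) (L\<^sub>F V))" by (intro tensorial_koszul_ssnm lift_snd_VF U V)
  show "pB.smooth_section (cFF U V)" unfolding cFF_def
    by (intro pB.section_scale section_grad_fst M.SF_mult M.SF_minus b_smooth SF_snd F.metric_apply_SF U V)
  show "pF.smooth_section (dFF U V)" unfolding dFF_def
    by (intro pF.section_add pF.section_scale pF.section_VF section_grad_snd pF.section_nabla
        M.SF_minus SF_snd F.metric_apply_SF M.VF_smooth b_smooth lift_snd_VF U V)
  show "dFF U V p = (\<lambda>f. 0)" if "b p = 0" for p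
    using db_zero_vf[OF lift_snd_VF[OF U] that] db_zero_vf[OF lift_snd_VF[OF V] that]
      grad_snd_zero[OF that] that by (simp add: dFF_def)
  fix Z assume Z: "Z \<in> B.VF"
  show "K\<^sub>P (L\<^sub>F U) (L\<^sub>F V) (L\<^sub>B Z) = (\<lambda>p. g\<^sub>B (fst p) (cFF U V p) (Z (fst p)))"
    unfolding koszul_ssnm_lift(7)[OF Z U V] cFF_def B.g_scale_left[OF grad_fst(1) B.VF_tangent[OF Z]] grad_fst(2)[OF Z]
    by (simp add: mult_ac)
next
  fix W assume W: "W \<in> F.VF"
  show "K\<^sub>P (L\<^sub>F U) (L\<^sub>F V) (L\<^sub>F W) = (\<lambda>p. b p * g\<^sub>F (snd p) (dFF U V p) (W (snd p)))"
    unfolding koszul_ssnm_lift(8)[OF U V W] dFF_def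
    by (simp only: bilinear_rules T_rules U V W F.nabla(2) grad_snd(2))
      (simp add: metric_apply_def power2_eq_square algebra_simps)
qed

section \<open>Contractions of Koszul forms of lifts\<close>

lemma contraction_lift_BB_BB:
  assumes "X \<in> B.VF" "Y \<in> B.VF" "Z \<in> B.VF" "T \<in> B.VF"
  shows "contraction M g (K\<^sub>P (L\<^sub>B X) (L\<^sub>B Z)) (K\<^sub>P (L\<^sub>B Y) (L\<^sub>B T)) = (\<lambda>p. g\<^sub>B (fst p) (cBB X Z p) (cBB Y T p))"
  unfolding contraction_represented[OF represents_BB[OF assms(1,3)] represents_BB[OF assms(2,4)]]
  by (simp add: F.g_0_left F.tangent_space_0)

text \<open>\<open>cBB\<close> depends on the B-component only, so y is arbitrary. Written with a
  point of the product, the contraction on B becomes literally the one on the twisted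
  product.\<close>

lemma contraction_BB:
  assumes "X \<in> B.VF" "Y \<in> B.VF" "Z \<in> B.VF" "T \<in> B.VF"
  shows "contraction A\<^sub>B g\<^sub>B (koszul_ssnm g\<^sub>B P X Z) (koszul_ssnm g\<^sub>B P Y T)
    = (\<lambda>x. g\<^sub>B x (cBB X Z (x, y)) (cBB Y T (x, y)))"
proof (rule B.contraction_nondegenerate)
  have t: "tensorial A\<^sub>B (koszul_ssnm g\<^sub>B P X Y)" if "X \<in> B.VF" "Y \<in> B.VF" for X Y
    using B.tensorial_koszul[OF that] B.tensorial_metric_apply[OF that(1)]
    unfolding tensorial_def koszul_ssnm_def by (simp add: algebra_simps)
  show "tensorial A\<^sub>B (koszul_ssnm g\<^sub>B P X Z)" "tensorial A\<^sub>B (koszul_ssnm g\<^sub>B P Y T)"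
    by (intro t assms)+
  have s: "pB.smooth_section (cBB X Z)" "pB.smooth_section (cBB Y T)"
    using represents_BB assms unfolding represents_def by blast+
  show "cBB X Z (x, y) \<in> B.T\<^sub>p x" "cBB Y T (x, y) \<in> B.T\<^sub>p x" for x
    using pB.section_tangent[OF s(1), of "(x, y)"] pB.section_tangent[OF s(2), of "(x, y)"] by simp_all
  show "koszul_ssnm g\<^sub>B P X Z W x = g\<^sub>B x (cBB X Z (x, y)) (W x)" if "W \<in> B.VF" for W x
    by (simp add: bilinear_rules T_rules assms that B.nabla(2) koszul_ssnm_def metric_apply_def cBB_def)
  show "koszul_ssnm g\<^sub>B P Y T W x = g\<^sub>B x (cBB Y T (x, y)) (W x)" if "W \<in> B.VF" for W x
    by (simp add: bilinear_rules T_rules assms that B.nabla(2) koszul_ssnm_def metric_apply_def cBB_def)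
  show "(\<lambda>x. g\<^sub>B x (cBB X Z (x, y)) (cBB Y T (x, y))) \<in> B.SF"
    using SF_slice_fst[OF pB.section_inner[OF s], of y] by simp
qed

text \<open>Needed because the curvature of F is itself defined by a contraction; this evaluates the
  one that occurs there.\<close>

lemma contraction_nabla_snd:
  assumes "U \<in> F.VF" "V \<in> F.VF" "W \<in> F.VF" "Q \<in> F.VF"
  shows "contraction A\<^sub>F g\<^sub>F (koszul g\<^sub>F U W) (koszul g\<^sub>F V Q) = (\<lambda>y. g\<^sub>F y (F.nabla U W y) (F.nabla V Q y))"
proof (rule F.contraction_nondegenerate)
  show "(\<lambda>y. g\<^sub>F y (F.nabla U W y) (F.nabla V Q y)) \<in> F.SF"
    using SF_slice_snd[OF pF.section_inner[OF pF.section_nabla[OF assms(1,3)] pF.section_nabla[OF assms(2,4)]]]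
    by simp
qed (simp_all add: F.tensorial_koszul F.nabla assms)

text \<open>The representing sections lie in complementary factors, so both summands of the
  contraction contain a zero section.\<close>

lemma contraction_lift_zero:
  assumes "X \<in> B.VF" "Y \<in> B.VF" "Z \<in> B.VF" "W \<in> F.VF"
  shows "contraction M g (K\<^sub>P (L\<^sub>B X) (L\<^sub>B Y)) (K\<^sub>P (L\<^sub>B Z) (L\<^sub>F W)) = (\<lambda>p. 0)"
    "contraction M g (K\<^sub>P (L\<^sub>B Z) (L\<^sub>F W)) (K\<^sub>P (L\<^sub>B X) (L\<^sub>B Y)) = (\<lambda>p. 0)"
    "contraction M g (K\<^sub>P (L\<^sub>B X) (L\<^sub>B Y)) (K\<^sub>P (L\<^sub>F W) (L\<^sub>B Z)) = (\<lambda>p. 0)"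
    "contraction M g (K\<^sub>P (L\<^sub>F W) (L\<^sub>B Z)) (K\<^sub>P (L\<^sub>B X) (L\<^sub>B Y)) = (\<lambda>p. 0)"
proof -
  have T: "cBB X Y p \<in> B.T\<^sub>p (fst p)" "dBF Z W p \<in> F.T\<^sub>p (snd p)" "dFB W Z p \<in> F.T\<^sub>p (snd p)" for p
    unfolding cBB_def dBF_def dFB_def by (intro T_rules assms)+
  note r = represents_BB[OF assms(1,2)] represents_BF[OF assms(3,4)] represents_FB[OF assms(3,4)]
  show "contraction M g (K\<^sub>P (L\<^sub>B X) (L\<^sub>B Y)) (K\<^sub>P (L\<^sub>B Z) (L\<^sub>F W)) = (\<lambda>p. 0)"
    "contraction M g (K\<^sub>P (L\<^sub>B Z) (L\<^sub>F W)) (K\<^sub>P (L\<^sub>B X) (L\<^sub>B Y)) = (\<lambda>p. 0)"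
    "contraction M g (K\<^sub>P (L\<^sub>B X) (L\<^sub>B Y)) (K\<^sub>P (L\<^sub>F W) (L\<^sub>B Z)) = (\<lambda>p. 0)"
    "contraction M g (K\<^sub>P (L\<^sub>F W) (L\<^sub>B Z)) (K\<^sub>P (L\<^sub>B X) (L\<^sub>B Y)) = (\<lambda>p. 0)"
    unfolding contraction_represented[OF r(1,2)] contraction_represented[OF r(2,1)]
      contraction_represented[OF r(1,3)] contraction_represented[OF r(3,1)]
    by (simp_all only: B.g_0_left F.g_0_left g_0_right T) simp_all
qed

lemma contraction_lift_BB_FF:
  assumes "X \<in> B.VF" "Y \<in> B.VF" "U \<in> F.VF" "V \<in> F.VF"
  shows "contraction M g (K\<^sub>P (L\<^sub>B X) (L\<^sub>B Y)) (K\<^sub>P (L\<^sub>F U) (L\<^sub>F V)) = (\<lambda>p. - b p * metric_apply g\<^sub>F U V (snd p)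
      * (g\<^sub>B (fst p) (B.nabla X Y (fst p)) (grad_fst p) + metric_apply g\<^sub>B Y P (fst p) * db (L\<^sub>B X) p))" (is "?l = ?r")
    "contraction M g (K\<^sub>P (L\<^sub>F U) (L\<^sub>F V)) (K\<^sub>P (L\<^sub>B X) (L\<^sub>B Y)) = (\<lambda>p. - b p * metric_apply g\<^sub>F U V (snd p)
      * (g\<^sub>B (fst p) (B.nabla X Y (fst p)) (grad_fst p) + metric_apply g\<^sub>B Y P (fst p) * db (L\<^sub>B X) p))" (is "?l' = _")
proof -
  have T: "cBB X Y p \<in> B.T\<^sub>p (fst p)" "cFF U V p \<in> B.T\<^sub>p (fst p)" "dFF U V p \<in> F.T\<^sub>p (snd p)" for p
    unfolding cBB_def cFF_def dFF_def by (intro T_rules assms)+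
  have x: "g\<^sub>B (fst p) (X (fst p)) (grad_fst p) = db (L\<^sub>B X) p" for p
    using grad_fst(2)[OF assms(1), of p] B.g_sym[OF grad_fst(1) B.VF_tangent[OF assms(1)], of p] by simp
  have e: "g\<^sub>B (fst p) (cBB X Y p) (cFF U V p) = ?r p" for p
    unfolding cBB_def cFF_def
    by (simp only: bilinear_rules T_rules assms x) (simp add: algebra_simps)
  show "?l = ?r"
    unfolding contraction_represented[OF represents_BB[OF assms(1,2)] represents_FF[OF assms(3,4)]]
    by (simp only: e F.g_0_left T) simp
  show "?l' = ?r"
    unfolding contraction_represented[OF represents_FF[OF assms(3,4)] represents_BB[OF assms(1,2)]]
    by (simp only: e g_0_right T B.g_sym[OF T(2) T(1)]) simp
qed

lemma contraction_lift_mixed: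
  assumes "X \<in> B.VF" "Y \<in> B.VF" "V \<in> F.VF" "W \<in> F.VF"
  shows "contraction M g (K\<^sub>P (L\<^sub>B X) (L\<^sub>F V)) (K\<^sub>P (L\<^sub>B Y) (L\<^sub>F W))
      = (\<lambda>p. db (L\<^sub>B X) p * db (L\<^sub>B Y) p * metric_apply g\<^sub>F V W (snd p))"
    "contraction M g (K\<^sub>P (L\<^sub>B X) (L\<^sub>F V)) (K\<^sub>P (L\<^sub>F W) (L\<^sub>B Y))
      = (\<lambda>p. db (L\<^sub>B X) p * (db (L\<^sub>B Y) p + b p * metric_apply g\<^sub>B Y P (fst p)) * metric_apply g\<^sub>F V W (snd p))"
    "contraction M g (K\<^sub>P (L\<^sub>F V) (L\<^sub>B X)) (K\<^sub>P (L\<^sub>B Y) (L\<^sub>F W))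
      = (\<lambda>p. (db (L\<^sub>B X) p + b p * metric_apply g\<^sub>B X P (fst p)) * db (L\<^sub>B Y) p * metric_apply g\<^sub>F V W (snd p))"
    "contraction M g (K\<^sub>P (L\<^sub>F V) (L\<^sub>B X)) (K\<^sub>P (L\<^sub>F W) (L\<^sub>B Y))
      = (\<lambda>p. (db (L\<^sub>B X) p + b p * metric_apply g\<^sub>B X P (fst p))
          * (db (L\<^sub>B Y) p + b p * metric_apply g\<^sub>B Y P (fst p)) * metric_apply g\<^sub>F V W (snd p))"
  unfolding contraction_represented[OF represents_BF[OF assms(1,3)] represents_BF[OF assms(2,4)]]
    contraction_represented[OF represents_BF[OF assms(1,3)] represents_FB[OF assms(2,4)]]
    contraction_represented[OF represents_FB[OF assms(1,3)] represents_BF[OF assms(2,4)]]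
    contraction_represented[OF represents_FB[OF assms(1,3)] represents_FB[OF assms(2,4)]]
    dBF_def dFB_def
  by (simp_all only: bilinear_rules T_rules assms) (simp_all add: metric_apply_def mult_ac)

lemma dFF_tangent: "U \<in> F.VF \<Longrightarrow> V \<in> F.VF \<Longrightarrow> dFF U V p \<in> F.T\<^sub>p (snd p)"
  unfolding dFF_def by (intro T_rules)

lemma dFF_inner:
  assumes "U \<in> F.VF" "V \<in> F.VF" "w \<in> F.T\<^sub>p (snd p)"
  shows "g\<^sub>F (snd p) (dFF U V p) w = b p * g\<^sub>F (snd p) (F.nabla U V (snd p)) w
    + db (L\<^sub>F U) p * g\<^sub>F (snd p) (V (snd p)) w + db (L\<^sub>F V) p * g\<^sub>F (snd p) (U (snd p)) w
    - metric_apply g\<^sub>F U V (snd p) * g\<^sub>F (snd p) (grad_snd p) w"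
  unfolding dFF_def by (simp only: bilinear_rules T_rules assms)

lemma dFF_VF:
  assumes "U \<in> F.VF" "V \<in> F.VF" "W \<in> F.VF"
  shows "g\<^sub>F (snd p) (dFF U V p) (W (snd p)) = b p * koszul g\<^sub>F U V W (snd p)
    + db (L\<^sub>F U) p * metric_apply g\<^sub>F V W (snd p) + db (L\<^sub>F V) p * metric_apply g\<^sub>F U W (snd p)
    - metric_apply g\<^sub>F U V (snd p) * db (L\<^sub>F W) p"
  unfolding dFF_inner[OF assms(1,2) F.VF_tangent[OF assms(3)]]
  by (simp add: F.nabla(2) grad_snd(2) assms metric_apply_def)

text \<open>\<open>G\<close> is the Koszul form of three F-lifts with its factor b removed.
  \<open>dBF\<close> and \<open>dFB\<close> are multiples of the field W, so the contraction
  multiplies \<open>G\<close> by X(b) or by X(b) + b g_B(X,P).\<close>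

lemma contraction_lift_FF_single:
  assumes "X \<in> B.VF" "U \<in> F.VF" "V \<in> F.VF" "W \<in> F.VF"
  defines "G \<equiv> \<lambda>p. b p * koszul g\<^sub>F U V W (snd p)
    + db (L\<^sub>F U) p * metric_apply g\<^sub>F V W (snd p) + db (L\<^sub>F V) p * metric_apply g\<^sub>F U W (snd p)
    - metric_apply g\<^sub>F U V (snd p) * db (L\<^sub>F W) p"
  shows "contraction M g (K\<^sub>P (L\<^sub>F U) (L\<^sub>F V)) (K\<^sub>P (L\<^sub>B X) (L\<^sub>F W)) = (\<lambda>p. db (L\<^sub>B X) p * G p)"
    "contraction M g (K\<^sub>P (L\<^sub>B X) (L\<^sub>F W)) (K\<^sub>P (L\<^sub>F U) (L\<^sub>F V)) = (\<lambda>p. db (L\<^sub>B X) p * G p)"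
    "contraction M g (K\<^sub>P (L\<^sub>F U) (L\<^sub>F V)) (K\<^sub>P (L\<^sub>F W) (L\<^sub>B X))
      = (\<lambda>p. (db (L\<^sub>B X) p + b p * metric_apply g\<^sub>B X P (fst p)) * G p)"
    "contraction M g (K\<^sub>P (L\<^sub>F W) (L\<^sub>B X)) (K\<^sub>P (L\<^sub>F U) (L\<^sub>F V))
      = (\<lambda>p. (db (L\<^sub>B X) p + b p * metric_apply g\<^sub>B X P (fst p)) * G p)"
proof -
  note T = dFF_tangent[OF assms(2,3)] F.VF_tangent[OF assms(4)]
  have c: "cFF U V p \<in> B.T\<^sub>p (fst p)" for p unfolding cFF_def by (intro T_rules)
  have e: "g\<^sub>F (snd p) (dFF U V p) (W (snd p)) = G p" "g\<^sub>F (snd p) (W (snd p)) (dFF U V p) = G p" for p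
    using dFF_VF[OF assms(2-4)] F.g_sym[OF T(2) T(1)] by (simp_all add: G_def)
  note r = represents_FF[OF assms(2,3)] represents_BF[OF assms(1,4)] represents_FB[OF assms(1,4)]
  show "contraction M g (K\<^sub>P (L\<^sub>F U) (L\<^sub>F V)) (K\<^sub>P (L\<^sub>B X) (L\<^sub>F W)) = (\<lambda>p. db (L\<^sub>B X) p * G p)"
    "contraction M g (K\<^sub>P (L\<^sub>B X) (L\<^sub>F W)) (K\<^sub>P (L\<^sub>F U) (L\<^sub>F V)) = (\<lambda>p. db (L\<^sub>B X) p * G p)"
    "contraction M g (K\<^sub>P (L\<^sub>F U) (L\<^sub>F V)) (K\<^sub>P (L\<^sub>F W) (L\<^sub>B X))
      = (\<lambda>p. (db (L\<^sub>B X) p + b p * metric_apply g\<^sub>B X P (fst p)) * G p)"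
    "contraction M g (K\<^sub>P (L\<^sub>F W) (L\<^sub>B X)) (K\<^sub>P (L\<^sub>F U) (L\<^sub>F V))
      = (\<lambda>p. (db (L\<^sub>B X) p + b p * metric_apply g\<^sub>B X P (fst p)) * G p)"
    unfolding contraction_represented[OF r(1,2)] contraction_represented[OF r(2,1)]
      contraction_represented[OF r(1,3)] contraction_represented[OF r(3,1)] dBF_def dFB_def
    by (simp_all only: F.g_scale_left[OF T(2) T(1)] F.g_scale_right[OF T(2) T(1)] e g_0_right(1)[OF c]
        B.g_0_left[OF c]) simp_all
qed

text \<open>A bilinear expansion arranged along the four summands of \<open>dFF V Q\<close>.
  Pairings of a covariant derivative with a field are written as Koszul forms, ready to cancel
  against derivatives of the metric, while the pairing of two covariant derivatives is the
  contraction that occurs in the curvature of F.\<close>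

lemma contraction_lift_FF_FF:
  assumes "U \<in> F.VF" "V \<in> F.VF" "W \<in> F.VF" "Q \<in> F.VF"
  shows "contraction M g (K\<^sub>P (L\<^sub>F U) (L\<^sub>F W)) (K\<^sub>P (L\<^sub>F V) (L\<^sub>F Q)) p
    = (b p)\<^sup>2 * metric_apply g\<^sub>F U W (snd p) * metric_apply g\<^sub>F V Q (snd p) * g\<^sub>B (fst p) (grad_fst p) (grad_fst p)
    + b p * (b p * g\<^sub>F (snd p) (F.nabla U W (snd p)) (F.nabla V Q (snd p))
        + db (L\<^sub>F U) p * koszul g\<^sub>F V Q W (snd p) + db (L\<^sub>F W) p * koszul g\<^sub>F V Q U (snd p)
        - metric_apply g\<^sub>F U W (snd p) * g\<^sub>F (snd p) (F.nabla V Q (snd p)) (grad_snd p))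
    + db (L\<^sub>F V) p * (b p * koszul g\<^sub>F U W Q (snd p) + db (L\<^sub>F U) p * metric_apply g\<^sub>F W Q (snd p)
        + db (L\<^sub>F W) p * metric_apply g\<^sub>F U Q (snd p) - metric_apply g\<^sub>F U W (snd p) * db (L\<^sub>F Q) p)
    + db (L\<^sub>F Q) p * (b p * koszul g\<^sub>F U W V (snd p) + db (L\<^sub>F U) p * metric_apply g\<^sub>F W V (snd p)
        + db (L\<^sub>F W) p * metric_apply g\<^sub>F U V (snd p) - metric_apply g\<^sub>F U W (snd p) * db (L\<^sub>F V) p)
    - metric_apply g\<^sub>F V Q (snd p) * (b p * g\<^sub>F (snd p) (F.nabla U W (snd p)) (grad_snd p)
        + 2 * db (L\<^sub>F U) p * db (L\<^sub>F W) p - metric_apply g\<^sub>F U W (snd p) * g\<^sub>F (snd p) (grad_snd p) (grad_snd p))"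
proof -
  let ?d = "dFF U W p"
  note N = F.nabla(1)[OF assms(2,4), of "snd p"]
  note d = dFF_tangent[OF assms(1,3), of p]
  have c: "g\<^sub>B (fst p) (cFF U W p) (cFF V Q p)
      = (b p)\<^sup>2 * metric_apply g\<^sub>F U W (snd p) * metric_apply g\<^sub>F V Q (snd p) * g\<^sub>B (fst p) (grad_fst p) (grad_fst p)"
    unfolding cFF_def by (simp only: bilinear_rules T_rules) (simp add: power2_eq_square)
  have 0: "g\<^sub>F (snd p) (W' (snd p)) (grad_snd p) = db (L\<^sub>F W') p"
    "g\<^sub>F (snd p) (W' (snd p)) (F.nabla V Q (snd p)) = koszul g\<^sub>F V Q W' (snd p)" if "W' \<in> F.VF" for W'
    using grad_snd(2)[OF that, of p] F.g_sym[OF F.VF_tangent[OF that] grad_snd(1)]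
      F.nabla(2)[OF assms(2,4) that] F.g_sym[OF F.VF_tangent[OF that] N] by simp_all
  have 1: "g\<^sub>F (snd p) ?d (F.nabla V Q (snd p)) = b p * g\<^sub>F (snd p) (F.nabla U W (snd p)) (F.nabla V Q (snd p))
      + db (L\<^sub>F U) p * koszul g\<^sub>F V Q W (snd p) + db (L\<^sub>F W) p * koszul g\<^sub>F V Q U (snd p)
      - metric_apply g\<^sub>F U W (snd p) * g\<^sub>F (snd p) (F.nabla V Q (snd p)) (grad_snd p)"
    unfolding dFF_inner[OF assms(1,3) N] 0(2)[OF assms(1)] 0(2)[OF assms(3)] F.g_sym[OF grad_snd(1) N] ..
  have 2: "g\<^sub>F (snd p) ?d (grad_snd p) = b p * g\<^sub>F (snd p) (F.nabla U W (snd p)) (grad_snd p)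
      + 2 * db (L\<^sub>F U) p * db (L\<^sub>F W) p - metric_apply g\<^sub>F U W (snd p) * g\<^sub>F (snd p) (grad_snd p) (grad_snd p)"
    unfolding dFF_inner[OF assms(1,3) grad_snd(1)] 0(1)[OF assms(1)] 0(1)[OF assms(3)] by simp
  have 3: "g\<^sub>F (snd p) ?d (dFF V Q p) = b p * g\<^sub>F (snd p) ?d (F.nabla V Q (snd p))
      + db (L\<^sub>F V) p * g\<^sub>F (snd p) ?d (Q (snd p)) + db (L\<^sub>F Q) p * g\<^sub>F (snd p) ?d (V (snd p))
      - metric_apply g\<^sub>F V Q (snd p) * g\<^sub>F (snd p) ?d (grad_snd p)"
    unfolding dFF_def[of V Q] by (simp only: F.g_add_right F.g_scale_right T_rules assms d)
  show ?thesis
    unfolding contraction_represented[OF represents_FF[OF assms(1,3)] represents_FF[OF assms(2,4)]]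
      c 3 1 2 dFF_VF[OF assms(1,3,2)] dFF_VF[OF assms(1,3,4)]
    by simp
qed

section \<open>The curvature evaluated on lifts\<close>

abbreviation "R \<equiv> riemann_ssnm M g (L\<^sub>B P)"

text \<open>Mixed lifts commute, so the bracket term of the curvature is a Koszul form with the zero
  field in its first place. \<open>tensorial\<close> concerns the last argument only, hence the
  direct computation.\<close>

lemma koszul_ssnm_0: "K\<^sub>P (\<lambda>p f. 0) Z T = (\<lambda>p. 0)" if "Z \<in> M.VF" "T \<in> M.VF"
proof -
  have z: "metric_apply g (\<lambda>p f. 0) Z = (\<lambda>p. 0)" "metric_apply g Z (\<lambda>p f. 0) = (\<lambda>p. 0)" if "Z \<in> M.VF" for Z
    using metric_apply_0[OF that] M.g_0_left[OF M.VF_tangent[OF that]] by (auto simp: metric_apply_def)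
  have l: "lie_bracket (\<lambda>p f. 0) Z = (\<lambda>p f. 0)" "lie_bracket Z (\<lambda>p f. 0) = (\<lambda>p f. 0)" if "Z \<in> M.VF" for Z
    using M.tangent_const[OF M.VF_tangent[OF that]] by (auto simp: lie_bracket_def vf_apply_def)
  show ?thesis
    by (simp add: koszul_ssnm_def koszul_def z l that M.lie_bracket_VF M.vf_apply_const)
      (simp add: vf_apply_def)
qed

lemmas deriv_rules = M.vf_apply_add M.vf_apply_diff M.vf_apply_minus M.vf_apply_mult M.vf_apply_power2
  M.vf_apply_const lift_fst_fst lift_fst_snd lift_snd_snd lift_snd_fst
  M.SF_add M.SF_mult M.SF_minus M.SF_diff M.SF_power smooth_rules

lemmas contraction_rules = contraction_lift_BB_BB contraction_lift_zero contraction_lift_BB_FF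
  contraction_lift_mixed contraction_lift_FF_single contraction_lift_FF_FF

lemmas bracket_rules = lie_bracket_lift_fst lie_bracket_lift_snd lie_bracket_lift_mixed koszul_ssnm_0
  B.lie_bracket_VF F.lie_bracket_VF lift_fst_VF lift_snd_VF

lemma db_lie_bracket_fst:
  "X \<in> B.VF \<Longrightarrow> Y \<in> B.VF \<Longrightarrow>
    db (L\<^sub>B (lie_bracket X Y)) p = vf_apply (L\<^sub>B X) (db (L\<^sub>B Y)) p - vf_apply (L\<^sub>B Y) (db (L\<^sub>B X)) p"
  unfolding lie_bracket_lift_fst[symmetric] by (simp add: vf_apply_def[of "lie_bracket _ _"]) (simp add: lie_bracket_def vf_apply_def)

lemma db_lie_bracket_snd:
  "U \<in> F.VF \<Longrightarrow> V \<in> F.VF \<Longrightarrow>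
    db (L\<^sub>F (lie_bracket U V)) p = vf_apply (L\<^sub>F U) (db (L\<^sub>F V)) p - vf_apply (L\<^sub>F V) (db (L\<^sub>F U)) p"
  unfolding lie_bracket_lift_snd[symmetric] by (simp add: vf_apply_def[of "lie_bracket _ _"]) (simp add: lie_bracket_def vf_apply_def)

text \<open>The vanishing mixed bracket applied to b. It brings all mixed second derivatives to the
  form XV(b).\<close>

lemma db_mixed:
  assumes "X \<in> B.VF" "U \<in> F.VF"
  shows "vf_apply (L\<^sub>F U) (db (L\<^sub>B X)) p = vf_apply (L\<^sub>B X) (db (L\<^sub>F U)) p"
  using fun_cong[OF fun_cong[OF lie_bracket_lift_mixed(1)[OF assms]], of p b]
  by (simp add: lie_bracket_def vf_apply_def)

lemma curvature_1:
  assumes "X \<in> B.VF" "Y \<in> B.VF" "Z \<in> B.VF" "T \<in> B.VF"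
  shows "R (L\<^sub>B X) (L\<^sub>B Y) (L\<^sub>B Z) (L\<^sub>B T) p = riemann_ssnm A\<^sub>B g\<^sub>B P X Y Z T (fst p)"
proof -
  have s: "koszul_ssnm g\<^sub>B P X Y Z \<in> B.SF" if "X \<in> B.VF" "Y \<in> B.VF" "Z \<in> B.VF" for X Y Z
    unfolding koszul_ssnm_def by (intro B.SF_add B.SF_mult B.koszul_SF B.metric_apply_SF that P)
  show ?thesis
    using assms contraction_BB[of X Y Z T "snd p"] contraction_BB[of Y X Z T "snd p"]
    by (simp add: riemann_ssnm_def curvature_of_def bracket_rules koszul_ssnm_lift contraction_rules
        lift_fst_fst s)
qed

lemma curvature_2:
  assumes "X \<in> B.VF" "Y \<in> B.VF" "Z \<in> B.VF" "W \<in> F.VF"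
  shows "R (L\<^sub>B X) (L\<^sub>B Y) (L\<^sub>B Z) (L\<^sub>F W) p = 0"
    "R (L\<^sub>B X) (L\<^sub>B Y) (L\<^sub>F W) (L\<^sub>B Z) p = 0"
    "R (L\<^sub>B Z) (L\<^sub>F W) (L\<^sub>B X) (L\<^sub>B Y) p = 0"
proof -
  have s: "koszul_ssnm g\<^sub>B P X Y Z \<in> B.SF" if "X \<in> B.VF" "Y \<in> B.VF" "Z \<in> B.VF" for X Y Z
    unfolding koszul_ssnm_def by (intro B.SF_add B.SF_mult B.koszul_SF B.metric_apply_SF that P)
  show "R (L\<^sub>B X) (L\<^sub>B Y) (L\<^sub>B Z) (L\<^sub>F W) p = 0"
    "R (L\<^sub>B X) (L\<^sub>B Y) (L\<^sub>F W) (L\<^sub>B Z) p = 0"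
    "R (L\<^sub>B Z) (L\<^sub>F W) (L\<^sub>B X) (L\<^sub>B Y) p = 0"
    using assms
    by (simp_all add: riemann_ssnm_def curvature_of_def bracket_rules koszul_ssnm_lift contraction_rules
        deriv_rules s)
qed

text \<open>In the first identity the commutator of second derivatives of b cancels the bracket
  term. In the second the derivative and bracket terms vanish. In both, the two contractions agree
  by symmetry of g_F.\<close>

lemma curvature_3:
  assumes "X \<in> B.VF" "Y \<in> B.VF" "V \<in> F.VF" "W \<in> F.VF"
  shows "R (L\<^sub>B X) (L\<^sub>B Y) (L\<^sub>F V) (L\<^sub>F W) p = 0" "R (L\<^sub>F V) (L\<^sub>F W) (L\<^sub>B X) (L\<^sub>B Y) p = 0"
  using assms F.metric_apply_sym[OF assms(3,4)]
  by (simp_all add: riemann_ssnm_def curvature_of_def bracket_rules koszul_ssnm_lift contraction_rules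
      deriv_rules db_lie_bracket_fst) (simp_all add: algebra_simps)

text \<open>X(b) Y(b) from differentiating b Y(b) cancels against the second contraction. Each of
  the two contractions supplies one copy of - b X(b) g_B(Y,P) g_F(V,W), one through
  \<open>cBB\<close> and one through \<open>dFB\<close>.\<close>

lemma curvature_4:
  assumes "X \<in> B.VF" "Y \<in> B.VF" "V \<in> F.VF" "W \<in> F.VF"
  shows "R (L\<^sub>F V) (L\<^sub>B X) (L\<^sub>F W) (L\<^sub>B Y) p =
      b p * vf_apply (L\<^sub>B X) (db (L\<^sub>B Y)) p * metric_apply g\<^sub>F V W (snd p)
      - b p * g\<^sub>B (fst p) (B.nabla X Y (fst p)) (grad_fst p) * metric_apply g\<^sub>F V W (snd p)
      - 2 * b p * db (L\<^sub>B X) p * metric_apply g\<^sub>B Y P (fst p) * metric_apply g\<^sub>F V W (snd p)"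
  using assms F.metric_apply_sym[OF assms(3,4)]
  by (simp add: riemann_ssnm_def curvature_of_def bracket_rules koszul_ssnm_lift contraction_rules
      deriv_rules) (simp add: algebra_simps)

text \<open>Differentiating b^2 g_B(Y,P) along X gives - 2 b X(b) g_B(Y,P), up to the factor
  g_F(V,W), and the two contractions return it in equal shares. Of the terms with P only the
  derivative of g_B(Y,P) survives.\<close>

lemma curvature_5:
  assumes "X \<in> B.VF" "Y \<in> B.VF" "V \<in> F.VF" "W \<in> F.VF"
  shows "R (L\<^sub>F V) (L\<^sub>B X) (L\<^sub>B Y) (L\<^sub>F W) p =
      - b p * vf_apply (L\<^sub>B X) (db (L\<^sub>B Y)) p * metric_apply g\<^sub>F V W (snd p)
      + b p * g\<^sub>B (fst p) (B.nabla X Y (fst p)) (grad_fst p) * metric_apply g\<^sub>F V W (snd p)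
      - (b p)\<^sup>2 * vf_apply X (metric_apply g\<^sub>B Y P) (fst p) * metric_apply g\<^sub>F V W (snd p)"
  using assms F.metric_apply_sym[OF assms(3,4)]
  by (simp add: riemann_ssnm_def curvature_of_def bracket_rules koszul_ssnm_lift contraction_rules
      deriv_rules) (simp add: algebra_simps power2_eq_square)

lemma curvature_swap:
  assumes "X \<in> B.VF" "V \<in> F.VF" "S \<in> M.VF" "S' \<in> M.VF"
  shows "R (L\<^sub>F V) (L\<^sub>B X) S S' p = - R (L\<^sub>B X) (L\<^sub>F V) S S' p"
  using assms by (simp add: riemann_ssnm_def curvature_of_def bracket_rules)

lemmas metric_derivative_rules = F.koszul_compat[symmetric] F.koszul_torsion[symmetric]

text \<open>The terms b X(b) K_F cancel by metric compatibility in the first identity, and by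
  compatibility together with vanishing torsion in the second. In the second identity the terms with
  P from the derivatives and brackets cancel those from the contractions.\<close>

lemma curvature_6:
  fixes p
  assumes "X \<in> B.VF" "U \<in> F.VF" "V \<in> F.VF" "W \<in> F.VF"
  defines "r \<equiv> b p * vf_apply (L\<^sub>B X) (db (L\<^sub>F V)) p * metric_apply g\<^sub>F W U (snd p)
      - db (L\<^sub>B X) p * db (L\<^sub>F V) p * metric_apply g\<^sub>F W U (snd p)
      - b p * vf_apply (L\<^sub>B X) (db (L\<^sub>F W)) p * metric_apply g\<^sub>F U V (snd p)
      + db (L\<^sub>B X) p * db (L\<^sub>F W) p * metric_apply g\<^sub>F U V (snd p)"
  shows "R (L\<^sub>B X) (L\<^sub>F U) (L\<^sub>F V) (L\<^sub>F W) p = r" "R (L\<^sub>F V) (L\<^sub>F W) (L\<^sub>B X) (L\<^sub>F U) p = r"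
proof -
  note s = F.metric_apply_sym[OF assms(3,4)] F.metric_apply_sym[OF assms(2,4)] F.metric_apply_sym[OF assms(2,3)]
  show "R (L\<^sub>B X) (L\<^sub>F U) (L\<^sub>F V) (L\<^sub>F W) p = r" "R (L\<^sub>F V) (L\<^sub>F W) (L\<^sub>B X) (L\<^sub>F U) p = r"
    using assms(1-4) s
    by (simp_all add: riemann_ssnm_def curvature_of_def bracket_rules koszul_ssnm_lift contraction_rules
        deriv_rules db_mixed metric_derivative_rules)
      (simp_all add: r_def s algebra_simps power2_eq_square)
qed

text \<open>All terms with P come from the contractions with \<open>dFB\<close>: they are b g_B(X,P)
  times the difference of the functions \<open>G\<close> of
  \<open>contraction_lift_FF_single\<close> for (V, U, W) and (W, U, V). The summands U(b) g_F(V,W)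
  drop out of this difference, and the remaining first derivatives of b double.\<close>

lemma curvature_7:
  assumes "X \<in> B.VF" "U \<in> F.VF" "V \<in> F.VF" "W \<in> F.VF"
  shows "R (L\<^sub>F V) (L\<^sub>F W) (L\<^sub>F U) (L\<^sub>B X) p =
      - b p * vf_apply (L\<^sub>B X) (db (L\<^sub>F V)) p * metric_apply g\<^sub>F W U (snd p)
      + db (L\<^sub>B X) p * db (L\<^sub>F V) p * metric_apply g\<^sub>F W U (snd p)
      + b p * vf_apply (L\<^sub>B X) (db (L\<^sub>F W)) p * metric_apply g\<^sub>F U V (snd p)
      - db (L\<^sub>B X) p * db (L\<^sub>F W) p * metric_apply g\<^sub>F U V (snd p)
      - 2 * b p * db (L\<^sub>F W) p * metric_apply g\<^sub>B X P (fst p) * metric_apply g\<^sub>F U V (snd p)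
      + 2 * b p * db (L\<^sub>F V) p * metric_apply g\<^sub>B X P (fst p) * metric_apply g\<^sub>F U W (snd p)
      + (b p)\<^sup>2 * metric_apply g\<^sub>B X P (fst p) * (koszul g\<^sub>F V U W (snd p) - koszul g\<^sub>F W U V (snd p))"
proof -
  note s = F.metric_apply_sym[OF assms(3,4)] F.metric_apply_sym[OF assms(2,4)] F.metric_apply_sym[OF assms(2,3)]
  show ?thesis
    using assms(1-4) s
    by (simp add: riemann_ssnm_def curvature_of_def bracket_rules koszul_ssnm_lift contraction_rules
        deriv_rules db_mixed metric_derivative_rules)
      (simp add: s algebra_simps power2_eq_square)
qed

text \<open>P is absent because it is orthogonal to all F-lifts. The products of a first derivative
  of b with K_F cancel by compatibility and vanishing torsion; those with a covariant derivative and
  the gradient of b remain as the terms with the inverse metric of F.\<close>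

lemma curvature_8:
  assumes "U \<in> F.VF" "V \<in> F.VF" "W \<in> F.VF" "Q \<in> F.VF"
  shows "R (L\<^sub>F U) (L\<^sub>F V) (L\<^sub>F W) (L\<^sub>F Q) p =
      (b p)\<^sup>2 * riemann A\<^sub>F g\<^sub>F U V W Q (snd p)
      + ((b p)\<^sup>2 * g\<^sub>B (fst p) (grad_fst p) (grad_fst p) + g\<^sub>F (snd p) (grad_snd p) (grad_snd p))
        * (metric_apply g\<^sub>F U W (snd p) * metric_apply g\<^sub>F V Q (snd p)
          - metric_apply g\<^sub>F V W (snd p) * metric_apply g\<^sub>F U Q (snd p))
      + (b p * vf_apply (L\<^sub>F U) (db (L\<^sub>F W)) p - 2 * db (L\<^sub>F U) p * db (L\<^sub>F W) p
          - b p * g\<^sub>F (snd p) (F.nabla U W (snd p)) (grad_snd p)) * metric_apply g\<^sub>F V Q (snd p)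
      + (b p * vf_apply (L\<^sub>F V) (db (L\<^sub>F Q)) p - 2 * db (L\<^sub>F V) p * db (L\<^sub>F Q) p
          - b p * g\<^sub>F (snd p) (F.nabla V Q (snd p)) (grad_snd p)) * metric_apply g\<^sub>F U W (snd p)
      - (b p * vf_apply (L\<^sub>F V) (db (L\<^sub>F W)) p - 2 * db (L\<^sub>F V) p * db (L\<^sub>F W) p
          - b p * g\<^sub>F (snd p) (F.nabla V W (snd p)) (grad_snd p)) * metric_apply g\<^sub>F U Q (snd p)
      - (b p * vf_apply (L\<^sub>F U) (db (L\<^sub>F Q)) p - 2 * db (L\<^sub>F U) p * db (L\<^sub>F Q) p
          - b p * g\<^sub>F (snd p) (F.nabla U Q (snd p)) (grad_snd p)) * metric_apply g\<^sub>F V W (snd p)"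
proof -
  note s = F.metric_apply_sym[OF assms(1,2)] F.metric_apply_sym[OF assms(1,3)] F.metric_apply_sym[OF assms(1,4)]
    F.metric_apply_sym[OF assms(2,3)] F.metric_apply_sym[OF assms(2,4)] F.metric_apply_sym[OF assms(3,4)]
  show ?thesis
    using assms s
    by (simp add: riemann_ssnm_def riemann_def curvature_of_def bracket_rules koszul_ssnm_lift contraction_rules
        contraction_nabla_snd deriv_rules db_lie_bracket_snd metric_derivative_rules)
      (simp add: s algebra_simps power2_eq_square)
qed

lemma inverse_metric_fst:
  "inverse_metric A\<^sub>B g\<^sub>B x (form_at A\<^sub>B (koszul g\<^sub>B X Y) x) (restrict_fst A\<^sub>B A\<^sub>F (x, y) (differential M b (x, y)))
    = g\<^sub>B x (B.nabla X Y x) (grad_fst (x, y))"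
  "inverse_metric A\<^sub>B g\<^sub>B x (restrict_fst A\<^sub>B A\<^sub>F (x, y) (differential M b (x, y)))
    (restrict_fst A\<^sub>B A\<^sub>F (x, y) (differential M b (x, y))) = g\<^sub>B x (grad_fst (x, y)) (grad_fst (x, y))"
  by (simp_all add: inverse_metric_def B.nabla_def grad_fst_def)

lemma inverse_metric_snd:
  "inverse_metric A\<^sub>F g\<^sub>F y (form_at A\<^sub>F (koszul g\<^sub>F U V) y) (restrict_snd A\<^sub>B A\<^sub>F (x, y) (differential M b (x, y)))
    = g\<^sub>F y (F.nabla U V y) (grad_snd (x, y))"
  "inverse_metric A\<^sub>F g\<^sub>F y (restrict_snd A\<^sub>B A\<^sub>F (x, y) (differential M b (x, y)))
    (restrict_snd A\<^sub>B A\<^sub>F (x, y) (differential M b (x, y))) = g\<^sub>F y (grad_snd (x, y)) (grad_snd (x, y))"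
  by (simp_all add: inverse_metric_def F.nabla_def grad_snd_def)

end

theorem theorem6p3:
  fixes A\<^sub>B :: "('b::{t2_space,second_countable_topology}, 'e::euclidean_space) atlas"
    and A\<^sub>F :: "('f::{t2_space,second_countable_topology}, 'd::euclidean_space) atlas"
    and g\<^sub>B :: "'b metric_tensor" and g\<^sub>F :: "'f metric_tensor"
    and b :: "'b \<times> 'f \<Rightarrow> real"
    and P X Y Z T :: "'b vfield" and U V W Q :: "'f vfield"
    and x :: 'b and y :: 'f
  defines "M \<equiv> prod_atlas A\<^sub>B A\<^sub>F"
    and "\<L>\<^sub>B \<equiv> lift_fst A\<^sub>B A\<^sub>F" and "\<L>\<^sub>F \<equiv> lift_snd A\<^sub>B A\<^sub>F"
  defines "R \<equiv> riemann_ssnm M (twisted_metric A\<^sub>B A\<^sub>F g\<^sub>B g\<^sub>F b) (\<L>\<^sub>B P)"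
    and "D \<equiv> (\<lambda>S h. vf_apply S h (x, y))"
    and "m\<^sub>B \<equiv> (\<lambda>S S'. metric_apply g\<^sub>B S S' x)" and "m\<^sub>F \<equiv> (\<lambda>S S'. metric_apply g\<^sub>F S S' y)"
    and "K\<^sub>F \<equiv> (\<lambda>S S' S''. koszul g\<^sub>F S S' S'' y)"
    and "db\<^sub>B \<equiv> restrict_fst A\<^sub>B A\<^sub>F (x, y) (differential M b (x, y))"
    and "db\<^sub>F \<equiv> restrict_snd A\<^sub>B A\<^sub>F (x, y) (differential M b (x, y))"
    and "N\<^sub>B \<equiv> (\<lambda>S S'. form_at A\<^sub>B (koszul g\<^sub>B S S') x)"
    and "N\<^sub>F \<equiv> (\<lambda>S S'. form_at A\<^sub>F (koszul g\<^sub>F S S') y)"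
    and "G\<^sub>B \<equiv> inverse_metric A\<^sub>B g\<^sub>B x" and "G\<^sub>F \<equiv> inverse_metric A\<^sub>F g\<^sub>F y"
  assumes "smooth_manifold A\<^sub>B" and "smooth_manifold A\<^sub>F"
    and "singular_semi_riemannian A\<^sub>B g\<^sub>B" and "nondegenerate A\<^sub>B g\<^sub>B"
    and "singular_semi_riemannian A\<^sub>F g\<^sub>F" and "nondegenerate A\<^sub>F g\<^sub>F"
    and "b \<in> smooth_functions M"
    and "\<And>p. b p = 0 \<Longrightarrow> differential M b p = 0"
    and "P \<in> vector_fields A\<^sub>B"
    and "X \<in> vector_fields A\<^sub>B" and "Y \<in> vector_fields A\<^sub>B"
    and "Z \<in> vector_fields A\<^sub>B" and "T \<in> vector_fields A\<^sub>B"
    and "U \<in> vector_fields A\<^sub>F" and "V \<in> vector_fields A\<^sub>F"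
    and "W \<in> vector_fields A\<^sub>F" and "Q \<in> vector_fields A\<^sub>F"
  shows
    "R (\<L>\<^sub>B X) (\<L>\<^sub>B Y) (\<L>\<^sub>B Z) (\<L>\<^sub>B T) (x, y) = riemann_ssnm A\<^sub>B g\<^sub>B P X Y Z T x \<and>
     R (\<L>\<^sub>B X) (\<L>\<^sub>B Y) (\<L>\<^sub>B Z) (\<L>\<^sub>F W) (x, y) = 0 \<and>
     R (\<L>\<^sub>B X) (\<L>\<^sub>B Y) (\<L>\<^sub>F W) (\<L>\<^sub>B Z) (x, y) = 0 \<and>
     R (\<L>\<^sub>B Z) (\<L>\<^sub>F W) (\<L>\<^sub>B X) (\<L>\<^sub>B Y) (x, y) = 0 \<and>
     R (\<L>\<^sub>B X) (\<L>\<^sub>B Y) (\<L>\<^sub>F V) (\<L>\<^sub>F W) (x, y) = 0 \<and>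
     R (\<L>\<^sub>F V) (\<L>\<^sub>F W) (\<L>\<^sub>B X) (\<L>\<^sub>B Y) (x, y) = 0 \<and>
     R (\<L>\<^sub>F V) (\<L>\<^sub>B X) (\<L>\<^sub>F W) (\<L>\<^sub>B Y) (x, y) = - R (\<L>\<^sub>B X) (\<L>\<^sub>F V) (\<L>\<^sub>F W) (\<L>\<^sub>B Y) (x, y) \<and>
     R (\<L>\<^sub>F V) (\<L>\<^sub>B X) (\<L>\<^sub>F W) (\<L>\<^sub>B Y) (x, y) =
       b (x, y) * D (\<L>\<^sub>B X) (vf_apply (\<L>\<^sub>B Y) b) * m\<^sub>F V W
       - b (x, y) * G\<^sub>B (N\<^sub>B X Y) db\<^sub>B * m\<^sub>F V W
       - 2 * b (x, y) * D (\<L>\<^sub>B X) b * m\<^sub>B Y P * m\<^sub>F V W \<and>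
     R (\<L>\<^sub>F V) (\<L>\<^sub>B X) (\<L>\<^sub>B Y) (\<L>\<^sub>F W) (x, y) = - R (\<L>\<^sub>B X) (\<L>\<^sub>F V) (\<L>\<^sub>B Y) (\<L>\<^sub>F W) (x, y) \<and>
     R (\<L>\<^sub>F V) (\<L>\<^sub>B X) (\<L>\<^sub>B Y) (\<L>\<^sub>F W) (x, y) =
       - b (x, y) * D (\<L>\<^sub>B X) (vf_apply (\<L>\<^sub>B Y) b) * m\<^sub>F V W
       + b (x, y) * G\<^sub>B (N\<^sub>B X Y) db\<^sub>B * m\<^sub>F V W
       - (b (x, y))\<^sup>2 * vf_apply X (metric_apply g\<^sub>B Y P) x * m\<^sub>F V W \<and>
     R (\<L>\<^sub>B X) (\<L>\<^sub>F U) (\<L>\<^sub>F V) (\<L>\<^sub>F W) (x, y) = R (\<L>\<^sub>F V) (\<L>\<^sub>F W) (\<L>\<^sub>B X) (\<L>\<^sub>F U) (x, y) \<and>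
     R (\<L>\<^sub>F V) (\<L>\<^sub>F W) (\<L>\<^sub>B X) (\<L>\<^sub>F U) (x, y) =
       b (x, y) * D (\<L>\<^sub>B X) (vf_apply (\<L>\<^sub>F V) b) * m\<^sub>F W U
       - D (\<L>\<^sub>B X) b * D (\<L>\<^sub>F V) b * m\<^sub>F W U
       - b (x, y) * D (\<L>\<^sub>B X) (vf_apply (\<L>\<^sub>F W) b) * m\<^sub>F U V
       + D (\<L>\<^sub>B X) b * D (\<L>\<^sub>F W) b * m\<^sub>F U V \<and>
     R (\<L>\<^sub>F V) (\<L>\<^sub>F W) (\<L>\<^sub>F U) (\<L>\<^sub>B X) (x, y) =
       - b (x, y) * D (\<L>\<^sub>B X) (vf_apply (\<L>\<^sub>F V) b) * m\<^sub>F W U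
       + D (\<L>\<^sub>B X) b * D (\<L>\<^sub>F V) b * m\<^sub>F W U
       + b (x, y) * D (\<L>\<^sub>B X) (vf_apply (\<L>\<^sub>F W) b) * m\<^sub>F U V
       - D (\<L>\<^sub>B X) b * D (\<L>\<^sub>F W) b * m\<^sub>F U V
       - 2 * b (x, y) * D (\<L>\<^sub>F W) b * m\<^sub>B X P * m\<^sub>F U V
       + 2 * b (x, y) * D (\<L>\<^sub>F V) b * m\<^sub>B X P * m\<^sub>F U W
       + (b (x, y))\<^sup>2 * m\<^sub>B X P * (K\<^sub>F V U W - K\<^sub>F W U V) \<and>
     R (\<L>\<^sub>F U) (\<L>\<^sub>F V) (\<L>\<^sub>F W) (\<L>\<^sub>F Q) (x, y) =
       (b (x, y))\<^sup>2 * riemann A\<^sub>F g\<^sub>F U V W Q y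
       + ((b (x, y))\<^sup>2 * G\<^sub>B db\<^sub>B db\<^sub>B + G\<^sub>F db\<^sub>F db\<^sub>F) * (m\<^sub>F U W * m\<^sub>F V Q - m\<^sub>F V W * m\<^sub>F U Q)
       + (b (x, y) * D (\<L>\<^sub>F U) (vf_apply (\<L>\<^sub>F W) b) - 2 * D (\<L>\<^sub>F U) b * D (\<L>\<^sub>F W) b
          - b (x, y) * G\<^sub>F (N\<^sub>F U W) db\<^sub>F) * m\<^sub>F V Q
       + (b (x, y) * D (\<L>\<^sub>F V) (vf_apply (\<L>\<^sub>F Q) b) - 2 * D (\<L>\<^sub>F V) b * D (\<L>\<^sub>F Q) b
          - b (x, y) * G\<^sub>F (N\<^sub>F V Q) db\<^sub>F) * m\<^sub>F U W
       - (b (x, y) * D (\<L>\<^sub>F V) (vf_apply (\<L>\<^sub>F W) b) - 2 * D (\<L>\<^sub>F V) b * D (\<L>\<^sub>F W) b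
          - b (x, y) * G\<^sub>F (N\<^sub>F V W) db\<^sub>F) * m\<^sub>F U Q
       - (b (x, y) * D (\<L>\<^sub>F U) (vf_apply (\<L>\<^sub>F Q) b) - 2 * D (\<L>\<^sub>F U) b * D (\<L>\<^sub>F Q) b
          - b (x, y) * G\<^sub>F (N\<^sub>F U Q) db\<^sub>F) * m\<^sub>F V W"
  (* In the identity for R V W U X the order in K_F(V,U,W) - K_F(W,U,V) is forced by the definition
     of R, which contributes g(X,P) * (K(V,U,W) - K(W,U,V)).  The printed source has the opposite
     order there, which already fails for b = 1. *)
proof -
  interpret twisted_product_field A\<^sub>B g\<^sub>B A\<^sub>F g\<^sub>F b P
    by unfold_locales (use assms in \<open>simp_all add: M_def\<close>)
  note VF = \<open>X \<in> B.VF\<close> \<open>Y \<in> B.VF\<close> \<open>Z \<in> B.VF\<close> \<open>T \<in> B.VF\<close>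
    \<open>U \<in> F.VF\<close> \<open>V \<in> F.VF\<close> \<open>W \<in> F.VF\<close> \<open>Q \<in> F.VF\<close>
  note defs = M_def \<L>\<^sub>B_def \<L>\<^sub>F_def R_def D_def m\<^sub>B_def m\<^sub>F_def K\<^sub>F_def db\<^sub>B_def db\<^sub>F_def
    N\<^sub>B_def N\<^sub>F_def G\<^sub>B_def G\<^sub>F_def
  let ?p = "(x, y)"
  show ?thesis
    unfolding defs inverse_metric_fst inverse_metric_snd
    using curvature_1[OF VF(1-4), of ?p] curvature_2[OF VF(1-3,7), of ?p] curvature_3[OF VF(1,2,6,7), of ?p]
      curvature_swap[OF VF(1,6) lift_snd_VF[OF VF(7)] lift_fst_VF[OF VF(2)], of ?p]
      curvature_swap[OF VF(1,6) lift_fst_VF[OF VF(2)] lift_snd_VF[OF VF(7)], of ?p]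
      curvature_4[OF VF(1,2,6,7), of ?p] curvature_5[OF VF(1,2,6,7), of ?p]
      curvature_6[OF VF(1,5,6,7), of ?p] curvature_7[OF VF(1,5,6,7), of ?p] curvature_8[OF VF(5-8), of ?p]
    unfolding fst_conv snd_conv
    by (intro conjI) (assumption | simp only:)+
qed

end
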